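(* For any hereditary $3$-graph property $\mathcal{H}$, one of the following holds. (1) For all $k\geq 1$, $k\otimes U(k)\in\text{Trip}(\mathcal{H})$. In this case, for some $C,C'>0$, $Tw(\epsilon^{-C})\leq M_{\mathcal{H}}(\epsilon)\leq Tw(\epsilon^{-C'})$ for all sufficiently small $\epsilon>0$. (2) For some $k\geq 1$, $k\otimes U(k)\notin\text{Trip}(\mathcal{H})$. In this case $M^{hom}_{\mathcal H}$ is defined and for some $K>0$, $M_{\mathcal{H}}(\epsilon)\leq M^{hom}_{\mathcal{H}}(\epsilon^4)\leq 2^{2^{\epsilon^{-K}}}$ for all sufficiently small $\epsilon>0$.
   Context: $3$-graphs $H=(V,E)$, $E\subseteq\binom V3$; hereditary $3$-graph properties are classes of finite $3$-graphs closed under isomorphism and induced sub-$3$-graphs. $d_H(X,Y,Z)=|\{(x,y,z)\in X\times Y\times Z:\{x,y,z\}\in E\}|/(|X||Y||Z|)$. A triple $(X,Y,Z)$ is $\epsilon$-regular if $|d_H(X,Y,Z)-d_H(X',Y',Z')|\le\epsilon$ for all subsets $X'\subseteq X,Y'\subseteq Y,Z'\subseteq Z$ of sizes at least $\epsilon|X|,\epsilon|Y|,\epsilon|Z|$; it is $\epsilon$-homogeneous if $d_H(X,Y,Z)\in[0,\epsilon)\cup(1-\epsilon,1]$. A partition $\mathcal P$ of $V$ is $\epsilon$-regular (resp. $\epsilon$-homogeneous) if at least $(1-\epsilon)|V|^3$ triples of $V^3$ lie in $X\times Y\times Z$ for some $\epsilon$-regular (resp. $\epsilon$-homogeneous) $(X,Y,Z)\in\mathcal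 P^3$. $M_{\mathcal H}(\epsilon)$ (resp. $M^{hom}_{\mathcal H}(\epsilon)$) is the least $M$ such that all sufficiently large members of $\mathcal H$ have an $\epsilon$-regular (resp. $\epsilon$-homogeneous) partition with at most $M$ parts; $M^{hom}_{\mathcal H}$ is defined when such $M$ exists for every $\epsilon$. $Tw(1)=1$, $Tw(i)=2^{Tw(i-1)}$. $\text{Trip}(H)$ has vertices $x_v,y_v,z_v$ ($v\in V$) and edges $x_vy_{v'}z_{v''}$ for $vv'v''\in E$; $\text{Trip}(\mathcal H)$ is the closure of $\{\text{Trip}(H):H\in\mathcal H\}$ under isomorphism and induced sub-$3$-graphs. $U(k)$ is the bipartite graph with parts $\{a_1,\dots,a_k\}$, $\{b_S:S\subseteq[k]\}$ and edges $a_ib_S$ for $i\in S$. For a bipartite graph $G=(U\cup V,E)$, $n\otimes G$ is the $3$-graph on $U\cup V\cup\{c_1,\dots,c_n\}$ (new $c_i$) with edges $\{c_i,u,w\}$ for $uw\in E$. *)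

theory Defs
  imports Complex_Main "HOL-Library.Disjoint_Sets"
begin

type_synonym 'a hg = "'a set \<times> 'a set set"

definition is_3graph :: "'a hg \<Rightarrow> bool" where
  "is_3graph G \<longleftrightarrow> finite (fst G) \<and> (\<forall>e\<in>snd G. e \<subseteq> fst G \<and> card e = 3)"

definition hg_iso :: "'a hg \<Rightarrow> 'b hg \<Rightarrow> bool" where
  "hg_iso G G' \<longleftrightarrow> (\<exists>f. bij_betw f (fst G) (fst G') \<and> snd G' = (\<lambda>e. f ` e) ` snd G)"

definition induced :: "'a hg \<Rightarrow> 'a set \<Rightarrow> 'a hg" where
  "induced G W = (W, {e \<in> snd G. e \<subseteq> W})"

text \<open>A hereditary 3-graph property: a class of finite 3-graphs (represented on vertex
  type nat; every finite 3-graph is isomorphic to one of these) closed under isomorphism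
  and induced sub-3-graphs.\<close>
definition hereditary :: "nat hg set \<Rightarrow> bool" where
  "hereditary \<H> \<longleftrightarrow>
     (\<forall>G\<in>\<H>. is_3graph G) \<and>
     (\<forall>G\<in>\<H>. \<forall>G'::nat hg. is_3graph G' \<and> hg_iso G G' \<longrightarrow> G' \<in> \<H>) \<and>
     (\<forall>G\<in>\<H>. \<forall>W. W \<subseteq> fst G \<longrightarrow> induced G W \<in> \<H>)"

definition dens :: "'a hg \<Rightarrow> 'a set \<Rightarrow> 'a set \<Rightarrow> 'a set \<Rightarrow> real" where
  "dens G X Y Z =
     real (card {(x, y, z). x \<in> X \<and> y \<in> Y \<and> z \<in> Z \<and> {x, y, z} \<in> snd G})
     / (real (card X) * real (card Y) * real (card Z))"

definition reg_triple :: "'a hg \<Rightarrow> real \<Rightarrow> 'a set \<Rightarrow> 'a set \<Rightarrow> 'a set \<Rightarrow> bool" where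
  "reg_triple G \<epsilon> X Y Z \<longleftrightarrow>
     (\<forall>X' Y' Z'. X' \<subseteq> X \<and> Y' \<subseteq> Y \<and> Z' \<subseteq> Z \<and>
        real (card X') \<ge> \<epsilon> * real (card X) \<and> real (card Y') \<ge> \<epsilon> * real (card Y) \<and>
        real (card Z') \<ge> \<epsilon> * real (card Z) \<longrightarrow>
        \<bar>dens G X Y Z - dens G X' Y' Z'\<bar> \<le> \<epsilon>)"

definition hom_triple :: "'a hg \<Rightarrow> real \<Rightarrow> 'a set \<Rightarrow> 'a set \<Rightarrow> 'a set \<Rightarrow> bool" where
  "hom_triple G \<epsilon> X Y Z \<longleftrightarrow>
     (0 \<le> dens G X Y Z \<and> dens G X Y Z < \<epsilon>) \<or> (1 - \<epsilon> < dens G X Y Z \<and> dens G X Y Z \<le> 1)"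

definition good_partition ::
  "('a set \<Rightarrow> 'a set \<Rightarrow> 'a set \<Rightarrow> bool) \<Rightarrow> 'a hg \<Rightarrow> real \<Rightarrow> 'a set set \<Rightarrow> bool" where
  "good_partition Q G \<epsilon> P \<longleftrightarrow> partition_on (fst G) P \<and>
     real (card {(x, y, z). x \<in> fst G \<and> y \<in> fst G \<and> z \<in> fst G \<and>
        (\<exists>X\<in>P. \<exists>Y\<in>P. \<exists>Z\<in>P. Q X Y Z \<and> x \<in> X \<and> y \<in> Y \<and> z \<in> Z)})
       \<ge> (1 - \<epsilon>) * real (card (fst G)) ^ 3"

definition reg_partition :: "'a hg \<Rightarrow> real \<Rightarrow> 'a set set \<Rightarrow> bool" where
  "reg_partition G \<epsilon> P \<longleftrightarrow> good_partition (reg_triple G \<epsilon>) G \<epsilon> P"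

definition hom_partition :: "'a hg \<Rightarrow> real \<Rightarrow> 'a set set \<Rightarrow> bool" where
  "hom_partition G \<epsilon> P \<longleftrightarrow> good_partition (hom_triple G \<epsilon>) G \<epsilon> P"

definition admits_reg :: "nat hg set \<Rightarrow> real \<Rightarrow> nat \<Rightarrow> bool" where
  "admits_reg \<H> \<epsilon> M \<longleftrightarrow>
     (\<exists>N. \<forall>G\<in>\<H>. card (fst G) \<ge> N \<longrightarrow> (\<exists>P. reg_partition G \<epsilon> P \<and> card P \<le> M))"

definition admits_hom :: "nat hg set \<Rightarrow> real \<Rightarrow> nat \<Rightarrow> bool" where
  "admits_hom \<H> \<epsilon> M \<longleftrightarrow>
     (\<exists>N. \<forall>G\<in>\<H>. card (fst G) \<ge> N \<longrightarrow> (\<exists>P. hom_partition G \<epsilon> P \<and> card P \<le> M))"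

definition M_reg :: "nat hg set \<Rightarrow> real \<Rightarrow> nat" where
  "M_reg \<H> \<epsilon> = (LEAST M. admits_reg \<H> \<epsilon> M)"

definition M_hom :: "nat hg set \<Rightarrow> real \<Rightarrow> nat" where
  "M_hom \<H> \<epsilon> = (LEAST M. admits_hom \<H> \<epsilon> M)"

definition M_hom_defined :: "nat hg set \<Rightarrow> bool" where
  "M_hom_defined \<H> \<longleftrightarrow> (\<forall>\<epsilon>>0. \<exists>M. admits_hom \<H> \<epsilon> M)"

text \<open>Tower function: Tw(1) = 1, Tw(i) = 2^Tw(i-1); Tw 0 is set to 1 (never used
  for epsilon < 1).\<close>
fun Tw :: "nat \<Rightarrow> nat" where
  "Tw 0 = 1"
| "Tw (Suc 0) = 1"
| "Tw (Suc (Suc n)) = 2 ^ Tw (Suc n)"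

definition trip :: "'a hg \<Rightarrow> ('a \<times> nat) hg" where
  "trip G = ((\<Union>v\<in>fst G. {(v, 0), (v, 1), (v, 2)}),
             {{(v, 0), (v', 1), (v'', 2)} | v v' v''. {v, v', v''} \<in> snd G})"

text \<open>Membership of an arbitrary 3-graph in Trip(H), the closure of
  {trip G. G \<in> H} under isomorphism and induced sub-3-graphs.\<close>
definition in_Trip :: "nat hg set \<Rightarrow> 'b hg \<Rightarrow> bool" where
  "in_Trip \<H> F \<longleftrightarrow> is_3graph F \<and>
     (\<exists>G\<in>\<H>. \<exists>W. W \<subseteq> fst (trip G) \<and> hg_iso F (induced (trip G) W))"

text \<open>Bipartite graphs: (U, V, E) with E a set of 2-sets {u,w}, u \<in> U, w \<in> V.\<close>
type_synonym 'a bigraph = "'a set \<times> 'a set \<times> 'a set set"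

definition Ubip :: "nat \<Rightarrow> (nat + nat set) bigraph" where
  "Ubip k = (Inl ` {1..k}, Inr ` Pow {1..k},
             {{Inl i, Inr S} | i S. i \<in> {1..k} \<and> S \<subseteq> {1..k} \<and> i \<in> S})"

definition tensor :: "nat \<Rightarrow> 'a bigraph \<Rightarrow> (nat + 'a) hg" where
  "tensor n B = (case B of (U, V, E) \<Rightarrow>
     (Inl ` {1..n} \<union> Inr ` (U \<union> V),
      {{Inl i, Inr u, Inr w} | i u w. i \<in> {1..n} \<and> {u, w} \<in> E}))"

end

theory Submission
  imports Defs "HOL-Library.FuncSet" "HOL-Analysis.Convex" "HOL-Real_Asymp.Real_Asymp"
begin

text \<open>
  If \<open>k \<otimes> U(k)\<close> is missing, then for every sample \<open>A\<close> of bounded size all but boundedly many vertices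
  \<open>w\<close> have a link in which no \<open>k\<close>-subset of \<open>A\<close> is shattered by positively many vertices. By Haussler's
  bound on one-inclusion graphs, the trace of \<open>x\<close> on a random sample \<open>A\<close> in the link of \<open>w\<close> then
  determines the neighbourhood of \<open>x\<close> in that link up to a small error. Each pair \<open>{a, z}\<close> entering the
  trace of \<open>x\<close> in the link of \<open>z\<close> is itself predicted, in the link of \<open>a\<close>, by the trace of \<open>x\<close> on a
  second sample \<open>B\<close>. So the edge relation is close in \<open>L\<^sup>1\<close> to a function of \<open>y\<close>, \<open>z\<close> and the pattern
  of \<open>x\<close> on \<open>A \<times> B\<close>, which takes at most \<open>2\<close> to the power \<open>|A| |B|\<close> values; averaging over the pattern
  classes in all three coordinates gives a homogeneous partition.

  If every \<open>k \<otimes> U(k)\<close> occurs, then some member of the property carries, behind a common apex set \<open>C\<close>,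
  a chain of layers \<open>B\<^sub>0, B\<^sub>1, \<dots>\<close> in which the clusters of \<open>B\<^sub>i\<^sub>+\<^sub>1\<close> are indexed by the words of a
  binary code whose coordinates are the clusters of \<open>B\<^sub>i\<close>. A regular partition that respects the clusters of
  \<open>B\<^sub>i\<close> must respect those of \<open>B\<^sub>i\<^sub>+\<^sub>1\<close>, since a part mixing codewords is cut evenly by a positive
  proportion of the coordinates. The errors do not accumulate along the chain, and the number of clusters
  grows exponentially at each step. The matching upper bound is the usual energy increment.
\<close>

section \<open>Regular and homogeneous partitions\<close>

text \<open>The trace of \<open>x\<close> on \<open>A\<close> in the link of \<open>z\<close> varies
  with \<open>z\<close>, so it cannot colour \<open>x\<close> by itself; the second sample is what
  removes \<open>z\<close> from the colour. Sampling is analysed by leaving one point out: in a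
  random set of \<open>s + 1\<close> points, one is predicted from the others with relative error of
  order \<open>k / s\<close>. Hence both samples are polynomial in \<open>1 / \<epsilon>\<close>. In
  the tower bound, a union bound over clusters is affordable only in the bottom layer, which has 64
  of them. Higher up, alignment replaces it: each part has a single dominant cluster, and only that
  one has to be tested. A step of the chain tolerates a loss of \<open>N / 16\<close> points below
  and guarantees \<open>N / 32\<close> above, whatever the layer; this is why errors do not grow.
  The number of layers is limited by dilution alone: \<open>s + 2\<close> sets of size
  \<open>N\<close> share the vertex set, so irregular triples are allowed up to
  \<open>\<epsilon> * (s + 2) ^ 3\<close> times \<open>N ^ 3\<close>, and \<open>s\<close> can be a
  power of \<open>1 / \<epsilon>\<close>. Partitions are handled as the fibres of colourings
  throughout.\<close>

definition cell :: "'a set \<Rightarrow> ('a \<Rightarrow> 'c) \<Rightarrow> 'a \<Rightarrow> 'a set" where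
  "cell V c x = {x' \<in> V. c x' = c x}"

lemma mem_cell_self: "x \<in> V \<Longrightarrow> x \<in> cell V c x"
  by (auto simp: cell_def)

lemma partition_on_cells: "partition_on V (cell V c ` V)"
  by (rule partition_onI) (auto simp: cell_def disjnt_def)

lemma card_cells_le:
  assumes "finite V" shows "card (cell V c ` V) \<le> card (c ` V)"
proof -
  have "cell V c ` V = (\<lambda>t. {x' \<in> V. c x' = t}) ` (c ` V)"
    by (auto simp: cell_def image_image)
  then show ?thesis
    using card_image_le[of "c ` V" "\<lambda>t. {x' \<in> V. c x' = t}"] assms by auto
qed

text \<open>A vertex lies in only one part, so the existential over \<open>P\<close> is decided by
  \<open>p x\<close>, \<open>p y\<close>, \<open>p z\<close>. Counting exceptional triples instead
  of good ones lets errors be added.\<close>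

lemma good_partition_iff:
  fixes G :: "'a hg"
  assumes fin: "finite (fst G)" and P: "partition_on (fst G) P"
    and p: "\<And>x. x \<in> fst G \<Longrightarrow> p x \<in> P \<and> x \<in> p x"
  shows "good_partition Q G \<epsilon> P \<longleftrightarrow>
    real (card {(x, y, z) \<in> fst G \<times> fst G \<times> fst G. \<not> Q (p x) (p y) (p z)}) \<le> \<epsilon> * real (card (fst G)) ^ 3"
proof -
  let ?V = "fst G"
  let ?T = "?V \<times> ?V \<times> ?V"
  let ?g = "{(x, y, z). x \<in> ?V \<and> y \<in> ?V \<and> z \<in> ?V \<and>
        (\<exists>X\<in>P. \<exists>Y\<in>P. \<exists>Z\<in>P. Q X Y Z \<and> x \<in> X \<and> y \<in> Y \<and> z \<in> Z)}"
  let ?b = "{(x, y, z) \<in> ?T. \<not> Q (p x) (p y) (p z)}"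
  have uniq: "X = p x" if "X \<in> P" "x \<in> X" for X x
  proof -
    have "x \<in> ?V" using P that by (auto simp: partition_on_def)
    then show ?thesis
      using p that partition_onD2[OF P] unfolding disjoint_def by blast
  qed
  have g: "?g = ?T - ?b"
  proof (intro set_eqI iffI)
    fix t assume "t \<in> ?g" then show "t \<in> ?T - ?b" using uniq by auto
  next
    fix t assume "t \<in> ?T - ?b" 
    then obtain x y z where "t = (x, y, z)" "x \<in> ?V" "y \<in> ?V" "z \<in> ?V" "Q (p x) (p y) (p z)" by auto
    then show "t \<in> ?g" using p[of x] p[of y] p[of z] by blast
  qed
  have "?b \<subseteq> ?T" by auto
  then have "card ?g = card ?T - card ?b" "card ?b \<le> card ?T"
    unfolding g using fin by (meson card_Diff_subset card_mono finite_SigmaI finite_subset)+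
  then have "real (card ?g) = real (card ?V) ^ 3 - real (card ?b)"
    by (simp add: of_nat_diff card_cartesian_product power3_eq_cube)
  then show ?thesis
    unfolding good_partition_def using P by (simp add: left_diff_distrib)
qed

definition triples :: "'a hg \<Rightarrow> 'a set \<Rightarrow> 'a set \<Rightarrow> 'a set \<Rightarrow> ('a \<times> 'a \<times> 'a) set" where
  "triples G X Y Z = {(x, y, z). x \<in> X \<and> y \<in> Y \<and> z \<in> Z \<and> {x, y, z} \<in> snd G}"

lemma triples_subset: "triples G X Y Z \<subseteq> X \<times> Y \<times> Z"
  by (auto simp: triples_def)

lemma dens_eq: "dens G X Y Z = real (card (triples G X Y Z)) / (real (card X) * real (card Y) * real (card Z))"
  by (simp add: dens_def triples_def)

lemma card_triples_le:
  assumes "finite X" "finite Y" "finite Z"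
  shows "real (card (triples G X Y Z)) \<le> real (card X) * real (card Y) * real (card Z)"
proof -
  have "card (triples G X Y Z) \<le> card (X \<times> Y \<times> Z)"
    using assms by (intro card_mono triples_subset) simp
  then show ?thesis
    by (simp add: card_cartesian_product mult.assoc flip: of_nat_mult)
qed

lemma dens_bounds:
  assumes "finite X" "finite Y" "finite Z"
  shows "0 \<le> dens G X Y Z" "dens G X Y Z \<le> 1"
proof -
  show "0 \<le> dens G X Y Z" by (simp add: dens_eq)
  have "0 \<le> real (card X) * real (card Y) * real (card Z)" by simp
  then show "dens G X Y Z \<le> 1"
    using card_triples_le[OF assms, of G] unfolding dens_eq divide_le_eq_1 by linarith
qed

text \<open>The fourth power pays for the passage to subsets: a sub-box with sides of share
  \<open>\<epsilon>\<close> keeps at least \<open>\<epsilon> ^ 3\<close> of the volume, so a share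
  \<open>\<epsilon> ^ 4\<close> of exceptional triples in the box is at most a share
  \<open>\<epsilon>\<close> of the sub-box. Both densities then lie within \<open>\<epsilon>\<close>
  of the same endpoint 0 or 1.\<close>

lemma hom_triple_imp_reg_triple:
  assumes fin: "finite X" "finite Y" "finite Z" and ne: "X \<noteq> {}" "Y \<noteq> {}" "Z \<noteq> {}"
    and eps: "0 < \<epsilon>" "\<epsilon> \<le> 1" and hom: "hom_triple G (\<epsilon> ^ 4) X Y Z"
  shows "reg_triple G \<epsilon> X Y Z"
  unfolding reg_triple_def
proof (intro allI impI, elim conjE)
  fix X' Y' Z'
  assume sub: "X' \<subseteq> X" "Y' \<subseteq> Y" "Z' \<subseteq> Z"
    and sz: "\<epsilon> * real (card X) \<le> real (card X')" "\<epsilon> * real (card Y) \<le> real (card Y')"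
      "\<epsilon> * real (card Z) \<le> real (card Z')"
  have fin': "finite X'" "finite Y'" "finite Z'"
    using sub fin by (auto intro: finite_subset)
  define p where "p = real (card X) * real (card Y) * real (card Z)"
  define p' where "p' = real (card X') * real (card Y') * real (card Z')"
  let ?e = "real (card (triples G X Y Z))" and ?e' = "real (card (triples G X' Y' Z'))"
  have p0: "0 < p" using fin ne by (auto simp: p_def card_gt_0_iff)
  have "(\<epsilon> * real (card X)) * (\<epsilon> * real (card Y)) * (\<epsilon> * real (card Z)) \<le> p'"
    unfolding p'_def using sz eps by (intro mult_mono) auto
  then have pp': "\<epsilon> ^ 3 * p \<le> p'"
    by (simp add: p_def power3_eq_cube algebra_simps)
  have p'0: "0 < p'" using pp' p0 eps by (smt (verit) mult_pos_pos zero_less_power)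
  have ft: "finite (X \<times> Y \<times> Z)" "finite (X' \<times> Y' \<times> Z')" using fin fin' by auto
  have e: "?e' \<le> ?e"
    using sub ft triples_subset[of G X Y Z]
    by (intro of_nat_mono card_mono) (auto simp: triples_def intro: finite_subset)
  have "card (X' \<times> Y' \<times> Z' - triples G X' Y' Z') \<le> card (X \<times> Y \<times> Z - triples G X Y Z)"
    using sub ft by (intro card_mono) (auto simp: triples_def)
  then have "real (card (X' \<times> Y' \<times> Z')) - ?e' \<le> real (card (X \<times> Y \<times> Z)) - ?e"
    using ft triples_subset[of G X Y Z] triples_subset[of G X' Y' Z']
    by (simp add: card_Diff_subset finite_subset card_mono flip: of_nat_diff)
  then have ne: "p' - ?e' \<le> p - ?e"
    by (simp add: p_def p'_def card_cartesian_product mult.assoc)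
  have small: "\<epsilon> ^ 4 * p \<le> \<epsilon> * p'"
    using mult_left_mono[OF pp', of \<epsilon>] eps by (simp add: power_numeral_reduce algebra_simps)
  have d: "dens G X Y Z = ?e / p" and d': "dens G X' Y' Z' = ?e' / p'"
    by (simp_all add: dens_eq p_def p'_def)
  have e4: "\<epsilon> ^ 4 \<le> \<epsilon>"
    using power_decreasing[of 1 4 \<epsilon>] eps by simp
  note b = dens_bounds[OF fin, of G] dens_bounds[OF fin', of G]
  from hom consider "dens G X Y Z < \<epsilon> ^ 4" | "1 - \<epsilon> ^ 4 < dens G X Y Z"
    unfolding hom_triple_def by blast
  then show "\<bar>dens G X Y Z - dens G X' Y' Z'\<bar> \<le> \<epsilon>"
  proof cases
    case 1
    then have "?e < \<epsilon> ^ 4 * p" using p0 by (simp add: d divide_less_eq)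
    then have "?e' \<le> \<epsilon> * p'" using e small by linarith
    then have "dens G X' Y' Z' \<le> \<epsilon>" using p'0 by (simp add: d' divide_le_eq)
    then show ?thesis using 1 b e4 by linarith
  next
    case 2
    then have "(1 - \<epsilon> ^ 4) * p < ?e" using p0 by (simp add: d less_divide_eq)
    then have "(1 - \<epsilon>) * p' \<le> ?e'" using ne small by (simp add: algebra_simps)
    then have "1 - \<epsilon> \<le> dens G X' Y' Z'" using p'0 by (simp add: d' le_divide_eq)
    then show ?thesis using 2 b e4 by linarith
  qed
qed

lemma hom_partition_imp_reg_partition:
  assumes "finite (fst G)" and eps: "0 < \<epsilon>" "\<epsilon> \<le> 1" and hom: "hom_partition G (\<epsilon> ^ 4) P"
  shows "reg_partition G \<epsilon> P"
proof -
  let ?V = "fst G"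
  have P: "partition_on ?V P"
    using hom by (auto simp: hom_partition_def good_partition_def)
  have triple: "reg_triple G \<epsilon> X Y Z" if "X \<in> P" "Y \<in> P" "Z \<in> P" "hom_triple G (\<epsilon> ^ 4) X Y Z" for X Y Z
    using that P assms(1) partition_onD3[OF P]
    by (intro hom_triple_imp_reg_triple eps) (auto simp: partition_on_def dest: finite_subset[rotated])
  let ?S = "\<lambda>Q. {(x, y, z). x \<in> ?V \<and> y \<in> ?V \<and> z \<in> ?V \<and>
        (\<exists>X\<in>P. \<exists>Y\<in>P. \<exists>Z\<in>P. Q X Y Z \<and> x \<in> X \<and> y \<in> Y \<and> z \<in> Z)}"
  have "?S (reg_triple G \<epsilon>) \<subseteq> ?V \<times> ?V \<times> ?V" by auto
  then have "finite (?S (reg_triple G \<epsilon>))"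
    using assms(1) by (meson finite_SigmaI finite_subset)
  moreover have "?S (hom_triple G (\<epsilon> ^ 4)) \<subseteq> ?S (reg_triple G \<epsilon>)"
    using triple by blast
  ultimately have "card (?S (hom_triple G (\<epsilon> ^ 4))) \<le> card (?S (reg_triple G \<epsilon>))"
    by (intro card_mono)
  moreover have "(1 - \<epsilon>) * real (card ?V) ^ 3 \<le> (1 - \<epsilon> ^ 4) * real (card ?V) ^ 3"
    using power_decreasing[of 1 4 \<epsilon>] eps by (intro mult_right_mono) auto
  ultimately show ?thesis
    using hom unfolding hom_partition_def reg_partition_def good_partition_def by linarith
qed

lemma M_reg_le_M_hom:
  assumes "\<forall>G\<in>\<H>. is_3graph G" and eps: "0 < \<epsilon>" "\<epsilon> \<le> 1" and M: "admits_hom \<H> (\<epsilon> ^ 4) M"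
  shows "M_reg \<H> \<epsilon> \<le> M_hom \<H> (\<epsilon> ^ 4)"
proof -
  have "admits_hom \<H> (\<epsilon> ^ 4) (M_hom \<H> (\<epsilon> ^ 4))"
    unfolding M_hom_def using M by (rule LeastI)
  then have "admits_reg \<H> \<epsilon> (M_hom \<H> (\<epsilon> ^ 4))"
    unfolding admits_hom_def admits_reg_def
    using hom_partition_imp_reg_partition[OF _ eps] assms(1) unfolding is_3graph_def by metis
  then show ?thesis
    unfolding M_reg_def by (rule Least_le)
qed

section \<open>The one-inclusion graph of a set family\<close>

definition shatters :: "'a set set \<Rightarrow> 'a set \<Rightarrow> bool" where
  "shatters F J \<longleftrightarrow> Pow J \<subseteq> (\<lambda>v. v \<inter> J) ` F"

lemma shatters_trace_mono:
  "shatters F J \<Longrightarrow> (\<lambda>v. v \<inter> J) ` F \<subseteq> (\<lambda>v. v \<inter> J) ` F' \<Longrightarrow> shatters F' J"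
  unfolding shatters_def by (rule order_trans)

text \<open>Edges of the cube on \<open>Y\<close> with both ends in \<open>F\<close>; an edge is
  stored as its direction \<open>y\<close> and its lower end \<open>T\<close>.\<close>

definition one_incl :: "'a set set \<Rightarrow> 'a set \<Rightarrow> ('a \<times> 'a set) set" where
  "one_incl F Y = {(y, T). y \<in> Y \<and> y \<notin> T \<and> T \<in> F \<and> insert y T \<in> F}"

lemma finite_one_incl: "finite F \<Longrightarrow> finite Y \<Longrightarrow> finite (one_incl F Y)"
  by (rule finite_subset[of _ "Y \<times> F"]) (auto simp: one_incl_def)

text \<open>Induction on the ground set: removing a point \<open>e\<close> replaces \<open>F\<close>
  by its trace on \<open>Y\<close> and by the family of sets with two extensions, whose sizes add up
  to that of \<open>F\<close>. The second family shatters no set of size \<open>k - 1\<close>, and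
  this saving of one pays for the edges in direction \<open>e\<close>.\<close>

lemma card_one_incl_le:
  assumes "finite Y" "F \<subseteq> Pow Y" "\<And>J. J \<subseteq> Y \<Longrightarrow> card J = k \<Longrightarrow> \<not> shatters F J"
  shows "card (one_incl F Y) \<le> k * card F"
  using assms
proof (induction Y arbitrary: F k rule: finite_induct)
  case empty
  then show ?case by (simp add: one_incl_def)
next
  case (insert e Y)
  show ?case
  proof (cases k)
    case 0
    then have "\<not> shatters F {}" using insert.prems(2)[of "{}"] by simp
    then have "F = {}" by (auto simp: shatters_def)
    then show ?thesis by (simp add: one_incl_def)
  next
    case (Suc k')
    have finF: "finite F" using insert.prems(1) insert.hyps(1) by (meson finite_Pow_iff finite_insert finite_subset)
    \<comment> \<open>\<open>F0\<close> and \<open>F0'\<close> are the members without and with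
      \<open>e\<close>, both read as subsets of \<open>Y\<close>. Their union is the trace of
      \<open>F\<close> on \<open>Y\<close>; their intersection collects the sets whose two
      extensions both lie in \<open>F\<close>.\<close>
    define F0 where "F0 = {v \<in> F. e \<notin> v}"
    define F0' where "F0' = (\<lambda>v. v - {e}) ` {v \<in> F. e \<in> v}"
    have "F = F0 \<union> {v \<in> F. e \<in> v}" "F0 \<inter> {v \<in> F. e \<in> v} = {}" by (auto simp: F0_def)
    then have "card F = card F0 + card {v \<in> F. e \<in> v}"
      using finF card_Un_disjoint[of F0 "{v \<in> F. e \<in> v}"] by (auto simp: F0_def)
    moreover have "card F0' = card {v \<in> F. e \<in> v}"
      unfolding F0'_def by (rule card_image) (auto simp: inj_on_def)
    moreover have "card F0 + card F0' = card (F0 \<union> F0') + card (F0 \<inter> F0')"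
      by (rule card_Un_Int) (auto simp: F0_def F0'_def finF)
    ultimately have cF: "card F = card (F0 \<union> F0') + card (F0 \<inter> F0')" by simp
    have F2: "F0 \<inter> F0' = {v. e \<notin> v \<and> v \<in> F \<and> insert e v \<in> F}"
    proof (intro set_eqI iffI)
      fix v assume "v \<in> F0 \<inter> F0'"
      then show "v \<in> {v. e \<notin> v \<and> v \<in> F \<and> insert e v \<in> F}"
        by (auto simp: F0_def F0'_def insert_absorb)
    next
      fix v assume "v \<in> {v. e \<notin> v \<and> v \<in> F \<and> insert e v \<in> F}"
      then show "v \<in> F0 \<inter> F0'"
        by (auto simp: F0_def F0'_def intro!: image_eqI[of _ _ "insert e v"])
    qed
    have memU: "T - {e} \<in> F0 \<union> F0'" if "T \<in> F" for T
      using that by (cases "e \<in> T") (auto simp: F0_def F0'_def)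
    have IH1: "card (one_incl (F0 \<union> F0') Y) \<le> k * card (F0 \<union> F0')"
    proof (rule insert.IH)
      show "F0 \<union> F0' \<subseteq> Pow Y" using insert.prems(1) by (auto simp: F0_def F0'_def)
    next
      fix J assume J: "J \<subseteq> Y" "card J = k"
      have "e \<notin> J" using J insert.hyps by auto
      then have sub: "(\<lambda>v. v \<inter> J) ` (F0 \<union> F0') \<subseteq> (\<lambda>v. v \<inter> J) ` F"
        by (auto simp: F0_def F0'_def image_iff)
      show "\<not> shatters (F0 \<union> F0') J"
        using insert.prems(2)[OF subset_insertI2[OF J(1)] J(2)] shatters_trace_mono[OF _ sub] by (rule contrapos_nn)
    qed
    have IH2: "card (one_incl (F0 \<inter> F0') Y) \<le> k' * card (F0 \<inter> F0')"
    proof (rule insert.IH)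
      show "F0 \<inter> F0' \<subseteq> Pow Y" using insert.prems(1) by (auto simp: F0_def)
    next
      fix J assume J: "J \<subseteq> Y" "card J = k'"
      have eJ: "e \<notin> J" using J insert.hyps by auto
      show "\<not> shatters (F0 \<inter> F0') J"
      proof
        assume sh: "shatters (F0 \<inter> F0') J"
        have "shatters F (insert e J)"
          unfolding shatters_def
        proof
          fix S assume S: "S \<in> Pow (insert e J)"
          then have "S - {e} \<in> Pow J" by auto
          then obtain v where v: "v \<in> F0 \<inter> F0'" "S - {e} = v \<inter> J"
            using sh unfolding shatters_def by blast
          then have v': "e \<notin> v" "v \<in> F" "insert e v \<in> F" using F2 by auto
          show "S \<in> (\<lambda>v. v \<inter> insert e J) ` F"
          proof (cases "e \<in> S")
            case True
            then have "S = insert e v \<inter> insert e J" using v by auto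
            then show ?thesis using v' by blast
          next
            case False
            then have "S = v \<inter> insert e J" using v v' by auto
            then show ?thesis using v' by blast
          qed
        qed
        moreover have "card (insert e J) = k"
          using J eJ insert.hyps Suc by (auto simp: card_insert_if dest: finite_subset)
        ultimately show False using insert.prems(2)[of "insert e J"] J by blast
      qed
    qed
    \<comment> \<open>Edges in direction \<open>e\<close> correspond to
      \<open>F0 \<inter> F0'\<close>. The others form \<open>D0\<close> and \<open>D1\<close>; with
      \<open>e\<close> erased they lie in the graph of the union, and an edge reached from both lies
      in the graph of the intersection.\<close>
    define D0 where "D0 = {(y, T) \<in> one_incl F (insert e Y). y \<noteq> e \<and> e \<notin> T}"
    define D1 where "D1 = {(y, T) \<in> one_incl F (insert e Y). y \<noteq> e \<and> e \<in> T}"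
    define D1' where "D1' = (\<lambda>(y, T). (y, T - {e})) ` D1"
    have fin: "finite (one_incl F (insert e Y))"
      by (simp add: finite_one_incl finF insert.hyps)
    have finD01: "finite D0" "finite D1"
      by (rule finite_subset[OF _ fin], auto simp: D0_def D1_def)+
    then have finD: "finite D0" "finite D1" "finite D1'"
      by (simp_all add: D1'_def)
    have sub: "one_incl F (insert e Y) \<subseteq> Pair e ` (F0 \<inter> F0') \<union> D0 \<union> D1"
      unfolding F2 by (auto simp: D0_def D1_def one_incl_def)
    have finU: "finite (F0 \<inter> F0')" "finite (F0 \<union> F0')" using finF by (auto simp: F0_def F0'_def)
    have "card (one_incl F (insert e Y)) \<le> card (Pair e ` (F0 \<inter> F0') \<union> D0 \<union> D1)"
      using sub finD finU by (intro card_mono) auto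
    also have "\<dots> \<le> card (Pair e ` (F0 \<inter> F0') \<union> D0) + card D1" by (rule card_Un_le)
    also have "\<dots> \<le> card (Pair e ` (F0 \<inter> F0')) + card D0 + card D1" by (simp add: card_Un_le)
    also have "card (Pair e ` (F0 \<inter> F0')) = card (F0 \<inter> F0')" by (rule card_image) (simp add: inj_on_def)
    also have "card D1 = card D1'"
      unfolding D1'_def by (rule card_image[symmetric]) (auto simp: inj_on_def D1_def)
    finally have "card (one_incl F (insert e Y)) \<le> card (F0 \<inter> F0') + (card D0 + card D1')" by simp
    also have "card D0 + card D1' = card (D0 \<union> D1') + card (D0 \<inter> D1')"
      using finD by (intro card_Un_Int)
    also have "card (D0 \<union> D1') \<le> card (one_incl (F0 \<union> F0') Y)"
    proof (intro card_mono finite_one_incl finU insert.hyps(1) subsetI)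
      fix t assume "t \<in> D0 \<union> D1'"
      then consider y T where "t = (y, T)" "(y, T) \<in> D0" | y T where "t = (y, T - {e})" "(y, T) \<in> D1"
        by (cases t) (auto simp: D1'_def)
      then show "t \<in> one_incl (F0 \<union> F0') Y"
      proof cases
        case 1
        then show ?thesis by (auto simp: D0_def one_incl_def F0_def)
      next
        case 2
        then have "T \<in> F" "insert y T \<in> F" "y \<noteq> e" "y \<in> Y" "y \<notin> T" by (auto simp: D1_def one_incl_def)
        moreover have "insert y (T - {e}) = insert y T - {e}" using \<open>y \<noteq> e\<close> by auto
        ultimately show ?thesis using memU[of T] memU[of "insert y T"] 2 by (auto simp: one_incl_def)
      qed
    qed
    also have "card (D0 \<inter> D1') \<le> card (one_incl (F0 \<inter> F0') Y)"
    proof (intro card_mono finite_one_incl finU insert.hyps(1) subsetI)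
      fix t assume "t \<in> D0 \<inter> D1'"
      then obtain y T where t: "t = (y, T - {e})" "(y, T) \<in> D1" "(y, T - {e}) \<in> D0"
        by (auto simp: D1'_def)
      then have T: "e \<in> T" "y \<noteq> e" "y \<in> Y" "y \<notin> T" "T \<in> F" "insert y T \<in> F" "T - {e} \<in> F" "insert y (T - {e}) \<in> F"
        by (auto simp: D1_def D0_def one_incl_def)
      have eq: "insert e (T - {e}) = T" "insert e (insert y (T - {e})) = insert y T"
        using T by auto
      show "t \<in> one_incl (F0 \<inter> F0') Y"
        unfolding F2 using T eq by (auto simp: t one_incl_def)
    qed
    finally have "card (one_incl F (insert e Y)) \<le>
        card (F0 \<inter> F0') + (k * card (F0 \<union> F0') + k' * card (F0 \<inter> F0'))"
      using IH1 IH2 by linarith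
    also have "\<dots> = k * card F" unfolding cF Suc by (simp add: algebra_simps)
    finally show ?thesis .
  qed
qed

text \<open>A layer-cake argument: \<open>min (p T) (p (insert y T))\<close> counts the thresholds
  \<open>t\<close> at which the edge belongs to the one-inclusion graph of the level set
  \<open>F t\<close>. From \<open>t0\<close> on Haussler's bound applies, and the sizes of the level
  sets sum to the total weight; below \<open>t0\<close> a trivial count of edges is used.\<close>

lemma sum_min_shift_le:
  fixes p :: "'a set \<Rightarrow> nat"
  assumes Y: "finite Y" and nsh: "\<And>J. J \<subseteq> Y \<Longrightarrow> card J = k \<Longrightarrow> \<not> shatters {v \<in> Pow Y. t0 \<le> p v} J"
  shows "(\<Sum>y\<in>Y. \<Sum>T\<in>Pow (Y - {y}). min (p T) (p (insert y T)))
    \<le> t0 * (card Y * 2 ^ card Y) + k * (\<Sum>v\<in>Pow Y. p v)"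
proof -
  define D where "D = (SIGMA y:Y. Pow (Y - {y}))"
  define F where "F t = {v \<in> Pow Y. t \<le> p v}" for t
  define n where "n = Max (p ` Pow Y)"
  have pn: "p v \<le> n" if "v \<subseteq> Y" for v
    unfolding n_def using that Y by (intro Max_ge) auto
  have count: "a = (\<Sum>t\<in>{1..n}. of_bool (t \<le> a))" if "a \<le> n" for a :: nat
  proof -
    have "{1..n} \<inter> {t. t \<le> a} = {1..a}" using that by auto
    then show ?thesis by (simp add: sum_of_bool_eq)
  qed
  have finD: "finite D" using Y by (auto simp: D_def)
  have oi: "one_incl (F t) Y = {(y, T) \<in> D. t \<le> p T \<and> t \<le> p (insert y T)}" for t
    by (auto simp: one_incl_def D_def F_def)
  have "(\<Sum>y\<in>Y. \<Sum>T\<in>Pow (Y - {y}). min (p T) (p (insert y T))) = (\<Sum>(y, T)\<in>D. min (p T) (p (insert y T)))"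
    unfolding D_def using Y by (subst sum.Sigma) auto
  also have "\<dots> = (\<Sum>(y, T)\<in>D. \<Sum>t\<in>{1..n}. of_bool (t \<le> p T \<and> t \<le> p (insert y T)))"
  proof (intro sum.cong refl, clarify)
    fix y T assume "(y, T) \<in> D"
    then have "min (p T) (p (insert y T)) \<le> n" using pn[of T] by (auto simp: D_def min_le_iff_disj)
    from count[OF this] show "min (p T) (p (insert y T)) = (\<Sum>t\<in>{1..n}. of_bool (t \<le> p T \<and> t \<le> p (insert y T)))"
      by simp
  qed
  also have "\<dots> = (\<Sum>t\<in>{1..n}. \<Sum>(y, T)\<in>D. of_bool (t \<le> p T \<and> t \<le> p (insert y T)))"
    unfolding case_prod_beta by (rule sum.swap)
  also have "\<dots> = (\<Sum>t\<in>{1..n}. card (one_incl (F t) Y))"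
    unfolding oi using finD by (intro sum.cong refl) (auto simp: case_prod_beta sum_of_bool_eq intro!: arg_cong[where f = card])
  also have "\<dots> \<le> (\<Sum>t\<in>{1..n}. of_bool (t < t0) * (card Y * 2 ^ card Y) + k * card (F t))"
  proof (rule sum_mono)
    fix t assume "t \<in> {1..n}"
    show "card (one_incl (F t) Y) \<le> of_bool (t < t0) * (card Y * 2 ^ card Y) + k * card (F t)"
    proof (cases "t < t0")
      case True
      have "card (one_incl (F t) Y) \<le> card (Y \<times> Pow Y)"
        using Y by (intro card_mono) (auto simp: one_incl_def F_def)
      then show ?thesis using True Y by (simp add: card_cartesian_product card_Pow)
    next
      case False
      have "card (one_incl (F t) Y) \<le> k * card (F t)"
      proof (rule card_one_incl_le[OF Y])
        show "F t \<subseteq> Pow Y" by (auto simp: F_def)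
        fix J assume "J \<subseteq> Y" "card J = k"
        moreover have "F t \<subseteq> {v \<in> Pow Y. t0 \<le> p v}" using False by (auto simp: F_def)
        ultimately show "\<not> shatters (F t) J"
          using nsh[of J] shatters_trace_mono[OF _ image_mono] by blast
      qed
      then show ?thesis by simp
    qed
  qed
  also have "\<dots> = (\<Sum>t\<in>{1..n}. of_bool (t < t0)) * (card Y * 2 ^ card Y) + k * (\<Sum>t\<in>{1..n}. card (F t))"
    by (simp add: sum.distrib sum_distrib_left sum_distrib_right)
  also have "(\<Sum>t\<in>{1..n}. of_bool (t < t0)) \<le> t0"
  proof -
    have "card ({1..n} \<inter> {t. t < t0}) \<le> card {..<t0}" by (intro card_mono) auto
    then show ?thesis by (simp add: sum_of_bool_eq)
  qed
  also have "(\<Sum>t\<in>{1..n}. card (F t)) = (\<Sum>v\<in>Pow Y. p v)"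
  proof -
    have "(\<Sum>t\<in>{1..n}. card (F t)) = (\<Sum>t\<in>{1..n}. \<Sum>v\<in>Pow Y. of_bool (t \<le> p v))"
      using Y by (intro sum.cong refl) (auto simp: F_def sum_of_bool_eq intro!: arg_cong[where f = card])
    also have "\<dots> = (\<Sum>v\<in>Pow Y. \<Sum>t\<in>{1..n}. of_bool (t \<le> p v))" by (rule sum.swap)
    also have "\<dots> = (\<Sum>v\<in>Pow Y. p v)"
      by (intro sum.cong refl, rule count[symmetric]) (auto intro: pn)
    finally show ?thesis .
  qed
  finally show ?thesis by simp
qed

section \<open>Sampling the links\<close>

definition link_trace :: "'a set set \<Rightarrow> 'a \<Rightarrow> 'a set \<Rightarrow> 'a \<Rightarrow> 'a set" where
  "link_trace E w A x = {a \<in> A. {w, a, x} \<in> E}"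

text \<open>The number of \<open>x\<close> on which the best guess of
  \<open>{w, y, x} \<in> E\<close> from the trace of \<open>x\<close> alone fails.\<close>

definition mismatch :: "'a set set \<Rightarrow> 'a set \<Rightarrow> 'a \<Rightarrow> 'a set \<Rightarrow> 'a \<Rightarrow> nat" where
  "mismatch E V w A y = (\<Sum>T\<in>Pow A. min (card {x \<in> V. link_trace E w A x = T \<and> {w, y, x} \<in> E})
                                     (card {x \<in> V. link_trace E w A x = T \<and> {w, y, x} \<notin> E}))"

lemma link_trace_subset: "link_trace E w A x \<subseteq> A"
  by (auto simp: link_trace_def)

lemma mismatch_mem:
  assumes "y \<in> A" shows "mismatch E V w A y = 0"
  unfolding mismatch_def
proof (intro sum.neutral ballI)
  fix T assume "T \<in> Pow A"
  show "min (card {x \<in> V. link_trace E w A x = T \<and> {w, y, x} \<in> E})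
        (card {x \<in> V. link_trace E w A x = T \<and> {w, y, x} \<notin> E}) = 0"
  proof (cases "y \<in> T")
    case True
    then have "{x \<in> V. link_trace E w A x = T \<and> {w, y, x} \<notin> E} = {}" using assms by (auto simp: link_trace_def)
    then show ?thesis by (metis card.empty min_0R)
  next
    case False
    then have "{x \<in> V. link_trace E w A x = T \<and> {w, y, x} \<in> E} = {}" using assms by (auto simp: link_trace_def)
    then show ?thesis by (metis card.empty min_0L)
  qed
qed

text \<open>The class of a trace \<open>T\<close> on \<open>Y - {y}\<close> splits, according to
  \<open>{w, y, x} \<in> E\<close>, into the classes of \<open>T\<close> and
  \<open>insert y T\<close> on \<open>Y\<close>. So the error of predicting \<open>y\<close> from
  the rest is a weighted count of cube edges in direction \<open>y\<close>.\<close>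

lemma mismatch_remove:
  fixes E :: "'a set set" and V :: "'a set" and w :: 'a
  assumes "y \<in> Y"
  defines "p \<equiv> \<lambda>v. card {x \<in> V. link_trace E w Y x = v}"
  shows "mismatch E V w (Y - {y}) y = (\<Sum>T\<in>Pow (Y - {y}). min (p T) (p (insert y T)))"
  unfolding mismatch_def
proof (rule sum.cong[OF refl])
  fix T assume T: "T \<in> Pow (Y - {y})"
  have "{x \<in> V. link_trace E w (Y - {y}) x = T \<and> {w, y, x} \<in> E} = {x \<in> V. link_trace E w Y x = insert y T}"
    "{x \<in> V. link_trace E w (Y - {y}) x = T \<and> {w, y, x} \<notin> E} = {x \<in> V. link_trace E w Y x = T}"
    using T assms(1) by (auto simp: link_trace_def)
  then show "min (card {x \<in> V. link_trace E w (Y - {y}) x = T \<and> {w, y, x} \<in> E})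
        (card {x \<in> V. link_trace E w (Y - {y}) x = T \<and> {w, y, x} \<notin> E}) = min (p T) (p (insert y T))"
    by (simp add: p_def min.commute)
qed

lemma sum_card_link_trace_le:
  assumes "finite V" "finite Y" shows "(\<Sum>v\<in>Pow Y. card {x \<in> V. link_trace E w Y x = v}) = card V"
proof -
  have "card V = (\<Sum>v\<in>Pow Y. card {x \<in> V. link_trace E w Y x = v})"
    using sum.group[of V "Pow Y" "link_trace E w Y" "\<lambda>_. 1 :: nat"] assms by (simp add: link_trace_subset image_subset_iff)
  then show ?thesis by simp
qed

lemma mismatch_le:
  assumes "finite V" "finite A" shows "mismatch E V w A y \<le> card V"
proof -
  have "mismatch E V w A y \<le> (\<Sum>v\<in>Pow A. card {x \<in> V. link_trace E w A x = v})"
    unfolding mismatch_def using assms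
    by (intro sum_mono min.coboundedI1 card_mono) auto
  then show ?thesis using sum_card_link_trace_le[OF assms, of E w] by simp
qed

definition heavy :: "'a set set \<Rightarrow> 'a set \<Rightarrow> nat \<Rightarrow> 'a set \<Rightarrow> 'a set" where
  "heavy E V t J = {w \<in> V. \<forall>S\<subseteq>J. t \<le> card {x \<in> V. link_trace E w J x = S}}"

text \<open>Double counting of pairs of a vertex \<open>w\<close> and a choice \<open>b\<close> of
  one vertex per trace: a heavy \<open>w\<close> admits at least \<open>t ^ 2 ^ k\<close> choices,
  while by \<open>NU\<close> each choice serves at most \<open>k\<close> vertices \<open>w\<close>.
  When \<open>t\<close> is a fixed share of \<open>card V\<close>, the number of heavy vertices is
  bounded independently of \<open>card V\<close>.\<close>

lemma card_heavy_le:
  assumes V: "finite V" and J: "finite J" "card J = k"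
    and NU: "\<And>b. b \<in> Pow J \<rightarrow> V \<Longrightarrow> card {w \<in> V. \<forall>S\<subseteq>J. link_trace E w J (b S) = S} \<le> k"
  shows "card (heavy E V t J) * t ^ 2 ^ k \<le> k * card V ^ 2 ^ k"
proof -
  let ?B = "Pow J \<rightarrow>\<^sub>E V"
  let ?R = "\<lambda>w b. \<forall>S\<subseteq>J. link_trace E w J (b S) = S"
  have finB: "finite ?B" using V J by (intro finite_PiE) auto
  have cPow: "card (Pow J) = 2 ^ k" using J by (simp add: card_Pow)
  have "card (heavy E V t J) * t ^ 2 ^ k = (\<Sum>w\<in>heavy E V t J. \<Prod>S\<in>Pow J. t)"
    using cPow by simp
  also have "\<dots> \<le> (\<Sum>w\<in>heavy E V t J. \<Prod>S\<in>Pow J. card {x \<in> V. link_trace E w J x = S})"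
    by (intro sum_mono prod_mono) (auto simp: heavy_def)
  also have "\<dots> = (\<Sum>w\<in>heavy E V t J. card (PiE (Pow J) (\<lambda>S. {x \<in> V. link_trace E w J x = S})))"
    using J by (intro sum.cong refl) (simp add: card_PiE)
  also have "\<dots> = (\<Sum>w\<in>heavy E V t J. \<Sum>b\<in>?B. of_bool (?R w b))"
  proof (intro sum.cong refl)
    fix w
    have "PiE (Pow J) (\<lambda>S. {x \<in> V. link_trace E w J x = S}) = ?B \<inter> {b. ?R w b}"
      by (auto simp: PiE_iff)
    then show "card (PiE (Pow J) (\<lambda>S. {x \<in> V. link_trace E w J x = S})) = (\<Sum>b\<in>?B. of_bool (?R w b))"
      using finB by (simp add: sum_of_bool_eq)
  qed
  also have "\<dots> = (\<Sum>b\<in>?B. \<Sum>w\<in>heavy E V t J. of_bool (?R w b))" by (rule sum.swap)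
  also have "\<dots> \<le> (\<Sum>b\<in>?B. k)"
  proof (rule sum_mono)
    fix b assume b: "b \<in> ?B"
    have "finite (heavy E V t J)" using V by (auto simp: heavy_def)
    then have "(\<Sum>w\<in>heavy E V t J. of_bool (?R w b)) = card (heavy E V t J \<inter> {w. ?R w b})"
      by (simp add: sum_of_bool_eq)
    also have "\<dots> \<le> card {w \<in> V. ?R w b}"
      using V by (intro card_mono) (auto simp: heavy_def)
    also have "\<dots> \<le> k" using NU[of b] b by auto
    finally show "(\<Sum>w\<in>heavy E V t J. of_bool (?R w b)) \<le> k" .
  qed
  also have "\<dots> = k * card V ^ 2 ^ k" using cPow J by (simp add: card_PiE)
  finally show ?thesis .
qed

text \<open>Implied by the absence of \<open>k \<otimes> U(k)\<close> from the tripartite double of the 3-graph: \<open>J\<close> and \<open>b\<close>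
  give the two sides of \<open>U(k)\<close>, and \<open>w\<close> ranges over the possible vertices \<open>c\<^sub>i\<close>.\<close>

definition tensor_free :: "nat \<Rightarrow> 'a set set \<Rightarrow> 'a set \<Rightarrow> bool" where
  "tensor_free k E V \<longleftrightarrow> (\<forall>J b. J \<subseteq> V \<and> card J = k \<and> b \<in> Pow J \<rightarrow> V \<longrightarrow>
     card {w \<in> V. \<forall>S\<subseteq>J. link_trace E w J (b S) = S} \<le> k)"

text \<open>Vertices \<open>w\<close> outside \<open>Bad\<close> fall under the layer-cake estimate;
  the boundedly many in \<open>Bad\<close> are charged the trivial error, which assumption
  \<open>n\<close> absorbs. Divided by \<open>Suc s\<close>, the result says that a left-out point
  is predicted with relative error at most \<open>(k + 2) / Suc s\<close> on average.\<close>

lemma sum_mismatch_le: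
  assumes V: "finite V" and Y: "Y \<subseteq> V" "card Y = Suc s"
    and free: "tensor_free k E V"
    and q: "q = Suc s * 2 ^ Suc s" and n: "q + 2 ^ Suc s * (k * q ^ 2 ^ k) * Suc s \<le> card V"
  shows "(\<Sum>y\<in>Y. \<Sum>w\<in>V. mismatch E V w (Y - {y}) y) \<le> (k + 2) * card V ^ 2"
proof -
  define n where "n = card V"
  \<comment> \<open>About \<open>n / q\<close>: small enough that the levels below it cost at most
    \<open>n + q\<close>, yet large enough that \<open>n \<le> q * t0\<close> bounds the heavy
    vertices for each \<open>J\<close> by \<open>k * q ^ 2 ^ k\<close>.\<close>
  define t0 where "t0 = n div q + 1"
  have q0: "0 < q" by (simp add: q)
  have t01: "n \<le> q * t0"
    unfolding t0_def distrib_left using mult_div_mod_eq[of q n] mod_less_divisor[OF q0, of n] by linarith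
  have t02: "q * t0 \<le> n + q" unfolding t0_def by (simp add: algebra_simps)
  have t00: "0 < t0" by (simp add: t0_def)
  have finY: "finite Y" using Y V finite_subset by blast
  define Bad where "Bad = (\<Union>J\<in>{J. J \<subseteq> Y \<and> card J = k}. heavy E V t0 J)"
  have heavy: "card (heavy E V t0 J) \<le> k * q ^ 2 ^ k" if "J \<subseteq> Y" "card J = k" for J
  proof -
    have "card (heavy E V t0 J) * t0 ^ 2 ^ k \<le> k * n ^ 2 ^ k"
      unfolding n_def using that Y finY free unfolding tensor_free_def
      by (intro card_heavy_le V) (auto intro: finite_subset)
    also have "\<dots> \<le> k * (q * t0) ^ 2 ^ k"
      using t01 by (intro mult_left_mono power_mono) auto
    also have "\<dots> = (k * q ^ 2 ^ k) * t0 ^ 2 ^ k" by (simp add: power_mult_distrib)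
    finally show ?thesis using t00 by simp
  qed
  have finBad: "finite Bad" "Bad \<subseteq> V"
    using V finY by (auto simp: Bad_def heavy_def)
  have "card Bad \<le> (\<Sum>J\<in>{J. J \<subseteq> Y \<and> card J = k}. card (heavy E V t0 J))"
    unfolding Bad_def using finY by (intro card_UN_le) auto
  also have "\<dots> \<le> (\<Sum>J\<in>{J. J \<subseteq> Y \<and> card J = k}. k * q ^ 2 ^ k)"
    using heavy by (intro sum_mono) auto
  also have "\<dots> = card {J. J \<subseteq> Y \<and> card J = k} * (k * q ^ 2 ^ k)" by simp
  also have "\<dots> \<le> card (Pow Y) * (k * q ^ 2 ^ k)"
    using finY by (intro mult_right_mono card_mono) auto
  finally have Bad: "card Bad \<le> 2 ^ Suc s * (k * q ^ 2 ^ k)" using finY Y by (simp add: card_Pow)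
  have good: "(\<Sum>y\<in>Y. mismatch E V w (Y - {y}) y) \<le> t0 * q + k * n" if w: "w \<in> V - Bad" for w
  proof -
    define p where "p v = card {x \<in> V. link_trace E w Y x = v}" for v
    have "(\<Sum>y\<in>Y. mismatch E V w (Y - {y}) y) = (\<Sum>y\<in>Y. \<Sum>T\<in>Pow (Y - {y}). min (p T) (p (insert y T)))"
      unfolding p_def by (intro sum.cong refl mismatch_remove)
    also have "\<dots> \<le> t0 * (card Y * 2 ^ card Y) + k * (\<Sum>v\<in>Pow Y. p v)"
    proof (rule sum_min_shift_le[OF finY])
      fix J assume J: "J \<subseteq> Y" "card J = k"
      show "\<not> shatters {v \<in> Pow Y. t0 \<le> p v} J"
      proof
        assume sh: "shatters {v \<in> Pow Y. t0 \<le> p v} J"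
        have "t0 \<le> card {x \<in> V. link_trace E w J x = S}" if S: "S \<subseteq> J" for S
        proof -
          obtain v where v: "t0 \<le> p v" "S = v \<inter> J"
            using sh S unfolding shatters_def by blast
          have "card {x \<in> V. link_trace E w Y x = v} \<le> card {x \<in> V. link_trace E w J x = S}"
            using V J v by (intro card_mono) (auto simp: link_trace_def)
          then show ?thesis using v by (simp add: p_def)
        qed
        then have "w \<in> heavy E V t0 J" using w by (simp add: heavy_def)
        then show False using w J by (auto simp: Bad_def)
      qed
    qed
    also have "(\<Sum>v\<in>Pow Y. p v) = n"
      unfolding p_def n_def by (rule sum_card_link_trace_le[OF V finY])
    finally show ?thesis using Y by (simp add: q)
  qed
  have bad: "(\<Sum>y\<in>Y. mismatch E V w (Y - {y}) y) \<le> Suc s * n" for w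
  proof -
    have "(\<Sum>y\<in>Y. mismatch E V w (Y - {y}) y) \<le> (\<Sum>y\<in>Y. n)"
      unfolding n_def using V finY by (intro sum_mono mismatch_le) auto
    then show ?thesis using Y by simp
  qed
  have "(\<Sum>y\<in>Y. \<Sum>w\<in>V. mismatch E V w (Y - {y}) y) = (\<Sum>w\<in>V. \<Sum>y\<in>Y. mismatch E V w (Y - {y}) y)"
    by (rule sum.swap)
  also have "\<dots> = (\<Sum>w\<in>V - Bad. \<Sum>y\<in>Y. mismatch E V w (Y - {y}) y) + (\<Sum>w\<in>Bad. \<Sum>y\<in>Y. mismatch E V w (Y - {y}) y)"
    using V finBad by (simp add: sum.subset_diff)
  also have "\<dots> \<le> (\<Sum>w\<in>V - Bad. t0 * q + k * n) + (\<Sum>w\<in>Bad. Suc s * n)"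
    by (intro add_mono sum_mono good bad)
  also have "\<dots> = card (V - Bad) * (t0 * q + k * n) + card Bad * (Suc s * n)" by simp
  also have "\<dots> \<le> n * (n + q + k * n) + 2 ^ Suc s * (k * q ^ 2 ^ k) * (Suc s * n)"
    using V Bad t02 unfolding n_def
    by (intro add_mono mult_mono card_mono) (auto simp: mult.commute)
  also have "\<dots> = n * ((k + 1) * n + (q + 2 ^ Suc s * (k * q ^ 2 ^ k) * Suc s))"
    by (simp only: algebra_simps)
  also have "\<dots> \<le> n * ((k + 1) * n + n)"
    using n unfolding n_def by (intro mult_left_mono add_mono) auto
  finally show ?thesis by (simp add: n_def power2_eq_square algebra_simps)
qed

definition link_error :: "'a set set \<Rightarrow> 'a set \<Rightarrow> 'a \<Rightarrow> 'a set \<Rightarrow> nat" where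
  "link_error E V w A = (\<Sum>y\<in>V. mismatch E V w A y)"

text \<open>The leave-one-out exchange: a sample with a fresh point outside it is the same thing as
  a set one larger with a marked point.\<close>

lemma sum_subsets_remove:
  assumes "finite V"
  shows "(\<Sum>A\<in>{A. A \<subseteq> V \<and> card A = s}. \<Sum>y\<in>V - A. f A y) =
    (\<Sum>Y\<in>{Y. Y \<subseteq> V \<and> card Y = Suc s}. \<Sum>y\<in>Y. f (Y - {y}) y)"
proof -
  let ?S = "SIGMA A:{A. A \<subseteq> V \<and> card A = s}. V - A"
  let ?T = "SIGMA Y:{Y. Y \<subseteq> V \<and> card Y = Suc s}. Y"
  have fin: "finite {A. A \<subseteq> V \<and> card A = m}" for m using assms by auto
  have finT: "\<forall>Y\<in>{Y. Y \<subseteq> V \<and> card Y = Suc s}. finite Y" using assms finite_subset by blast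
  have "(\<Sum>(A, y)\<in>?S. f A y) = (\<Sum>(Y, y)\<in>?T. f (Y - {y}) y)"
  proof (rule sum.reindex_bij_witness[of _ "\<lambda>(Y, y). (Y - {y}, y)" "\<lambda>(A, y). (insert y A, y)"])
    fix t assume t: "t \<in> ?S"
    then obtain A y where "t = (A, y)" "A \<subseteq> V" "card A = s" "y \<in> V" "y \<notin> A" by blast
    moreover from this have "finite A" using assms finite_subset by blast
    ultimately show "(case case t of (A, y) \<Rightarrow> (insert y A, y) of (Y, y) \<Rightarrow> (Y - {y}, y)) = t"
      "(case t of (A, y) \<Rightarrow> (insert y A, y)) \<in> ?T"
      "(case case t of (A, y) \<Rightarrow> (insert y A, y) of (Y, y) \<Rightarrow> f (Y - {y}) y) = (case t of (A, y) \<Rightarrow> f A y)"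
      by (auto simp: insert_Diff_if)
  next
    fix t assume "t \<in> ?T"
    then obtain Y y where "t = (Y, y)" "Y \<subseteq> V" "card Y = Suc s" "y \<in> Y" by blast
    moreover from this have "finite Y" using assms finite_subset by blast
    ultimately show "(case case t of (Y, y) \<Rightarrow> (Y - {y}, y) of (A, y) \<Rightarrow> (insert y A, y)) = t"
      "(case t of (Y, y) \<Rightarrow> (Y - {y}, y)) \<in> ?S"
      by auto
  qed
  then show ?thesis
    using sum.Sigma[OF fin, of s "\<lambda>A. V - A" f] sum.Sigma[OF fin finT, of "\<lambda>Y y. f (Y - {y}) y"] assms by simp
qed

text \<open>Points of the sample itself are predicted without error, so only fresh points count, and
  these can be exchanged for left-out points of a larger set.\<close>

lemma sum_link_error_le:
  assumes V: "finite V" and free: "tensor_free k E V"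
    and q: "q = Suc s * 2 ^ Suc s" and n: "q + 2 ^ Suc s * (k * q ^ 2 ^ k) * Suc s \<le> card V"
  shows "(\<Sum>A\<in>{A. A \<subseteq> V \<and> card A = s}. \<Sum>w\<in>V. link_error E V w A) * Suc s \<le> (card V choose s) * ((k + 2) * card V ^ 3)"
proof -
  let ?C = "\<lambda>m. {A. A \<subseteq> V \<and> card A = m}"
  have "(\<Sum>w\<in>V. link_error E V w A) = (\<Sum>y\<in>V - A. \<Sum>w\<in>V. mismatch E V w A y)" if "A \<in> ?C s" for A
  proof -
    have "(\<Sum>w\<in>V. link_error E V w A) = (\<Sum>y\<in>V. \<Sum>w\<in>V. mismatch E V w A y)"
      unfolding link_error_def by (rule sum.swap)
    also have "\<dots> = (\<Sum>y\<in>V - A. \<Sum>w\<in>V. mismatch E V w A y)"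
      using V by (intro sum.mono_neutral_right) (auto simp: mismatch_mem)
    finally show ?thesis .
  qed
  then have "(\<Sum>A\<in>?C s. \<Sum>w\<in>V. link_error E V w A) = (\<Sum>A\<in>?C s. \<Sum>y\<in>V - A. \<Sum>w\<in>V. mismatch E V w A y)"
    by (rule sum.cong[OF refl])
  also have "\<dots> = (\<Sum>Y\<in>?C (Suc s). \<Sum>y\<in>Y. \<Sum>w\<in>V. mismatch E V w (Y - {y}) y)"
    by (rule sum_subsets_remove[OF V])
  also have "\<dots> \<le> (\<Sum>Y\<in>?C (Suc s). (k + 2) * card V ^ 2)"
    by (intro sum_mono sum_mismatch_le[OF V _ _ free q n]) auto
  also have "\<dots> = (card V choose Suc s) * ((k + 2) * card V ^ 2)"
    using V by (simp add: n_subsets)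
  finally have "(\<Sum>A\<in>?C s. \<Sum>w\<in>V. link_error E V w A) * Suc s \<le> ((card V choose Suc s) * ((k + 2) * card V ^ 2)) * Suc s"
    by (rule mult_right_mono) simp
  also have "\<dots> = (Suc s * (card V choose Suc s)) * ((k + 2) * card V ^ 2)" by (simp only: ac_simps)
  \<comment> \<open>Absorption turns the number of \<open>(s + 1)\<close>-sets back into the number
    of samples, at the cost of a factor at most \<open>card V\<close>.\<close>
  also have "Suc s * (card V choose Suc s) = (card V - s) * (card V choose s)"
    by (metis binomial_absorb_comp binomial_absorption)
  also have "\<dots> * ((k + 2) * card V ^ 2) \<le> card V * (card V choose s) * ((k + 2) * card V ^ 2)"
    by (intro mult_right_mono) auto
  finally show ?thesis by (simp add: power3_eq_cube power2_eq_square ac_simps)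
qed

lemma card_subsets_mem:
  assumes "finite V" "w \<in> V"
  shows "card {A. A \<subseteq> V \<and> card A = s \<and> w \<in> A} * card V = s * (card V choose s)"
proof (cases s)
  case 0
  then have "{A. A \<subseteq> V \<and> card A = s \<and> w \<in> A} = {}"
    using assms by (auto dest: finite_subset)
  then have "card {A. A \<subseteq> V \<and> card A = s \<and> w \<in> A} = 0" by (simp only: card.empty)
  then show ?thesis using 0 by simp
next
  case (Suc s')
  have "{A. A \<subseteq> V \<and> card A = s \<and> w \<in> A} = insert w ` {A. A \<subseteq> V - {w} \<and> card A = s'}"
  proof (intro set_eqI iffI)
    fix A assume "A \<in> {A. A \<subseteq> V \<and> card A = s \<and> w \<in> A}"
    then have A: "A \<subseteq> V" "card A = Suc s'" "w \<in> A" using Suc by auto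
    then have "A = insert w (A - {w})" "A - {w} \<subseteq> V - {w}" "card (A - {w}) = s'" by auto
    then show "A \<in> insert w ` {A. A \<subseteq> V - {w} \<and> card A = s'}" by blast
  next
    fix A assume "A \<in> insert w ` {A. A \<subseteq> V - {w} \<and> card A = s'}"
    then obtain A' where A': "A = insert w A'" "A' \<subseteq> V - {w}" "card A' = s'" by blast
    have "finite A'" using A'(2) assms(1) finite_subset by blast
    then show "A \<in> {A. A \<subseteq> V \<and> card A = s \<and> w \<in> A}"
      using A' assms(2) Suc by (auto simp: card_insert_if)
  qed
  moreover have "inj_on (insert w) {A. A \<subseteq> V - {w} \<and> card A = s'}"
    by (auto simp: inj_on_def)
  ultimately have "card {A. A \<subseteq> V \<and> card A = s \<and> w \<in> A} = card {A. A \<subseteq> V - {w} \<and> card A = s'}"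
    by (simp add: card_image)
  also have "\<dots> = (card V - 1) choose s'" using assms by (simp add: n_subsets)
  finally show ?thesis by (simp only: Suc binomial_absorption mult.commute)
qed

lemma exists_le_average:
  fixes f :: "'b \<Rightarrow> real"
  assumes "finite S" "S \<noteq> {}" "sum f S \<le> real (card S) * c"
  shows "\<exists>A\<in>S. f A \<le> c"
proof (rule ccontr)
  assume "\<not> ?thesis"
  then have "sum (\<lambda>_. c) S < sum f S" using assms by (intro sum_strict_mono) auto
  then show False using assms by simp
qed

text \<open>\<open>B\<close> is chosen first, with small total link error. A random \<open>A\<close>
  contains each vertex with probability \<open>s1 / card V\<close>, so the errors of
  \<open>B\<close> in the links of the points of \<open>A\<close> are small on average as well. The
  weight \<open>card V\<close> on that sum accounts for the free coordinate \<open>y\<close> when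
  the triples \<open>{a, z, x}\<close> are predicted.\<close>

lemma exists_sample_pair:
  assumes V: "finite V" and free: "tensor_free k E V"
    and n: "\<And>s. s \<in> {s1, s2} \<Longrightarrow>
      Suc s * 2 ^ Suc s + 2 ^ Suc s * (k * (Suc s * 2 ^ Suc s) ^ 2 ^ k) * Suc s \<le> card V"
  shows "\<exists>A B. A \<subseteq> V \<and> B \<subseteq> V \<and> card A = s1 \<and> card B = s2 \<and>
    real (\<Sum>w\<in>V. link_error E V w A) + real (card V) * real (\<Sum>a\<in>A. link_error E V a B)
    \<le> real (k + 2) * (1 / real (Suc s1) + real s1 / real (Suc s2)) * real (card V) ^ 3"
proof -
  define nn where "nn = real (card V)"
  define K where "K = real (k + 2) * nn ^ 3"
  let ?C = "\<lambda>m. {A. A \<subseteq> V \<and> card A = m}"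
  have sle: "s \<le> card V" if "s \<in> {s1, s2}" for s
  proof -
    have "s \<le> Suc s * 1" by simp
    also have "\<dots> \<le> Suc s * 2 ^ Suc s" by (intro mult_left_mono) auto
    also have "\<dots> \<le> card V" using n[OF that] by linarith
    finally show ?thesis .
  qed
  have nn0: "0 < nn"
  proof -
    have "0 < Suc s1 * 2 ^ Suc s1" by simp
    also have "\<dots> \<le> card V" using n[of s1] by simp
    finally show ?thesis by (simp add: nn_def)
  qed
  have C: "finite (?C s)" "card (?C s) = card V choose s" for s
    using V by (auto simp: n_subsets)
  have Cne: "?C s \<noteq> {}" if "s \<in> {s1, s2}" for s
    using C(2)[of s] sle[OF that] zero_less_binomial[of s "card V"] by (metis card.empty less_irrefl)
  have avg: "(\<Sum>A\<in>?C s. real (\<Sum>w\<in>V. link_error E V w A)) \<le> real (card V choose s) * (K / real (Suc s))"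
    if "s \<in> {s1, s2}" for s
  proof -
    have "real ((\<Sum>A\<in>?C s. \<Sum>w\<in>V. link_error E V w A) * Suc s) \<le> real ((card V choose s) * ((k + 2) * card V ^ 3))"
      using sum_link_error_le[OF V free refl n[OF that]] by (rule of_nat_mono)
    then have "(\<Sum>A\<in>?C s. real (\<Sum>w\<in>V. link_error E V w A)) * real (Suc s) \<le> real (card V choose s) * K"
      by (simp only: K_def nn_def of_nat_mult of_nat_sum of_nat_power)
    then show ?thesis by (simp add: le_divide_eq)
  qed
  obtain B where B: "B \<in> ?C s2" "real (\<Sum>w\<in>V. link_error E V w B) \<le> K / real (Suc s2)"
    using exists_le_average[OF C(1) Cne, of s2 "\<lambda>A. real (\<Sum>w\<in>V. link_error E V w A)" "K / real (Suc s2)"]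
      avg[of s2] C(2) by auto
  have "(\<Sum>A\<in>?C s1. \<Sum>a\<in>A. real (link_error E V a B)) = (\<Sum>A\<in>?C s1. \<Sum>w\<in>V. of_bool (w \<in> A) * real (link_error E V w B))"
    using V by (intro sum.cong refl sum.mono_neutral_cong_left) auto
  also have "\<dots> = (\<Sum>w\<in>V. \<Sum>A\<in>?C s1. of_bool (w \<in> A) * real (link_error E V w B))" by (rule sum.swap)
  also have "\<dots> = (\<Sum>w\<in>V. real (card {A. A \<subseteq> V \<and> card A = s1 \<and> w \<in> A}) * real (link_error E V w B))"
  proof (intro sum.cong refl)
    fix w
    have "?C s1 \<inter> {A. w \<in> A} = {A. A \<subseteq> V \<and> card A = s1 \<and> w \<in> A}" by auto
    then show "(\<Sum>A\<in>?C s1. of_bool (w \<in> A) * real (link_error E V w B)) = real (card {A. A \<subseteq> V \<and> card A = s1 \<and> w \<in> A}) * real (link_error E V w B)"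
      using C(1) by (simp add: sum_of_bool_eq flip: sum_distrib_right)
  qed
  also have "\<dots> * nn = (\<Sum>w\<in>V. (real (card {A. A \<subseteq> V \<and> card A = s1 \<and> w \<in> A}) * nn) * real (link_error E V w B))"
    by (subst sum_distrib_right) (simp only: ac_simps)
  also have "\<dots> = (\<Sum>w\<in>V. (real s1 * real (card V choose s1)) * real (link_error E V w B))"
    using card_subsets_mem[OF V, of _ s1] by (intro sum.cong refl) (simp add: nn_def flip: of_nat_mult)
  also have "\<dots> = (real s1 * real (card V choose s1)) * real (\<Sum>w\<in>V. link_error E V w B)"
    by (simp add: sum_distrib_left)
  also have "\<dots> \<le> (real s1 * real (card V choose s1)) * (K / real (Suc s2))"
    using B(2) by (intro mult_left_mono) auto
  finally have "(\<Sum>A\<in>?C s1. \<Sum>a\<in>A. real (link_error E V a B)) * nn \<le> (real s1 * real (card V choose s1)) * (K / real (Suc s2))" .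
  then have 2: "(\<Sum>A\<in>?C s1. nn * (\<Sum>a\<in>A. real (link_error E V a B))) \<le> real (card V choose s1) * (real s1 * K / real (Suc s2))"
    by (simp add: mult.commute mult.left_commute flip: sum_distrib_left)
  have "(\<Sum>A\<in>?C s1. real (\<Sum>w\<in>V. link_error E V w A) + nn * (\<Sum>a\<in>A. real (link_error E V a B)))
      \<le> real (card (?C s1)) * (K / real (Suc s1) + real s1 * K / real (Suc s2))"
    unfolding sum.distrib C(2) distrib_left using avg[of s1] 2 by simp
  then obtain A where A: "A \<in> ?C s1"
    "real (\<Sum>w\<in>V. link_error E V w A) + nn * (\<Sum>a\<in>A. real (link_error E V a B)) \<le> K / real (Suc s1) + real s1 * K / real (Suc s2)"
    using exists_le_average[OF C(1) Cne, of s1] by blast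
  show ?thesis
    using A B by (intro exI[of _ A] exI[of _ B]) (simp add: nn_def K_def algebra_simps)
qed

section \<open>Step functions\<close>

definition majority :: "'a set set \<Rightarrow> 'a set \<Rightarrow> 'a \<Rightarrow> 'a set \<Rightarrow> 'a \<Rightarrow> 'a set \<Rightarrow> bool" where
  "majority E V w A y T \<longleftrightarrow> card {x \<in> V. link_trace E w A x = T \<and> {w, y, x} \<notin> E}
     \<le> card {x \<in> V. link_trace E w A x = T \<and> {w, y, x} \<in> E}"

lemma card_majority_ne_le:
  assumes "finite V" "finite A"
  shows "card {x \<in> V. ({w, y, x} \<in> E) \<noteq> majority E V w A y (link_trace E w A x)} \<le> mismatch E V w A y"
proof -
  let ?D = "{x \<in> V. ({w, y, x} \<in> E) \<noteq> majority E V w A y (link_trace E w A x)}"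
  have "?D = (\<Union>T\<in>Pow A. {x \<in> ?D. link_trace E w A x = T})" using link_trace_subset by fastforce
  then have "card ?D \<le> (\<Sum>T\<in>Pow A. card {x \<in> ?D. link_trace E w A x = T})"
    using card_UN_le[of "Pow A" "\<lambda>T. {x \<in> ?D. link_trace E w A x = T}"] assms(2) by (metis finite_Pow_iff)
  also have "\<dots> \<le> mismatch E V w A y"
    unfolding mismatch_def
  proof (rule sum_mono)
    fix T
    let ?P = "{x \<in> V. link_trace E w A x = T \<and> {w, y, x} \<in> E}"
    let ?N = "{x \<in> V. link_trace E w A x = T \<and> {w, y, x} \<notin> E}"
    show "card {x \<in> ?D. link_trace E w A x = T} \<le> min (card ?P) (card ?N)"
    proof (cases "majority E V w A y T")
      case True
      then have "{x \<in> ?D. link_trace E w A x = T} = ?N" by auto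
      then show ?thesis using True by (simp add: majority_def)
    next
      case False
      then have "{x \<in> ?D. link_trace E w A x = T} = ?P" by auto
      then show ?thesis using False by (simp add: majority_def)
    qed
  qed
  finally show ?thesis .
qed

lemma card_triple_collect:
  assumes "finite V"
  shows "card {(x, y, z) \<in> V \<times> V \<times> V. R x y z} = (\<Sum>z\<in>V. \<Sum>y\<in>V. card {x \<in> V. R x y z})"
proof -
  have "{(x, y, z) \<in> V \<times> V \<times> V. R x y z} = (\<lambda>(z, y, x). (x, y, z)) ` (SIGMA z:V. SIGMA y:V. {x \<in> V. R x y z})"
    by (auto simp: image_iff)
  moreover have "inj_on (\<lambda>(z, y, x). (x, y, z)) (SIGMA z:V. SIGMA y:V. {x \<in> V. R x y z})"
    by (auto simp: inj_on_def)
  ultimately show ?thesis using assms by (simp add: card_image card_SigmaI)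
qed

text \<open>Here \<open>t\<close> stands for the pattern of \<open>x\<close> on
  \<open>A \<times> B\<close>. It contains the traces of \<open>x\<close> in the links of all
  \<open>a \<in> A\<close>, from which \<open>g\<close> guesses the edges \<open>{a, z, x}\<close>;
  the guesses then serve as the trace of \<open>x\<close> in the link of \<open>z\<close>. An error
  needs a wrong outer prediction or a wrong inner one, and the inner ones do not involve
  \<open>y\<close>, hence the factor \<open>card V\<close>.\<close>

lemma card_predict_le:
  fixes E :: "'a set set"
  assumes V: "finite V" and A: "finite A" and B: "finite B"
  defines "c \<equiv> \<lambda>x. {(a, b) \<in> A \<times> B. {a, b, x} \<in> E}"
  defines "g \<equiv> \<lambda>y z t. majority E V z A y {a \<in> A. majority E V a B z {b \<in> B. (a, b) \<in> t}}"
  shows "card {(x, y, z) \<in> V \<times> V \<times> V. ({x, y, z} \<in> E) \<noteq> g y z (c x)}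
    \<le> (\<Sum>w\<in>V. link_error E V w A) + card V * (\<Sum>a\<in>A. link_error E V a B)"
proof -
  let ?S = "{(x, y, z) \<in> V \<times> V \<times> V. ({x, y, z} \<in> E) \<noteq> g y z (c x)}"
  let ?S1 = "{(x, y, z) \<in> V \<times> V \<times> V. ({z, y, x} \<in> E) \<noteq> majority E V z A y (link_trace E z A x)}"
  let ?Sa = "\<lambda>a. {(x, y, z) \<in> V \<times> V \<times> V. ({a, z, x} \<in> E) \<noteq> majority E V a B z (link_trace E a B x)}"
  have "?S \<subseteq> ?S1 \<union> (\<Union>a\<in>A. ?Sa a)"
  proof
    fix t assume t: "t \<in> ?S"
    obtain x y z where xyz: "t = (x, y, z)" by (cases t)
    show "t \<in> ?S1 \<union> (\<Union>a\<in>A. ?Sa a)"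
    proof (rule ccontr)
      assume "t \<notin> ?S1 \<union> (\<Union>a\<in>A. ?Sa a)"
      then have 1: "({z, y, x} \<in> E) = majority E V z A y (link_trace E z A x)"
        and 2: "\<And>a. a \<in> A \<Longrightarrow> ({a, z, x} \<in> E) = majority E V a B z (link_trace E a B x)"
        using t xyz by auto
      have "{b \<in> B. (a, b) \<in> c x} = link_trace E a B x" if "a \<in> A" for a
        using that by (auto simp: c_def link_trace_def)
      then have "{a \<in> A. majority E V a B z {b \<in> B. (a, b) \<in> c x}} = link_trace E z A x"
        using 2 by (auto simp: link_trace_def insert_commute)
      then show False using t xyz 1 by (auto simp: g_def insert_commute)
    qed
  qed
  moreover have fin: "finite (V \<times> V \<times> V)" using V by simp
  moreover have "finite ?S1" "finite (?Sa a)" for a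
    by (rule finite_subset[OF _ fin], blast)+
  ultimately have "card ?S \<le> card (?S1 \<union> (\<Union>a\<in>A. ?Sa a))"
    using A by (intro card_mono) auto
  also have "\<dots> \<le> card ?S1 + card (\<Union>a\<in>A. ?Sa a)" by (rule card_Un_le)
  also have "\<dots> \<le> card ?S1 + (\<Sum>a\<in>A. card (?Sa a))" using A by (simp add: card_UN_le)
  also have "card ?S1 \<le> (\<Sum>w\<in>V. link_error E V w A)"
    unfolding card_triple_collect[OF V] link_error_def by (intro sum_mono card_majority_ne_le V A)
  also have "(\<Sum>a\<in>A. card (?Sa a)) \<le> (\<Sum>a\<in>A. card V * link_error E V a B)"
  proof (rule sum_mono)
    fix a
    have "card (?Sa a) \<le> (\<Sum>z\<in>V. \<Sum>y\<in>V. mismatch E V a B z)"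
      unfolding card_triple_collect[OF V] by (intro sum_mono card_majority_ne_le V B)
    then show "card (?Sa a) \<le> card V * link_error E V a B" by (simp add: link_error_def sum_distrib_left)
  qed
  finally show ?thesis by (simp add: sum_distrib_left)
qed

section \<open>Averaging over the cells of a colouring (conditional expectation)\<close>

definition cell_avg :: "'a set \<Rightarrow> ('a \<Rightarrow> 'c) \<Rightarrow> ('a \<Rightarrow> real) \<Rightarrow> 'a \<Rightarrow> real" where
  "cell_avg V c g x = (\<Sum>x'\<in>cell V c x. g x') / real (card (cell V c x))"

lemma cell_avg_cong: "c x = c x' \<Longrightarrow> cell_avg V c g x = cell_avg V c g x'"
  by (simp add: cell_avg_def cell_def)

lemma sum_cell_avg:
  assumes V: "finite V" shows "(\<Sum>x\<in>V. cell_avg V c g x) = (\<Sum>x\<in>V. g x)"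
proof -
  have "(\<Sum>x\<in>V. cell_avg V c g x) = (\<Sum>x\<in>V. \<Sum>x'\<in>V. of_bool (c x' = c x) * (g x' / real (card (cell V c x'))))"
  proof (rule sum.cong[OF refl])
    fix x assume "x \<in> V"
    have "cell_avg V c g x = (\<Sum>x'\<in>cell V c x. g x' / real (card (cell V c x')))"
      unfolding cell_avg_def sum_divide_distrib by (intro sum.cong refl) (simp add: cell_def)
    also have "\<dots> = (\<Sum>x'\<in>V. of_bool (c x' = c x) * (g x' / real (card (cell V c x'))))"
      using V by (intro sum.mono_neutral_cong_left) (auto simp: cell_def)
    finally show "cell_avg V c g x = \<dots>" .
  qed
  also have "\<dots> = (\<Sum>x'\<in>V. \<Sum>x\<in>V. of_bool (c x' = c x) * (g x' / real (card (cell V c x'))))"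
    by (rule sum.swap)
  also have "\<dots> = (\<Sum>x'\<in>V. g x')"
  proof (rule sum.cong[OF refl])
    fix x' assume x': "x' \<in> V"
    have "V \<inter> {x. c x' = c x} = cell V c x'" by (auto simp: cell_def)
    moreover have "card (cell V c x') > 0"
      using mem_cell_self[OF x'] V by (auto simp: card_gt_0_iff cell_def)
    ultimately show "(\<Sum>x\<in>V. of_bool (c x' = c x) * (g x' / real (card (cell V c x')))) = g x'"
      using V by (simp add: sum_of_bool_eq flip: sum_divide_distrib sum_distrib_right)
  qed
  finally show ?thesis .
qed

lemma abs_cell_avg_le: "\<bar>cell_avg V c g x\<bar> \<le> cell_avg V c (\<lambda>x. \<bar>g x\<bar>) x"
  unfolding cell_avg_def abs_divide by (simp add: divide_right_mono sum_abs)

lemma sum_abs_cell_avg_le: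
  assumes V: "finite V" shows "(\<Sum>x\<in>V. \<bar>cell_avg V c g x\<bar>) \<le> (\<Sum>x\<in>V. \<bar>g x\<bar>)"
  using sum_mono[of V "\<lambda>x. \<bar>cell_avg V c g x\<bar>", OF abs_cell_avg_le] unfolding sum_cell_avg[OF V] .

lemma cell_avg_diff: "cell_avg V c (\<lambda>x. g x - h x) x = cell_avg V c g x - cell_avg V c h x"
  by (simp add: cell_avg_def sum_subtractf diff_divide_distrib)

lemma cell_avg_const:
  assumes "finite V" "x \<in> V" "\<And>x'. x' \<in> V \<Longrightarrow> c x' = c x \<Longrightarrow> h x' = h x"
  shows "cell_avg V c h x = h x"
proof -
  have "card (cell V c x) > 0"
    using mem_cell_self[OF assms(2)] assms(1) by (auto simp: card_gt_0_iff cell_def)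
  moreover have "(\<Sum>x'\<in>cell V c x. h x') = (\<Sum>x'\<in>cell V c x. h x)"
    using assms(3) by (intro sum.cong refl) (auto simp: cell_def)
  ultimately show ?thesis by (simp add: cell_avg_def)
qed

text \<open>Averaging is an L1 contraction that fixes \<open>h\<close>, so \<open>g\<close> and its
  average are equally close to \<open>h\<close>; hence the factor 2.\<close>

lemma sum_abs_diff_cell_avg_le:
  assumes V: "finite V" and h: "\<And>x x'. x \<in> V \<Longrightarrow> x' \<in> V \<Longrightarrow> c x' = c x \<Longrightarrow> h x' = h x"
  shows "(\<Sum>x\<in>V. \<bar>g x - cell_avg V c g x\<bar>) \<le> 2 * (\<Sum>x\<in>V. \<bar>g x - h x\<bar>)"
proof -
  have "cell_avg V c h x = h x" if "x \<in> V" for x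
    by (rule cell_avg_const[OF V that]) (rule h[OF that])
  then have "(\<Sum>x\<in>V. \<bar>g x - cell_avg V c g x\<bar>) \<le> (\<Sum>x\<in>V. \<bar>g x - h x\<bar> + \<bar>cell_avg V c (\<lambda>x. g x - h x) x\<bar>)"
    by (intro sum_mono) (auto simp: cell_avg_diff)
  also have "\<dots> \<le> 2 * (\<Sum>x\<in>V. \<bar>g x - h x\<bar>)"
    using sum_abs_cell_avg_le[OF V, of c "\<lambda>x. g x - h x"] by (simp add: sum.distrib)
  finally show ?thesis .
qed

text \<open>The variant in which an already averaged \<open>f\<close> replaces \<open>g\<close>
  inside the average; by contraction this adds only the distance from \<open>g\<close> to
  \<open>f\<close>, so that coordinates can be treated one after another.\<close>

lemma sum_abs_diff_cell_avg_le':
  assumes V: "finite V" and h: "\<And>x x'. x \<in> V \<Longrightarrow> x' \<in> V \<Longrightarrow> c x' = c x \<Longrightarrow> h x' = h x"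
  shows "(\<Sum>x\<in>V. \<bar>g x - cell_avg V c f x\<bar>) \<le> 2 * (\<Sum>x\<in>V. \<bar>g x - h x\<bar>) + (\<Sum>x\<in>V. \<bar>g x - f x\<bar>)"
proof -
  have "(\<Sum>x\<in>V. \<bar>g x - cell_avg V c f x\<bar>) \<le> (\<Sum>x\<in>V. \<bar>g x - cell_avg V c g x\<bar> + \<bar>cell_avg V c (\<lambda>x. g x - f x) x\<bar>)"
    by (intro sum_mono) (auto simp: cell_avg_diff)
  also have "\<dots> \<le> 2 * (\<Sum>x\<in>V. \<bar>g x - h x\<bar>) + (\<Sum>x\<in>V. \<bar>g x - f x\<bar>)"
  proof -
    have "(\<Sum>x\<in>V. \<bar>g x - cell_avg V c g x\<bar>) \<le> 2 * (\<Sum>x\<in>V. \<bar>g x - h x\<bar>)"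
      by (rule sum_abs_diff_cell_avg_le[OF V]) (rule h)
    then show ?thesis
      unfolding sum.distrib by (intro add_mono sum_abs_cell_avg_le V)
  qed
  finally show ?thesis .
qed

text \<open>A function close to one that depends on \<open>x\<close> only through \<open>c x\<close> is, by symmetry, close to its
  average over the cells in each of the three coordinates, hence to the average over all three.\<close>

lemma exists_step_function:
  fixes f :: "'a \<Rightarrow> 'a \<Rightarrow> 'a \<Rightarrow> real"
  assumes V: "finite V"
    and sym: "\<And>x y z. f x y z = f y x z" "\<And>x y z. f x y z = f z y x"
    and D: "(\<Sum>z\<in>V. \<Sum>y\<in>V. \<Sum>x\<in>V. \<bar>f x y z - G (c x) y z\<bar>) \<le> D"
  shows "\<exists>h. (\<forall>x y z x' y' z'. c x = c x' \<longrightarrow> c y = c y' \<longrightarrow> c z = c z' \<longrightarrow> h x y z = h x' y' z') \<and>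
    (\<Sum>z\<in>V. \<Sum>y\<in>V. \<Sum>x\<in>V. \<bar>f x y z - h x y z\<bar>) \<le> 6 * D"
proof -
  define F3 where "F3 x y z = cell_avg V c (\<lambda>z. f x y z) z" for x y z
  define F2 where "F2 x y z = cell_avg V c (\<lambda>y. F3 x y z) y" for x y z
  define F1 where "F1 x y z = cell_avg V c (\<lambda>x. F2 x y z) x" for x y z
  \<comment> \<open>Each coordinate is averaged in turn, symmetry moving it into the first argument
    of \<open>G\<close>. The errors are \<open>2 * D\<close>, then \<open>2 * D + 2 * D\<close>,
    then \<open>2 * D + 4 * D\<close>.\<close>
  have "(\<Sum>x\<in>V. \<Sum>y\<in>V. \<Sum>z\<in>V. \<bar>f x y z - F3 x y z\<bar>)
      \<le> (\<Sum>x\<in>V. \<Sum>y\<in>V. 2 * (\<Sum>z\<in>V. \<bar>f x y z - G (c z) y x\<bar>))"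
    unfolding F3_def by (intro sum_mono sum_abs_diff_cell_avg_le V) auto
  also have "\<dots> = 2 * (\<Sum>x\<in>V. \<Sum>y\<in>V. \<Sum>z\<in>V. \<bar>f z y x - G (c z) y x\<bar>)"
    using sym(2) by (simp add: sum_distrib_left)
  also have "\<dots> \<le> 2 * D" using D by simp
  finally have 3: "(\<Sum>x\<in>V. \<Sum>y\<in>V. \<Sum>z\<in>V. \<bar>f x y z - F3 x y z\<bar>) \<le> 2 * D" .
  have "(\<Sum>z\<in>V. \<Sum>x\<in>V. \<Sum>y\<in>V. \<bar>f x y z - F2 x y z\<bar>)
      \<le> (\<Sum>z\<in>V. \<Sum>x\<in>V. 2 * (\<Sum>y\<in>V. \<bar>f x y z - G (c y) x z\<bar>) + (\<Sum>y\<in>V. \<bar>f x y z - F3 x y z\<bar>))"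
    unfolding F2_def by (intro sum_mono sum_abs_diff_cell_avg_le' V) auto
  also have "\<dots> = 2 * (\<Sum>z\<in>V. \<Sum>x\<in>V. \<Sum>y\<in>V. \<bar>f y x z - G (c y) x z\<bar>) + (\<Sum>z\<in>V. \<Sum>x\<in>V. \<Sum>y\<in>V. \<bar>f x y z - F3 x y z\<bar>)"
    using sym(1) by (simp add: sum_distrib_left sum.distrib)
  also have "(\<Sum>z\<in>V. \<Sum>x\<in>V. \<Sum>y\<in>V. \<bar>f x y z - F3 x y z\<bar>) = (\<Sum>x\<in>V. \<Sum>y\<in>V. \<Sum>z\<in>V. \<bar>f x y z - F3 x y z\<bar>)"
    by (subst sum.swap) (intro sum.cong refl sum.swap)
  finally have 2: "(\<Sum>z\<in>V. \<Sum>x\<in>V. \<Sum>y\<in>V. \<bar>f x y z - F2 x y z\<bar>) \<le> 4 * D" using D 3 by linarith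
  have "(\<Sum>z\<in>V. \<Sum>y\<in>V. \<Sum>x\<in>V. \<bar>f x y z - F1 x y z\<bar>)
      \<le> (\<Sum>z\<in>V. \<Sum>y\<in>V. 2 * (\<Sum>x\<in>V. \<bar>f x y z - G (c x) y z\<bar>) + (\<Sum>x\<in>V. \<bar>f x y z - F2 x y z\<bar>))"
    unfolding F1_def by (intro sum_mono sum_abs_diff_cell_avg_le' V) auto
  also have "\<dots> = 2 * (\<Sum>z\<in>V. \<Sum>y\<in>V. \<Sum>x\<in>V. \<bar>f x y z - G (c x) y z\<bar>) + (\<Sum>z\<in>V. \<Sum>y\<in>V. \<Sum>x\<in>V. \<bar>f x y z - F2 x y z\<bar>)"
    by (simp add: sum_distrib_left sum.distrib)
  also have "(\<Sum>z\<in>V. \<Sum>y\<in>V. \<Sum>x\<in>V. \<bar>f x y z - F2 x y z\<bar>) = (\<Sum>z\<in>V. \<Sum>x\<in>V. \<Sum>y\<in>V. \<bar>f x y z - F2 x y z\<bar>)"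
    by (intro sum.cong refl sum.swap)
  finally have 1: "(\<Sum>z\<in>V. \<Sum>y\<in>V. \<Sum>x\<in>V. \<bar>f x y z - F1 x y z\<bar>) \<le> 6 * D" using D 2 by linarith
  have "F1 x y z = F1 x' y' z'" if "c x = c x'" "c y = c y'" "c z = c z'" for x y z x' y' z'
  proof -
    have "F3 a b z = F3 a b z'" for a b unfolding F3_def using that(3) by (rule cell_avg_cong)
    then have "F2 a y z = F2 a y' z'" for a unfolding F2_def using cell_avg_cong[of c y y'] that(2) by simp
    then show ?thesis unfolding F1_def using cell_avg_cong[of c x x'] that(1) by simp
  qed
  then show ?thesis using 1 by blast
qed

text \<open>If the density of a box of cells lies between \<open>\<epsilon>\<close> and
  \<open>1 - \<epsilon>\<close>, the edge indicator takes each of the values 0 and 1 on at least a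
  share \<open>\<epsilon>\<close> of the box. As
  \<open>\<bar>1 - a\<bar> + \<bar>a\<bar> \<ge> 1\<close>, a function with constant value
  \<open>a\<close> on the box errs there by at least \<open>\<epsilon>\<close> times the
  volume.\<close>

lemma card_not_hom_le:
  fixes G :: "'a hg"
  defines "V \<equiv> fst G"
  assumes fin: "finite V"
    and h: "\<And>x y z x' y' z'. c x = c x' \<Longrightarrow> c y = c y' \<Longrightarrow> c z = c z' \<Longrightarrow> h x y z = h x' y' z'"
    and D: "(\<Sum>z\<in>V. \<Sum>y\<in>V. \<Sum>x\<in>V. \<bar>of_bool ({x, y, z} \<in> snd G) - h x y z\<bar>) \<le> D"
  shows "\<epsilon> * real (card {(x, y, z) \<in> V \<times> V \<times> V.
      \<not> hom_triple G \<epsilon> (cell V c x) (cell V c y) (cell V c z)}) \<le> D"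
proof -
  define F where "F = (\<lambda>(x, y, z). \<bar>of_bool ({x, y, z} \<in> snd G) - h x y z\<bar> :: real)"
  define N where "N = (\<lambda>(x, y, z). \<epsilon> * of_bool (\<not> hom_triple G \<epsilon> (cell V c x) (cell V c y) (cell V c z)) :: real)"
  define \<phi> where "\<phi> = (\<lambda>(x, y, z). (c x, c y, c z))"
  define \<Omega> where "\<Omega> = V \<times> V \<times> V"
  have fin\<Omega>: "finite \<Omega>" using fin by (simp add: \<Omega>_def)
  have "\<epsilon> * real (card {(x, y, z) \<in> V \<times> V \<times> V.
      \<not> hom_triple G \<epsilon> (cell V c x) (cell V c y) (cell V c z)}) = (\<Sum>t\<in>\<Omega>. N t)"
  proof -
    have "(\<Sum>t\<in>\<Omega>. N t) = \<epsilon> * (\<Sum>t\<in>\<Omega>. of_bool (case t of (x, y, z) \<Rightarrow> \<not> hom_triple G \<epsilon> (cell V c x) (cell V c y) (cell V c z)))"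
      unfolding N_def by (simp add: sum_distrib_left case_prod_beta)
    also have "\<dots> = \<epsilon> * real (card (\<Omega> \<inter> {t. case t of (x, y, z) \<Rightarrow> \<not> hom_triple G \<epsilon> (cell V c x) (cell V c y) (cell V c z)}))"
      using fin\<Omega> by (simp add: sum_of_bool_eq)
    also have "\<Omega> \<inter> {t. case t of (x, y, z) \<Rightarrow> \<not> hom_triple G \<epsilon> (cell V c x) (cell V c y) (cell V c z)} =
        {(x, y, z) \<in> V \<times> V \<times> V. \<not> hom_triple G \<epsilon> (cell V c x) (cell V c y) (cell V c z)}"
      by (auto simp: \<Omega>_def)
    finally show ?thesis by simp
  qed
  also have "\<dots> = (\<Sum>u\<in>\<phi> ` \<Omega>. \<Sum>t\<in>{t \<in> \<Omega>. \<phi> t = u}. N t)"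
    using fin\<Omega> by (intro sum.group[symmetric]) auto
  also have "\<dots> \<le> (\<Sum>u\<in>\<phi> ` \<Omega>. \<Sum>t\<in>{t \<in> \<Omega>. \<phi> t = u}. F t)"
  proof (rule sum_mono)
    fix u assume "u \<in> \<phi> ` \<Omega>"
    then obtain x0 y0 z0 where 0: "x0 \<in> V" "y0 \<in> V" "z0 \<in> V" and u: "u = (c x0, c y0, c z0)"
      by (auto simp: \<phi>_def \<Omega>_def)
    define X where "X = cell V c x0"
    define Y where "Y = cell V c y0"
    define Z where "Z = cell V c z0"
    note XYZ = X_def Y_def Z_def
    have fXYZ: "finite X" "finite Y" "finite Z" using fin by (auto simp: XYZ cell_def)
    have fib: "{t \<in> \<Omega>. \<phi> t = u} = X \<times> Y \<times> Z"
      by (auto simp: XYZ \<Omega>_def \<phi>_def u cell_def)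
    define p where "p = real (card X) * real (card Y) * real (card Z)"
    have p: "real (card (X \<times> Y \<times> Z)) = p" by (simp add: p_def card_cartesian_product)
    have p0: "0 < p"
    proof -
      have "X \<noteq> {}" "Y \<noteq> {}" "Z \<noteq> {}" 
        using mem_cell_self[OF 0(1), of c] mem_cell_self[OF 0(2), of c] mem_cell_self[OF 0(3), of c] unfolding XYZ by auto
      then show ?thesis using fXYZ by (simp add: p_def card_gt_0_iff)
    qed
    define a where "a = h x0 y0 z0"
    define e where "e = real (card (triples G X Y Z))"
    have N: "(\<Sum>t\<in>X \<times> Y \<times> Z. N t) = (\<Sum>t\<in>X \<times> Y \<times> Z. \<epsilon> * of_bool (\<not> hom_triple G \<epsilon> X Y Z))"
      unfolding N_def XYZ by (intro sum.cong refl) (auto simp: cell_def)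
    have "(\<Sum>t\<in>X \<times> Y \<times> Z. F t) = (\<Sum>t\<in>X \<times> Y \<times> Z. if t \<in> triples G X Y Z then \<bar>1 - a\<bar> else \<bar>a\<bar>)"
    proof (rule sum.cong[OF refl])
      fix t assume "t \<in> X \<times> Y \<times> Z"
      then obtain x y z where t: "t = (x, y, z)" "x \<in> X" "y \<in> Y" "z \<in> Z" by blast
      have "h x y z = a" unfolding a_def using t by (intro h) (auto simp: XYZ cell_def)
      then show "F t = (if t \<in> triples G X Y Z then \<bar>1 - a\<bar> else \<bar>a\<bar>)"
        using t by (auto simp: F_def triples_def)
    qed
    also have "\<dots> = real (card ((X \<times> Y \<times> Z) \<inter> triples G X Y Z)) * \<bar>1 - a\<bar> +
        real (card ((X \<times> Y \<times> Z) - triples G X Y Z)) * \<bar>a\<bar>"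
      using fXYZ by (simp add: sum.If_cases Diff_eq)
    also have "(X \<times> Y \<times> Z) \<inter> triples G X Y Z = triples G X Y Z" using triples_subset[of G X Y Z] by blast
    also have "real (card ((X \<times> Y \<times> Z) - triples G X Y Z)) = p - e"
      unfolding e_def p[symmetric] using fXYZ triples_subset[of G X Y Z]
      by (metis card_Diff_subset card_mono finite_SigmaI finite_subset of_nat_diff)
    finally have F: "(\<Sum>t\<in>X \<times> Y \<times> Z. F t) = e * \<bar>1 - a\<bar> + (p - e) * \<bar>a\<bar>" by (simp add: e_def)
    have e: "0 \<le> e" "e \<le> p" using card_triples_le[OF fXYZ, of G] by (auto simp: e_def p_def)
    have d: "dens G X Y Z = e / p" by (simp add: dens_eq e_def p_def)
    show "(\<Sum>t\<in>{t \<in> \<Omega>. \<phi> t = u}. N t) \<le> (\<Sum>t\<in>{t \<in> \<Omega>. \<phi> t = u}. F t)"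
    proof (cases "hom_triple G \<epsilon> X Y Z")
      case True
      then show ?thesis unfolding fib N F using e by simp
    next
      case False
      then have "\<epsilon> \<le> e / p" "e / p \<le> 1 - \<epsilon>"
        using dens_bounds[OF fXYZ, of G] unfolding hom_triple_def d by linarith+
      then have ee: "\<epsilon> * p \<le> e" "\<epsilon> * p \<le> p - e"
        using p0 by (auto simp: field_simps)
      show ?thesis
      proof (cases "0 \<le> \<epsilon>")
        case True
        have "\<epsilon> * p * 1 \<le> \<epsilon> * p * (\<bar>1 - a\<bar> + \<bar>a\<bar>)"
          using p0 True by (intro mult_left_mono) auto
        also have "\<dots> = \<epsilon> * p * \<bar>1 - a\<bar> + \<epsilon> * p * \<bar>a\<bar>" by (rule distrib_left)
        also have "\<dots> \<le> e * \<bar>1 - a\<bar> + (p - e) * \<bar>a\<bar>"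
          using ee by (intro add_mono mult_right_mono) auto
        finally show ?thesis unfolding fib N F using False p by (simp add: mult.commute)
      next
        case neg: False
        have "p * \<epsilon> \<le> 0" using neg p0 by (simp add: mult_le_0_iff)
        then show ?thesis unfolding fib N F using False p e by (auto intro: order_trans)
      qed
    qed
  qed
  also have "\<dots> = (\<Sum>t\<in>\<Omega>. F t)"
    using fin\<Omega> by (intro sum.group) auto
  also have "\<dots> = (\<Sum>x\<in>V. \<Sum>y\<in>V. \<Sum>z\<in>V. F (x, y, z))"
    unfolding \<Omega>_def by (simp add: sum.cartesian_product)
  also have "\<dots> = (\<Sum>y\<in>V. \<Sum>x\<in>V. \<Sum>z\<in>V. F (x, y, z))" by (rule sum.swap)
  also have "\<dots> = (\<Sum>y\<in>V. \<Sum>z\<in>V. \<Sum>x\<in>V. F (x, y, z))" by (intro sum.cong refl sum.swap)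
  also have "\<dots> = (\<Sum>z\<in>V. \<Sum>y\<in>V. \<Sum>x\<in>V. F (x, y, z))" by (rule sum.swap)
  also have "\<dots> \<le> D" using D by (simp add: F_def)
  finally show ?thesis .
qed

text \<open>The step function is within \<open>6 * D\<close> of the edge relation in L1, and a box
  that is not homogeneous costs \<open>\<epsilon>\<close> per triple. The square in \<open>s\<close>
  leaves a share \<open>\<epsilon>\<close> of exceptional triples after division by
  \<open>\<epsilon>\<close>.\<close>

lemma exists_hom_partition:
  fixes G :: "'a hg"
  assumes V: "finite (fst G)" and free: "tensor_free k (snd G) (fst G)" and eps: "0 < \<epsilon>"
    and s: "6 * (real (k + 2) * (1 / real (Suc s1) + real s1 / real (Suc s2))) \<le> \<epsilon> ^ 2"
    and n: "\<And>s. s \<in> {s1, s2} \<Longrightarrow>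
      Suc s * 2 ^ Suc s + 2 ^ Suc s * (k * (Suc s * 2 ^ Suc s) ^ 2 ^ k) * Suc s \<le> card (fst G)"
  shows "\<exists>P. hom_partition G \<epsilon> P \<and> card P \<le> 2 ^ (s1 * s2)"
proof -
  let ?V = "fst G" and ?E = "snd G"
  define D where "D = real (k + 2) * (1 / real (Suc s1) + real s1 / real (Suc s2)) * real (card ?V) ^ 3"
  obtain A B where AB: "A \<subseteq> ?V" "B \<subseteq> ?V" "card A = s1" "card B = s2"
    and le: "real (\<Sum>w\<in>?V. link_error ?E ?V w A) + real (card ?V) * real (\<Sum>a\<in>A. link_error ?E ?V a B) \<le> D"
    using exists_sample_pair[OF V free n] unfolding D_def by metis
  have fin: "finite A" "finite B" using AB V finite_subset by blast+
  define c where "c x = {(a, b) \<in> A \<times> B. {a, b, x} \<in> ?E}" for x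
  define g where "g y z t = majority ?E ?V z A y {a \<in> A. majority ?E ?V a B z {b \<in> B. (a, b) \<in> t}}" for y z t
  define f where "f x y z = (of_bool ({x, y, z} \<in> ?E) :: real)" for x y z
  have "(\<Sum>z\<in>?V. \<Sum>y\<in>?V. \<Sum>x\<in>?V. \<bar>f x y z - of_bool (g y z (c x))\<bar>) =
      (\<Sum>z\<in>?V. \<Sum>y\<in>?V. real (card {x \<in> ?V. ({x, y, z} \<in> ?E) \<noteq> g y z (c x)}))"
  proof (intro sum.cong refl)
    fix y z
    have "(\<Sum>x\<in>?V. \<bar>f x y z - of_bool (g y z (c x))\<bar>) = (\<Sum>x\<in>?V. of_bool (({x, y, z} \<in> ?E) \<noteq> g y z (c x)))"
      by (intro sum.cong refl) (auto simp: f_def)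
    also have "\<dots> = real (card {x \<in> ?V. ({x, y, z} \<in> ?E) \<noteq> g y z (c x)})"
      using V by (simp add: sum_of_bool_eq Int_def)
    finally show "(\<Sum>x\<in>?V. \<bar>f x y z - of_bool (g y z (c x))\<bar>) = \<dots>" .
  qed
  also have "\<dots> = real (card {(x, y, z) \<in> ?V \<times> ?V \<times> ?V. ({x, y, z} \<in> ?E) \<noteq> g y z (c x)})"
    unfolding card_triple_collect[OF V] of_nat_sum ..
  also have "\<dots> \<le> real ((\<Sum>w\<in>?V. link_error ?E ?V w A) + card ?V * (\<Sum>a\<in>A. link_error ?E ?V a B))"
    unfolding c_def g_def by (intro of_nat_mono card_predict_le V fin)
  also have "\<dots> \<le> D" using le by simp
  finally have L1: "(\<Sum>z\<in>?V. \<Sum>y\<in>?V. \<Sum>x\<in>?V. \<bar>f x y z - of_bool (g y z (c x))\<bar>) \<le> D" .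
  have sym: "f x y z = f y x z" "f x y z = f z y x" for x y z
    by (simp_all add: f_def insert_commute)
  obtain h where h: "\<And>x y z x' y' z'. c x = c x' \<Longrightarrow> c y = c y' \<Longrightarrow> c z = c z' \<Longrightarrow> h x y z = h x' y' z'"
    and hD: "(\<Sum>z\<in>?V. \<Sum>y\<in>?V. \<Sum>x\<in>?V. \<bar>f x y z - h x y z\<bar>) \<le> 6 * D"
    using exists_step_function[OF V, of f "\<lambda>t y z. of_bool (g y z t)" c D] sym L1 by blast
  have "\<epsilon> * real (card {(x, y, z) \<in> ?V \<times> ?V \<times> ?V.
      \<not> hom_triple G \<epsilon> (cell ?V c x) (cell ?V c y) (cell ?V c z)}) \<le> 6 * D"
    by (rule card_not_hom_le[OF V h]) (use hD in \<open>auto simp: f_def\<close>)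
  also have "6 * D = 6 * (real (k + 2) * (1 / real (Suc s1) + real s1 / real (Suc s2))) * real (card ?V) ^ 3"
    by (simp add: D_def)
  also have "\<dots> \<le> \<epsilon> ^ 2 * real (card ?V) ^ 3" by (intro mult_right_mono s) simp
  also have "\<dots> = \<epsilon> * (\<epsilon> * real (card ?V) ^ 3)" by (simp add: power2_eq_square)
  finally have "real (card {(x, y, z) \<in> ?V \<times> ?V \<times> ?V.
      \<not> hom_triple G \<epsilon> (cell ?V c x) (cell ?V c y) (cell ?V c z)}) \<le> \<epsilon> * real (card ?V) ^ 3"
    using eps by simp
  then have "hom_partition G \<epsilon> (cell ?V c ` ?V)"
    unfolding hom_partition_def
    by (subst good_partition_iff[OF V partition_on_cells, where p = "cell ?V c"]) (auto simp: mem_cell_self)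
  moreover have "card (cell ?V c ` ?V) \<le> 2 ^ (s1 * s2)"
  proof -
    have "card (cell ?V c ` ?V) \<le> card (c ` ?V)" by (rule card_cells_le[OF V])
    also have "\<dots> \<le> card (Pow (A \<times> B))" using fin by (intro card_mono) (auto simp: c_def)
    also have "\<dots> = 2 ^ (s1 * s2)" using fin AB by (simp add: card_Pow card_cartesian_product)
    finally show ?thesis .
  qed
  ultimately show ?thesis by blast
qed

section \<open>Copies of \<open>k \<otimes> U(k)\<close>\<close>

text \<open>\<open>tensor\<close> reads \<open>{u, w}\<close> as an unordered pair, so
  \<open>u\<close> may come from either side; both orders give the same triple.\<close>

lemma snd_tensor_Ubip:
  "snd (tensor k (Ubip k)) =
    {{Inl i, Inr (Inl j), Inr (Inr S)} | i j S. i \<in> {1..k} \<and> j \<in> {1..k} \<and> S \<subseteq> {1..k} \<and> j \<in> S}"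
  (is "_ = ?R")
proof (intro set_eqI iffI)
  fix e assume "e \<in> snd (tensor k (Ubip k))"
  then obtain i u w j S where e: "e = {Inl i, Inr u, Inr w}" "i \<in> {1..k}"
    and uw: "{u, w} = {Inl j, Inr S}" and jS: "j \<in> {1..k}" "S \<subseteq> {1..k}" "j \<in> S"
    by (auto simp: tensor_def Ubip_def)
  from uw have "e = {Inl i, Inr (Inl j), Inr (Inr S)}"
    unfolding e by (auto simp: doubleton_eq_iff)
  then show "e \<in> ?R" using e(2) jS by blast
next
  fix e assume "e \<in> ?R"
  then show "e \<in> snd (tensor k (Ubip k))" unfolding tensor_def Ubip_def by simp blast
qed

lemma fst_tensor_Ubip:
  "fst (tensor k (Ubip k)) = Inl ` {1..k} \<union> Inr ` (Inl ` {1..k} \<union> Inr ` Pow {1..k})"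
  by (simp add: tensor_def Ubip_def)

lemma mem_tensor_Ubip_iff:
  assumes "i \<in> {1..k}" "j \<in> {1..k}" "S \<subseteq> {1..k}"
  shows "{Inl i, Inr (Inl j), Inr (Inr S)} \<in> snd (tensor k (Ubip k)) \<longleftrightarrow> j \<in> S"
proof
  assume "{Inl i, Inr (Inl j), Inr (Inr S)} \<in> snd (tensor k (Ubip k))"
  then obtain i' j' S' where "{Inl i, Inr (Inl j), Inr (Inr S)} = {Inl i', Inr (Inl j'), Inr (Inr S')}" "j' \<in> S'"
    unfolding snd_tensor_Ubip by blast
  then have "Inr (Inl j) \<in> {Inl i', Inr (Inl j'), Inr (Inr S')}" "Inr (Inr S) \<in> {Inl i', Inr (Inl j'), Inr (Inr S')}"
    by blast+
  then show "j \<in> S" using \<open>j' \<in> S'\<close> by auto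
next
  assume "j \<in> S" then show "{Inl i, Inr (Inl j), Inr (Inr S)} \<in> snd (tensor k (Ubip k))"
    unfolding snd_tensor_Ubip using assms by blast
qed

lemma is_3graph_tensor_Ubip: "is_3graph (tensor k (Ubip k))"
proof -
  have "e \<subseteq> fst (tensor k (Ubip k)) \<and> card e = 3" if e: "e \<in> snd (tensor k (Ubip k))" for e
  proof -
    obtain i j S where "e = {Inl i, Inr (Inl j), Inr (Inr S)}" "i \<in> {1..k}" "j \<in> {1..k}" "S \<subseteq> {1..k}"
      using e unfolding snd_tensor_Ubip by blast
    then show ?thesis unfolding fst_tensor_Ubip by auto
  qed
  moreover have "finite (fst (tensor k (Ubip k)))" by (simp add: fst_tensor_Ubip)
  ultimately show ?thesis by (simp add: is_3graph_def)
qed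

lemma trip_edge_iff:
  assumes "{p, q, r} = {0, 1, 2 :: nat}"
  shows "{(x, p), (y, q), (z, r)} \<in> snd (trip G) \<longleftrightarrow> {x, y, z} \<in> snd G"
proof
  assume "{(x, p), (y, q), (z, r)} \<in> snd (trip G)"
  then obtain v v' v'' where e: "{(x, p), (y, q), (z, r)} = {(v, 0), (v', 1), (v'', 2)}" and v: "{v, v', v''} \<in> snd G"
    by (auto simp: trip_def)
  have "{x, y, z} = {v, v', v''}" using arg_cong[OF e, of "image fst"] by simp
  then show "{x, y, z} \<in> snd G" using v by simp
next
  assume xyz: "{x, y, z} \<in> snd G"
  have mem: "{(v, 0), (v', 1), (v'', 2)} \<in> snd (trip G)" if "{v, v', v''} \<in> snd G" for v v' v''
    using that by (auto simp: trip_def)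
  have pqr: "p \<in> {0, 1, 2}" "q \<in> {0, 1, 2}" "r \<in> {0, 1, 2}" and all: "0 \<in> {p, q, r}" "1 \<in> {p, q, r}" "2 \<in> {p, q, r}"
    using assms by blast+
  from pqr consider "p = 0" "q = 1" "r = 2" | "p = 0" "q = 2" "r = 1" | "p = 1" "q = 0" "r = 2"
    | "p = 1" "q = 2" "r = 0" | "p = 2" "q = 0" "r = 1" | "p = 2" "q = 1" "r = 0"
    by (elim insertE emptyE) (use all in simp_all)
  then show "{(x, p), (y, q), (z, r)} \<in> snd (trip G)"
    using mem[of x y z] mem[of x z y] mem[of y x z] mem[of z x y] mem[of y z x] mem[of z y x] xyz
    by cases (simp_all add: insert_commute)
qed

text \<open>The images of the three maps may overlap in \<open>G\<close>, since each map goes into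
  its own class of \<open>trip G\<close>; injectivity of each one suffices.\<close>

lemma in_Trip_tensor_UbipI:
  fixes \<gamma> \<alpha> :: "nat \<Rightarrow> nat" and \<beta> :: "nat set \<Rightarrow> nat"
  assumes G: "G \<in> \<H>" and inj: "inj_on \<gamma> {1..k}" "inj_on \<alpha> {1..k}" "inj_on \<beta> (Pow {1..k})"
    and V: "\<gamma> ` {1..k} \<subseteq> fst G" "\<alpha> ` {1..k} \<subseteq> fst G" "\<beta> ` Pow {1..k} \<subseteq> fst G"
    and E: "\<And>i j S. i \<in> {1..k} \<Longrightarrow> j \<in> {1..k} \<Longrightarrow> S \<subseteq> {1..k} \<Longrightarrow> {\<gamma> i, \<alpha> j, \<beta> S} \<in> snd G \<longleftrightarrow> j \<in> S"
  shows "in_Trip \<H> (tensor k (Ubip k))"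
proof -
  let ?F = "tensor k (Ubip k)"
  define f where "f = case_sum (\<lambda>i. (\<gamma> i, 0 :: nat)) (case_sum (\<lambda>j. (\<alpha> j, 1)) (\<lambda>S. (\<beta> S, 2)))"
  have f [simp]: "f (Inl i) = (\<gamma> i, 0)" "f (Inr (Inl j)) = (\<alpha> j, 1)" "f (Inr (Inr S)) = (\<beta> S, 2)" for i j S
    by (simp_all add: f_def)
  define W where "W = f ` fst ?F"
  have W: "(v, 0) \<in> W \<longleftrightarrow> v \<in> \<gamma> ` {1..k}" "(v, Suc 0) \<in> W \<longleftrightarrow> v \<in> \<alpha> ` {1..k}" "(v, 2) \<in> W \<longleftrightarrow> v \<in> \<beta> ` Pow {1..k}" for v
    by (auto simp: W_def fst_tensor_Ubip image_Un image_image)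
  have sub: "W \<subseteq> fst (trip G)"
    using V by (auto simp: W_def fst_tensor_Ubip trip_def image_subset_iff)
  have inj_f: "inj_on f (fst ?F)"
  proof (rule inj_onI)
    fix u v assume "u \<in> fst ?F" "v \<in> fst ?F" "f u = f v"
    then show "u = v"
      unfolding fst_tensor_Ubip
      by (auto simp: inj_on_eq_iff[OF inj(1)] inj_on_eq_iff[OF inj(2)] inj_on_eq_iff[OF inj(3)])
  qed
  have "{e \<in> snd (trip G). e \<subseteq> W} = (\<lambda>e. f ` e) ` snd ?F"
  proof (intro set_eqI iffI)
    fix e assume "e \<in> {e \<in> snd (trip G). e \<subseteq> W}"
    then obtain v v' v'' where e: "e = {(v, 0), (v', 1), (v'', 2)}" "{v, v', v''} \<in> snd G" and "e \<subseteq> W"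
      by (auto simp: trip_def)
    then obtain i j S where ijS: "i \<in> {1..k}" "j \<in> {1..k}" "S \<subseteq> {1..k}" "v = \<gamma> i" "v' = \<alpha> j" "v'' = \<beta> S"
      using W by auto
    then have "{Inl i, Inr (Inl j), Inr (Inr S)} \<in> snd ?F"
      using E[of i j S] e(2) by (simp add: mem_tensor_Ubip_iff)
    moreover have "e = f ` {Inl i, Inr (Inl j), Inr (Inr S)}" using e ijS by simp
    ultimately show "e \<in> (\<lambda>e. f ` e) ` snd ?F" by blast
  next
    fix e assume "e \<in> (\<lambda>e. f ` e) ` snd ?F"
    then obtain i j S where ijS: "i \<in> {1..k}" "j \<in> {1..k}" "S \<subseteq> {1..k}" "j \<in> S"
      and e: "e = f ` {Inl i, Inr (Inl j), Inr (Inr S)}"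
      unfolding snd_tensor_Ubip by blast
    then have "{\<gamma> i, \<alpha> j, \<beta> S} \<in> snd G" using E by simp
    then have "e \<in> snd (trip G)" using trip_edge_iff[of 0 1 2 "\<gamma> i" "\<alpha> j" "\<beta> S" G] by (simp add: e)
    moreover have "e \<subseteq> W" using ijS by (auto simp: e W)
    ultimately show "e \<in> {e \<in> snd (trip G). e \<subseteq> W}" by simp
  qed
  then have "hg_iso ?F (induced (trip G) W)"
    unfolding hg_iso_def induced_def using inj_f by (intro exI[of _ f]) (simp add: W_def inj_on_imp_bij_betw)
  then show ?thesis
    unfolding in_Trip_def using is_3graph_tensor_Ubip G sub by blast
qed

text \<open>The embedding may permute the three classes of \<open>trip G\<close>. But every edge
  meets all three, so one edge fixes \<open>p\<close>, \<open>q\<close>, \<open>r\<close>, and a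
  vertex on an edge with two vertices of known class has the third. The vertex for
  \<open>S = {}\<close> is isolated and its class stays unknown; therefore the edge rule and the
  injectivity of \<open>\<beta>\<close> leave it out.\<close>

lemma in_Trip_tensor_UbipE:
  assumes tr: "in_Trip \<H> (tensor k (Ubip k))" and k: "1 \<le> k"
  obtains G and \<gamma> \<alpha> :: "nat \<Rightarrow> nat" and \<beta> :: "nat set \<Rightarrow> nat"
  where "G \<in> \<H>" "inj_on \<gamma> {1..k}" "inj_on \<alpha> {1..k}" "inj_on \<beta> (Pow {1..k} - {{}})"
    "\<gamma> ` {1..k} \<subseteq> fst G" "\<alpha> ` {1..k} \<subseteq> fst G" "\<beta> ` Pow {1..k} \<subseteq> fst G"
    "\<And>i j S. i \<in> {1..k} \<Longrightarrow> j \<in> {1..k} \<Longrightarrow> S \<subseteq> {1..k} \<Longrightarrow> S \<noteq> {} \<Longrightarrow> {\<gamma> i, \<alpha> j, \<beta> S} \<in> snd G \<longleftrightarrow> j \<in> S"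
proof -
  let ?F = "tensor k (Ubip k)"
  obtain G W f where G: "G \<in> \<H>" and W: "W \<subseteq> fst (trip G)" and bij: "bij_betw f (fst ?F) W"
    and E: "{e \<in> snd (trip G). e \<subseteq> W} = (\<lambda>e. f ` e) ` snd ?F"
    using tr unfolding in_Trip_def hg_iso_def induced_def by auto
  define c where "c i = f (Inl i)" for i
  define a where "a j = f (Inr (Inl j))" for j
  define b where "b S = f (Inr (Inr S))" for S
  have inj: "inj_on f (fst ?F)" and img: "f ` fst ?F = W" using bij by (auto simp: bij_betw_def)
  have cab: "{c i, a j, b S} \<in> snd (trip G) \<longleftrightarrow> j \<in> S" if "i \<in> {1..k}" "j \<in> {1..k}" "S \<subseteq> {1..k}" for i j S
  proof -
    let ?e = "{Inl i, Inr (Inl j), Inr (Inr S)}"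
    have sub: "?e \<subseteq> fst ?F" using that by (auto simp: fst_tensor_Ubip)
    have "{c i, a j, b S} = f ` ?e" by (simp add: c_def a_def b_def)
    moreover have "f ` ?e \<subseteq> W" using sub img by blast
    ultimately have "{c i, a j, b S} \<in> snd (trip G) \<longleftrightarrow> f ` ?e \<in> (\<lambda>e. f ` e) ` snd ?F"
      using E by auto
    also have "\<dots> \<longleftrightarrow> ?e \<in> snd ?F"
    proof
      assume "f ` ?e \<in> (\<lambda>e. f ` e) ` snd ?F"
      then obtain e where e: "e \<in> snd ?F" "f ` ?e = f ` e" by blast
      then have "e \<subseteq> fst ?F" using is_3graph_tensor_Ubip unfolding is_3graph_def by blast
      then show "?e \<in> snd ?F" using inj_on_image_eq_iff[OF inj sub] e by metis
    qed (rule imageI)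
    also have "\<dots> \<longleftrightarrow> j \<in> S" using that by (rule mem_tensor_Ubip_iff)
    finally show ?thesis .
  qed
  have \<sigma>: "{snd (c i), snd (a j), snd (b S)} = {0, 1, 2}" if "i \<in> {1..k}" "j \<in> S" "S \<subseteq> {1..k}" for i j S
  proof -
    have "{c i, a j, b S} \<in> snd (trip G)" using cab[of i j S] that by auto
    then obtain v v' v'' where "{c i, a j, b S} = {(v, 0), (v', 1), (v'', 2)}" by (auto simp: trip_def)
    from arg_cong[OF this, of "image snd"] show ?thesis by simp
  qed
  have third: "x = x'" if "{x, y, z} = {0, 1, 2 :: nat}" "{x', y, z} = {0, 1, 2}" for x x' y z
  proof -
    have "card {x, y, z} = 3" using that(1) by simp
    then have "x \<noteq> y" "x \<noteq> z" by (auto simp: card_insert_if split: if_splits)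
    moreover have "{x, y, z} = {x', y, z}" using that by simp
    then have "x \<in> {x', y, z}" by blast
    ultimately show ?thesis by simp
  qed
  define p q r where "p = snd (c 1)" and "q = snd (a 1)" and "r = snd (b {1..k})"
  have pqr: "{p, q, r} = {0, 1, 2}" unfolding p_def q_def r_def using k by (intro \<sigma>) auto
  have c: "snd (c i) = p" if "i \<in> {1..k}" for i
    using third[of "snd (c i)" q r p] \<sigma>[of i 1 "{1..k}"] pqr that k by (auto simp: q_def r_def)
  have a: "snd (a j) = q" if "j \<in> {1..k}" for j
    using third[of "snd (a j)" p r q] \<sigma>[of 1 j "{1..k}"] pqr that k by (auto simp: p_def r_def insert_commute)
  have b: "snd (b S) = r" if S: "S \<subseteq> {1..k}" "S \<noteq> {}" for S
  proof -
    obtain j where j: "j \<in> S" using S by blast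
    then have "snd (a j) = q" using a S by blast
    then have "{p, q, snd (b S)} = {0, 1, 2}" using \<sigma>[of 1 j S] S j k by (simp add: p_def)
    then show ?thesis using third[of "snd (b S)" p q r] pqr by (simp add: insert_commute)
  qed
  have injD: "x = y" if "f x = f y" "x \<in> fst ?F" "y \<in> fst ?F" for x y
    using inj that by (rule inj_onD)
  have mem: "fst (f x) \<in> fst G" if "x \<in> fst ?F" for x
    using img W that by (auto simp: trip_def)
  show thesis
  proof (rule that[of G "fst \<circ> c" "fst \<circ> a" "fst \<circ> b"])
    show "inj_on (fst \<circ> c) {1..k}"
    proof (rule inj_onI)
      fix i i' assume i: "i \<in> {1..k}" "i' \<in> {1..k}" "(fst \<circ> c) i = (fst \<circ> c) i'"
      then have "c i = c i'" using c by (simp add: prod_eq_iff)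
      then show "i = i'" using injD[of "Inl i" "Inl i'"] i by (simp add: c_def fst_tensor_Ubip)
    qed
    show "inj_on (fst \<circ> a) {1..k}"
    proof (rule inj_onI)
      fix i i' assume i: "i \<in> {1..k}" "i' \<in> {1..k}" "(fst \<circ> a) i = (fst \<circ> a) i'"
      then have "a i = a i'" using a by (simp add: prod_eq_iff)
      then show "i = i'" using injD[of "Inr (Inl i)" "Inr (Inl i')"] i by (auto simp: a_def fst_tensor_Ubip)
    qed
    show "inj_on (fst \<circ> b) (Pow {1..k} - {{}})"
    proof (rule inj_onI)
      fix S S' assume S: "S \<in> Pow {1..k} - {{}}" "S' \<in> Pow {1..k} - {{}}" "(fst \<circ> b) S = (fst \<circ> b) S'"
      then have "b S = b S'" using b by (simp add: prod_eq_iff)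
      then show "S = S'" using injD[of "Inr (Inr S)" "Inr (Inr S')"] S by (auto simp: b_def fst_tensor_Ubip)
    qed
    show "(fst \<circ> c) ` {1..k} \<subseteq> fst G" "(fst \<circ> a) ` {1..k} \<subseteq> fst G" "(fst \<circ> b) ` Pow {1..k} \<subseteq> fst G"
      by (auto simp: c_def a_def b_def fst_tensor_Ubip intro!: mem)
    fix i j S assume ijS: "i \<in> {1..k}" "j \<in> {1..k}" "S \<subseteq> {1..k}" "S \<noteq> {}"
    have "c i = (fst (c i), p)" "a j = (fst (a j), q)" "b S = (fst (b S), r)"
      using c a b ijS by (simp_all add: prod_eq_iff)
    then show "{(fst \<circ> c) i, (fst \<circ> a) j, (fst \<circ> b) S} \<in> snd G \<longleftrightarrow> j \<in> S"
      using cab[OF ijS(1-3)] trip_edge_iff[OF pqr, of "fst (c i)" "fst (a j)" "fst (b S)" G] by simp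
  qed (rule G)
qed

lemma tensor_free_if_not_in_Trip:
  assumes G: "G \<in> \<H>" "is_3graph G" and ntr: "\<not> in_Trip \<H> (tensor k (Ubip k))"
  shows "tensor_free k (snd G) (fst G)"
  unfolding tensor_free_def
proof (intro allI impI, elim conjE)
  fix J b assume J: "J \<subseteq> fst G" "card J = k" and b: "b \<in> Pow J \<rightarrow> fst G"
  let ?W = "{w \<in> fst G. \<forall>S\<subseteq>J. link_trace (snd G) w J (b S) = S}"
  have fin: "finite (fst G)" using G(2) by (simp add: is_3graph_def)
  then have finJ: "finite J" using J finite_subset by blast
  show "card ?W \<le> k"
  proof (rule ccontr)
    assume "\<not> card ?W \<le> k"
    then have "k \<le> card ?W" "card ?W \<noteq> 0" by linarith+
    then have "?W \<noteq> {}" by (metis (lifting) card.empty)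
    from \<open>k \<le> card ?W\<close> obtain W where W: "W \<subseteq> ?W" "card W = k" "finite W"
      by (rule obtain_subset_with_card_n)
    \<comment> \<open>One common \<open>w0\<close> already makes \<open>b\<close> injective, since
      in its link \<open>b S\<close> has trace \<open>S\<close>.\<close>
    obtain w0 where w0: "w0 \<in> ?W" using \<open>?W \<noteq> {}\<close> by blast
    obtain \<alpha> where \<alpha>: "bij_betw \<alpha> {1..k} J" using ex_bij_betw_nat_finite_1[OF finJ] J(2) by blast
    obtain \<gamma> where \<gamma>: "bij_betw \<gamma> {1..k} W" using ex_bij_betw_nat_finite_1[OF W(3)] W(2) by blast
    have aS: "\<alpha> ` S \<subseteq> J" if "S \<subseteq> {1..k}" for S using \<alpha> that by (auto simp: bij_betw_def)
    have "in_Trip \<H> (tensor k (Ubip k))"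
    proof (rule in_Trip_tensor_UbipI[where \<gamma> = \<gamma> and \<alpha> = \<alpha> and \<beta> = "\<lambda>S. b (\<alpha> ` S)", OF G(1)])
      show "inj_on \<gamma> {1..k}" "inj_on \<alpha> {1..k}" using \<alpha> \<gamma> by (simp_all add: bij_betw_def)
      show "inj_on (\<lambda>S. b (\<alpha> ` S)) (Pow {1..k})"
      proof (rule inj_onI)
        fix S S' assume S: "S \<in> Pow {1..k}" "S' \<in> Pow {1..k}" "b (\<alpha> ` S) = b (\<alpha> ` S')"
        have "\<alpha> ` S = \<alpha> ` S'" using w0 S aS[of S] aS[of S'] by (metis (mono_tags, lifting) PowD mem_Collect_eq)
        then show "S = S'" using S \<alpha> inj_on_image_eq_iff[of \<alpha> "{1..k}" S S'] by (auto simp: bij_betw_def)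
      qed
      show "\<gamma> ` {1..k} \<subseteq> fst G" using \<gamma> W by (auto simp: bij_betw_def)
      show "\<alpha> ` {1..k} \<subseteq> fst G" using \<alpha> J by (auto simp: bij_betw_def)
      show "(\<lambda>S. b (\<alpha> ` S)) ` Pow {1..k} \<subseteq> fst G" using b aS by blast
      fix i j S assume ijS: "i \<in> {1..k}" "j \<in> {1..k}" "S \<subseteq> {1..k}"
      have "\<gamma> i \<in> W" using \<gamma> ijS by (auto simp: bij_betw_def)
      then have "\<gamma> i \<in> ?W" using W(1) by blast
      then have t: "link_trace (snd G) (\<gamma> i) J (b (\<alpha> ` S)) = \<alpha> ` S" using aS[OF ijS(3)] by blast
      have "\<alpha> j \<in> J" using \<alpha> ijS by (auto simp: bij_betw_def)
      then have "{\<gamma> i, \<alpha> j, b (\<alpha> ` S)} \<in> snd G \<longleftrightarrow> \<alpha> j \<in> \<alpha> ` S"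
        using t by (auto simp: link_trace_def)
      also have "\<dots> \<longleftrightarrow> j \<in> S" using \<alpha> ijS inj_on_image_mem_iff[of \<alpha> "{1..k}" j S] by (simp add: bij_betw_def)
      finally show "{\<gamma> i, \<alpha> j, b (\<alpha> ` S)} \<in> snd G \<longleftrightarrow> j \<in> S" .
    qed
    then show False using ntr by contradiction
  qed
qed

lemma admits_hom_pow:
  assumes H: "hereditary \<H>" and ntr: "\<not> in_Trip \<H> (tensor k (Ubip k))" and eps: "0 < \<epsilon>"
    and s: "6 * (real (k + 2) * (1 / real (Suc s1) + real s1 / real (Suc s2))) \<le> \<epsilon> ^ 2"
  shows "admits_hom \<H> \<epsilon> (2 ^ (s1 * s2))"
proof -
  define N where "N s = Suc s * 2 ^ Suc s + 2 ^ Suc s * (k * (Suc s * 2 ^ Suc s) ^ 2 ^ k) * Suc s" for s :: nat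
  have "\<exists>P. hom_partition G \<epsilon> P \<and> card P \<le> 2 ^ (s1 * s2)" if G: "G \<in> \<H>" "N s1 + N s2 \<le> card (fst G)" for G
  proof -
    have G3: "is_3graph G" using H G by (auto simp: hereditary_def)
    show ?thesis
    proof (rule exists_hom_partition[OF _ _ eps s])
      show "finite (fst G)" using G3 by (simp add: is_3graph_def)
      show "tensor_free k (snd G) (fst G)" using tensor_free_if_not_in_Trip[OF G(1) G3 ntr] .
      fix s assume "s \<in> {s1, s2}"
      then have "N s \<le> card (fst G)" using G by auto
      then show "Suc s * 2 ^ Suc s + 2 ^ Suc s * (k * (Suc s * 2 ^ Suc s) ^ 2 ^ k) * Suc s \<le> card (fst G)"
        by (simp only: N_def)
    qed
  qed
  then show ?thesis unfolding admits_hom_def by blast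
qed

text \<open>The factor 12 gives each of the two error terms half of \<open>\<epsilon>\<close> after
  multiplication by 6. The inner errors add up over \<open>s1\<close> points, so \<open>s2\<close>
  must be larger than \<open>s1\<close> by another factor of order
  \<open>\<kappa> / \<epsilon>\<close>, and the product is cubic; 2041 is
  \<open>13 * 157\<close>.\<close>

lemma sample_sizes:
  fixes \<kappa> \<epsilon> :: real
  assumes "1 \<le> \<kappa>" "0 < \<epsilon>"
  defines "s1 \<equiv> nat \<lceil>12 * \<kappa> / \<epsilon>\<rceil>"
  defines "s2 \<equiv> nat \<lceil>12 * \<kappa> * real s1 / \<epsilon>\<rceil>"
  shows "6 * (\<kappa> * (1 / real (Suc s1) + real s1 / real (Suc s2))) \<le> \<epsilon>"
    and "\<epsilon> \<le> 1 \<Longrightarrow> real (s1 * s2) \<le> 2041 * \<kappa> ^ 3 / \<epsilon> ^ 3"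
proof -
  have up: "real (nat \<lceil>x\<rceil>) \<le> x + 1" if "0 \<le> x" for x :: real
    using that by linarith
  have r1: "12 * \<kappa> / \<epsilon> \<le> real s1" unfolding s1_def by (rule real_nat_ceiling_ge)
  have r2: "12 * \<kappa> * real s1 / \<epsilon> \<le> real s2" unfolding s2_def by (rule real_nat_ceiling_ge)
  have "12 * \<kappa> \<le> \<epsilon> * real (Suc s1)"
    using r1 assms(2) by (simp add: field_simps)
  then have 1: "12 * (\<kappa> * (1 / real (Suc s1))) \<le> \<epsilon>" by (simp add: field_simps)
  have "12 * \<kappa> * real s1 \<le> \<epsilon> * real (Suc s2)"
    using r2 assms(2) by (simp add: field_simps)
  then have 2: "12 * (\<kappa> * (real s1 / real (Suc s2))) \<le> \<epsilon>" by (simp add: field_simps)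
  show "6 * (\<kappa> * (1 / real (Suc s1) + real s1 / real (Suc s2))) \<le> \<epsilon>"
    using 1 2 unfolding distrib_left by linarith
  assume e1: "\<epsilon> \<le> 1"
  define t where "t = \<kappa> / \<epsilon>"
  have t: "1 \<le> t" using assms(1,2) e1 by (simp add: t_def)
  have "real s1 \<le> 12 * t + 1"
    using up[of "12 * \<kappa> / \<epsilon>"] assms(1,2) by (simp add: s1_def t_def)
  then have u1: "real s1 \<le> 13 * t" using t by linarith
  have "real s2 \<le> 12 * t * real s1 + 1"
    using up[of "12 * \<kappa> * real s1 / \<epsilon>"] assms(1,2) by (simp add: s2_def t_def mult.commute)
  also have "\<dots> \<le> 12 * t * (13 * t) + 1 * 1"
    using u1 t by (intro add_mono mult_left_mono) auto
  also have "\<dots> \<le> 12 * t * (13 * t) + t * t"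
    using t by (intro add_mono mult_mono) auto
  finally have u2: "real s2 \<le> 157 * t ^ 2" by (simp add: power2_eq_square)
  have "real (s1 * s2) \<le> (13 * t) * (157 * t ^ 2)"
    unfolding of_nat_mult using u1 u2 t by (intro mult_mono) auto
  also have "\<dots> = 2041 * \<kappa> ^ 3 / \<epsilon> ^ 3" by (simp add: t_def power_divide power2_eq_square power3_eq_cube)
  finally show "real (s1 * s2) \<le> 2041 * \<kappa> ^ 3 / \<epsilon> ^ 3" .
qed

lemma M_hom_bounds:
  assumes H: "hereditary \<H>" and ntr: "\<not> in_Trip \<H> (tensor k (Ubip k))"
  shows "M_hom_defined \<H>"
    and "\<exists>K>0. \<exists>\<epsilon>0>0. \<forall>\<epsilon>::real. 0 < \<epsilon> \<and> \<epsilon> < \<epsilon>0 \<longrightarrow>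
              M_reg \<H> \<epsilon> \<le> M_hom \<H> (\<epsilon> ^ 4) \<and>
              real (M_hom \<H> (\<epsilon> ^ 4)) \<le> 2 powr (2 powr (\<epsilon> powr (- K)))"
proof -
  define \<kappa> where "\<kappa> = real (k + 2)"
  have \<kappa>: "1 \<le> \<kappa>" by (simp add: \<kappa>_def)
  have adm: "\<exists>m. admits_hom \<H> \<epsilon> (2 ^ m) \<and> (\<epsilon> \<le> 1 \<longrightarrow> real m \<le> 2041 * \<kappa> ^ 3 / (\<epsilon> ^ 2) ^ 3)" if "0 < \<epsilon>" for \<epsilon>
  proof -
    have "0 < \<epsilon> ^ 2" using that by simp
    note ss = sample_sizes[OF \<kappa> this]
    show ?thesis
      using admits_hom_pow[OF H ntr that] ss(1) ss(2) that unfolding \<kappa>_def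
      by (metis (no_types, lifting) less_eq_real_def power_le_one)
  qed
  then show "M_hom_defined \<H>" unfolding M_hom_defined_def by blast
  define \<epsilon>0 where "\<epsilon>0 = 1 / (2041 * \<kappa> ^ 3)"
  have \<kappa>3: "1 \<le> \<kappa> ^ 3" using \<kappa> by simp
  then have "1 \<le> 2041 * \<kappa> ^ 3" by linarith
  then have \<epsilon>0: "0 < \<epsilon>0" "\<epsilon>0 \<le> 1" using \<kappa> unfolding \<epsilon>0_def by (auto simp: divide_le_eq)
  have "M_reg \<H> \<epsilon> \<le> M_hom \<H> (\<epsilon> ^ 4) \<and>
              real (M_hom \<H> (\<epsilon> ^ 4)) \<le> 2 powr (2 powr (\<epsilon> powr (- 25)))" if e: "0 < \<epsilon>" "\<epsilon> < \<epsilon>0" for \<epsilon>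
  proof
    have e1: "\<epsilon> \<le> 1" using e \<epsilon>0 by simp
    obtain m where m: "admits_hom \<H> (\<epsilon> ^ 4) (2 ^ m)" "real m \<le> 2041 * \<kappa> ^ 3 / ((\<epsilon> ^ 4) ^ 2) ^ 3"
      using adm[of "\<epsilon> ^ 4"] e e1 by (auto simp: power_le_one)
    show "M_reg \<H> \<epsilon> \<le> M_hom \<H> (\<epsilon> ^ 4)"
      using H m(1) e(1) e1 by (intro M_reg_le_M_hom) (auto simp: hereditary_def)
    \<comment> \<open>The exponent 25: accuracy \<open>\<epsilon> ^ 4\<close>, squared and then
      cubed, makes 24, and by the choice of \<open>\<epsilon>0\<close> one more factor
      \<open>1 / \<epsilon>\<close> swallows the constant.\<close>
    have "2041 * \<kappa> ^ 3 \<le> 1 / \<epsilon>"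
    proof -
      have "0 < 2041 * \<kappa> ^ 3" using \<kappa>3 by linarith
      then have "\<epsilon> * (2041 * \<kappa> ^ 3) < 1"
        using e(2) unfolding \<epsilon>0_def by (simp only: pos_less_divide_eq)
      then show ?thesis using e(1) by (simp only: pos_le_divide_eq mult.commute less_imp_le)
    qed
    then have "2041 * \<kappa> ^ 3 / \<epsilon> ^ 24 \<le> (1 / \<epsilon>) / \<epsilon> ^ 24"
      using e by (intro divide_right_mono) auto
    then have "real m \<le> (1 / \<epsilon>) / \<epsilon> ^ 24"
      using m(2) by (simp flip: power_mult)
    also have "\<dots> = \<epsilon> powr (- 25)"
      using e(1) by (simp add: powr_minus powr_numeral divide_inverse power_numeral_reduce)
    finally have m25: "real m \<le> \<epsilon> powr (- 25)" .
    have "real (M_hom \<H> (\<epsilon> ^ 4)) \<le> real (2 ^ m)"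
      unfolding M_hom_def using m(1) by (intro of_nat_mono Least_le)
    also have "\<dots> = 2 powr real m" by (simp add: powr_realpow)
    \<comment> \<open>The construction gives a single exponential; here it is relaxed to the double
      exponential form through \<open>m < 2 ^ m\<close>.\<close>
    also have "\<dots> \<le> 2 powr (2 powr real m)"
      using of_nat_less_two_power[of m, where 'a = real] by (intro powr_mono) (auto simp: powr_realpow)
    also have "\<dots> \<le> 2 powr (2 powr (\<epsilon> powr (- 25)))"
      using m25 by (intro powr_mono) auto
    finally show "real (M_hom \<H> (\<epsilon> ^ 4)) \<le> 2 powr (2 powr (\<epsilon> powr (- 25)))" .
  qed
  then show "\<exists>K>0. \<exists>\<epsilon>0>0. \<forall>\<epsilon>::real. 0 < \<epsilon> \<and> \<epsilon> < \<epsilon>0 \<longrightarrow>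
              M_reg \<H> \<epsilon> \<le> M_hom \<H> (\<epsilon> ^ 4) \<and>
              real (M_hom \<H> (\<epsilon> ^ 4)) \<le> 2 powr (2 powr (\<epsilon> powr (- K)))"
    using \<epsilon>0(1) by (intro exI[of _ 25] exI[of _ \<epsilon>0] conjI) auto
qed

section \<open>The energy increment\<close>

text \<open>Averaging is self-adjoint and fixes functions that are constant on cells.\<close>

lemma sum_cell_avg_mult:
  assumes V: "finite V" and h: "\<And>x x'. x \<in> V \<Longrightarrow> x' \<in> V \<Longrightarrow> c x' = c x \<Longrightarrow> h x' = h x"
  shows "(\<Sum>x\<in>V. cell_avg V c g x * h x) = (\<Sum>x\<in>V. g x * h x)"
proof -
  have "cell_avg V c (\<lambda>x. g x * h x) x = cell_avg V c g x * h x" if x: "x \<in> V" for x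
  proof -
    have "(\<Sum>x'\<in>cell V c x. g x' * h x') = (\<Sum>x'\<in>cell V c x. g x' * h x)"
      using h[OF x] by (intro sum.cong refl) (auto simp: cell_def)
    then show ?thesis by (simp add: cell_avg_def flip: sum_distrib_right)
  qed
  then have "(\<Sum>x\<in>V. cell_avg V c g x * h x) = (\<Sum>x\<in>V. cell_avg V c (\<lambda>x. g x * h x) x)" by simp
  then show ?thesis by (simp only: sum_cell_avg[OF V])
qed

text \<open>Pythagoras: the coarse average is the orthogonal projection of the fine one.\<close>

lemma sum_cell_avg_refine:
  assumes V: "finite V" and ref: "\<And>x x'. x \<in> V \<Longrightarrow> x' \<in> V \<Longrightarrow> c' x' = c' x \<Longrightarrow> c x' = c x"
  shows "(\<Sum>x\<in>V. (cell_avg V c' g x)\<^sup>2) = (\<Sum>x\<in>V. (cell_avg V c g x)\<^sup>2) + (\<Sum>x\<in>V. (cell_avg V c' g x - cell_avg V c g x)\<^sup>2)"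
proof -
  have "(\<Sum>x\<in>V. cell_avg V c' g x * cell_avg V c g x) = (\<Sum>x\<in>V. g x * cell_avg V c g x)"
    by (rule sum_cell_avg_mult[OF V]) (rule cell_avg_cong, rule ref)
  also have "\<dots> = (\<Sum>x\<in>V. cell_avg V c g x * cell_avg V c g x)"
    by (rule sum_cell_avg_mult[OF V, symmetric]) (rule cell_avg_cong)
  finally have eq: "(\<Sum>x\<in>V. cell_avg V c' g x * cell_avg V c g x) = (\<Sum>x\<in>V. cell_avg V c g x * cell_avg V c g x)" .
  have "(\<Sum>x\<in>V. (cell_avg V c' g x - cell_avg V c g x)\<^sup>2) =
      (\<Sum>x\<in>V. (cell_avg V c' g x)\<^sup>2 - 2 * (cell_avg V c' g x * cell_avg V c g x) + cell_avg V c g x * cell_avg V c g x)"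
    by (intro sum.cong refl) (simp add: power2_eq_square algebra_simps)
  also have "\<dots> = (\<Sum>x\<in>V. (cell_avg V c' g x)\<^sup>2) - 2 * (\<Sum>x\<in>V. cell_avg V c' g x * cell_avg V c g x) + (\<Sum>x\<in>V. cell_avg V c g x * cell_avg V c g x)"
    by (simp add: sum.distrib sum_subtractf sum_distrib_left)
  finally show ?thesis unfolding eq by (simp add: power2_eq_square)
qed

text \<open>Colourings of \<open>V\<close> are lifted to triples so that a density becomes a cell
  average of \<open>edge_indicator\<close>, and the L2 facts about \<open>cell_avg\<close> apply to
  it.\<close>

definition cube :: "'a set \<Rightarrow> ('a \<times> 'a \<times> 'a) set" where
  "cube V = V \<times> V \<times> V"

definition color_triple :: "('a \<Rightarrow> 'c) \<Rightarrow> 'a \<times> 'a \<times> 'a \<Rightarrow> 'c \<times> 'c \<times> 'c" where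
  "color_triple c = (\<lambda>(x, y, z). (c x, c y, c z))"

definition edge_indicator :: "'a hg \<Rightarrow> 'a \<times> 'a \<times> 'a \<Rightarrow> real" where
  "edge_indicator G = (\<lambda>(x, y, z). of_bool ({x, y, z} \<in> snd G))"

lemma cell_cube: "cell (cube V) (color_triple c) (x, y, z) = cell V c x \<times> cell V c y \<times> cell V c z"
  by (auto simp: cell_def cube_def color_triple_def)

lemma sum_edge_indicator:
  assumes "finite X" "finite Y" "finite Z"
  shows "(\<Sum>t\<in>X \<times> Y \<times> Z. edge_indicator G t) = real (card (triples G X Y Z))"
proof -
  have "(\<Sum>t\<in>X \<times> Y \<times> Z. edge_indicator G t) = (\<Sum>t\<in>X \<times> Y \<times> Z. of_bool (t \<in> triples G X Y Z))"
    by (intro sum.cong refl) (auto simp: edge_indicator_def triples_def)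
  also have "\<dots> = real (card ((X \<times> Y \<times> Z) \<inter> triples G X Y Z))"
    using assms by (simp add: sum_of_bool_eq)
  also have "(X \<times> Y \<times> Z) \<inter> triples G X Y Z = triples G X Y Z"
    using triples_subset by blast
  finally show ?thesis .
qed

lemma cell_avg_edge_indicator:
  assumes "finite V"
  shows "cell_avg (cube V) (color_triple c) (edge_indicator G) (x, y, z) = dens G (cell V c x) (cell V c y) (cell V c z)"
proof -
  have "finite (cell V c u)" for u using assms by (simp add: cell_def)
  then show ?thesis
    unfolding cell_avg_def cell_cube by (simp add: sum_edge_indicator dens_eq card_cartesian_product mult.assoc)
qed

definition energy :: "'a hg \<Rightarrow> ('a \<Rightarrow> 'c) \<Rightarrow> real" where
  "energy G c = (\<Sum>t\<in>cube (fst G). (cell_avg (cube (fst G)) (color_triple c) (edge_indicator G) t)\<^sup>2)"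

lemma energy_le:
  assumes "finite (fst G)" shows "energy G c \<le> real (card (fst G)) ^ 3"
proof -
  have "(cell_avg (cube (fst G)) (color_triple c) (edge_indicator G) t)\<^sup>2 \<le> 1" for t
  proof -
    obtain x y z where t: "t = (x, y, z)" by (cases t)
    have "finite (cell (fst G) c u)" for u using assms by (simp add: cell_def)
    then show ?thesis unfolding t cell_avg_edge_indicator[OF assms] by (simp add: dens_bounds power_le_one)
  qed
  then have "energy G c \<le> (\<Sum>t\<in>cube (fst G). 1)" unfolding energy_def by (rule sum_mono)
  then show ?thesis by (simp add: cube_def card_cartesian_product power3_eq_cube)
qed

definition irreg :: "'a hg \<Rightarrow> real \<Rightarrow> ('a \<Rightarrow> 'c) \<Rightarrow> ('a \<times> 'a \<times> 'a) set" where
  "irreg G \<epsilon> c = {(x, y, z) \<in> fst G \<times> fst G \<times> fst G.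
    \<not> reg_triple G \<epsilon> (cell (fst G) c x) (cell (fst G) c y) (cell (fst G) c z)}"

text \<open>The refinement cuts the parts by the witnesses of all irregular triples, three sets per
  triple of parts. On an irregular box the old and new averages differ by more than
  \<open>\<epsilon>\<close> in mean over the witness box, which has at least
  \<open>\<epsilon> ^ 3\<close> of the volume; Cauchy-Schwarz turns this into a gain of
  \<open>\<epsilon> ^ 5\<close> per triple.\<close>

lemma energy_increment:
  fixes c :: "'a \<Rightarrow> 'a set"
  assumes fin: "finite (fst G)" and eps: "0 < \<epsilon>"
  shows "\<exists>c' :: 'a \<Rightarrow> 'a set.
    card (c' ` fst G) \<le> card (c ` fst G) * 2 ^ (3 * card (c ` fst G) ^ 3) \<and>
    energy G c + \<epsilon> ^ 5 * real (card (irreg G \<epsilon> c)) \<le> energy G c'"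
proof -
  define V where "V = fst G"
  let ?cl = "cell V c"
  have V: "finite V" using fin by (simp add: V_def)
  have "\<forall>u. \<exists>w. case u of (X, Y, Z) \<Rightarrow> case w of (X', Y', Z') \<Rightarrow> \<not> reg_triple G \<epsilon> X Y Z \<longrightarrow>
      X' \<subseteq> X \<and> Y' \<subseteq> Y \<and> Z' \<subseteq> Z \<and>
        real (card X') \<ge> \<epsilon> * real (card X) \<and> real (card Y') \<ge> \<epsilon> * real (card Y) \<and>
        real (card Z') \<ge> \<epsilon> * real (card Z) \<and> \<bar>dens G X Y Z - dens G X' Y' Z'\<bar> > \<epsilon>"
    unfolding reg_triple_def split_paired_All split_paired_Ex prod.case not_le[symmetric] by meson
  from choice[OF this] obtain w where w0: "\<And>u. case u of (X, Y, Z) \<Rightarrow> case w u of (X', Y', Z') \<Rightarrow> \<not> reg_triple G \<epsilon> X Y Z \<longrightarrow>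
      X' \<subseteq> X \<and> Y' \<subseteq> Y \<and> Z' \<subseteq> Z \<and>
        real (card X') \<ge> \<epsilon> * real (card X) \<and> real (card Y') \<ge> \<epsilon> * real (card Y) \<and>
        real (card Z') \<ge> \<epsilon> * real (card Z) \<and> \<bar>dens G X Y Z - dens G X' Y' Z'\<bar> > \<epsilon>"
    by blast
  have w: "\<And>X Y Z X' Y' Z'. w (X, Y, Z) = (X', Y', Z') \<Longrightarrow> \<not> reg_triple G \<epsilon> X Y Z \<Longrightarrow>
      X' \<subseteq> X \<and> Y' \<subseteq> Y \<and> Z' \<subseteq> Z \<and>
        real (card X') \<ge> \<epsilon> * real (card X) \<and> real (card Y') \<ge> \<epsilon> * real (card Y) \<and>
        real (card Z') \<ge> \<epsilon> * real (card Z) \<and> \<bar>dens G X Y Z - dens G X' Y' Z'\<bar> > \<epsilon>"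
    subgoal for X Y Z X' Y' Z' using w0[of "(X, Y, Z)"] by simp
    done
  define \<C> where "\<C> = ?cl ` V"
  define \<W> where "\<W> = (fst \<circ> w) ` (\<C> \<times> \<C> \<times> \<C>) \<union> (fst \<circ> snd \<circ> w) ` (\<C> \<times> \<C> \<times> \<C>) \<union> (snd \<circ> snd \<circ> w) ` (\<C> \<times> \<C> \<times> \<C>)"
  have finC: "finite \<C>" "finite (\<C> \<times> \<C> \<times> \<C>)" using V by (auto simp: \<C>_def)
  have cardC: "card (\<C> \<times> \<C> \<times> \<C>) \<le> card (c ` V) ^ 3"
  proof -
    have "card \<C> \<le> card (c ` V)" unfolding \<C>_def by (rule card_cells_le[OF V])
    then show ?thesis by (simp add: card_cartesian_product power3_eq_cube mult.assoc mult_le_mono)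
  qed
  have finW: "finite \<W>" using finC by (simp add: \<W>_def)
  have "card \<W> \<le> card ((fst \<circ> w) ` (\<C> \<times> \<C> \<times> \<C>)) + card ((fst \<circ> snd \<circ> w) ` (\<C> \<times> \<C> \<times> \<C>)) + card ((snd \<circ> snd \<circ> w) ` (\<C> \<times> \<C> \<times> \<C>))"
    unfolding \<W>_def by (meson add_le_mono card_Un_le le_refl le_trans)
  also have "\<dots> \<le> card (c ` V) ^ 3 + card (c ` V) ^ 3 + card (c ` V) ^ 3"
    by (intro add_mono order_trans[OF card_image_le cardC] finC)
  finally have cardW: "card \<W> \<le> 3 * card (c ` V) ^ 3" by simp
  \<comment> \<open>The new colour of \<open>x\<close> is its own refined cell, a subset of
    \<open>V\<close>; so the colour type stays the same and the step can be iterated.\<close>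
  define c' where "c' x = {y \<in> V. c y = c x \<and> (\<forall>W\<in>\<W>. y \<in> W \<longleftrightarrow> x \<in> W)}" for x
  have c': "c x' = c x" "W \<in> \<W> \<Longrightarrow> x' \<in> W \<longleftrightarrow> x \<in> W" if "x \<in> V" "x' \<in> V" "c' x' = c' x" for x x' W
  proof -
    have "x \<in> c' x'" using that by (auto simp: c'_def)
    then show "c x' = c x" "W \<in> \<W> \<Longrightarrow> x' \<in> W \<longleftrightarrow> x \<in> W" by (auto simp: c'_def)
  qed
  have "card (c' ` V) \<le> card (c ` V) * 2 ^ (3 * card (c ` V) ^ 3)"
  proof -
    define F where "F = (\<lambda>(s, T). {y \<in> V. c y = s \<and> (\<forall>W\<in>\<W>. y \<in> W \<longleftrightarrow> W \<in> T)})"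
    have "c' x = F (c x, {W \<in> \<W>. x \<in> W})" for x by (auto simp: c'_def F_def)
    then have "c' ` V \<subseteq> F ` (c ` V \<times> Pow \<W>)" by blast
    then have "card (c' ` V) \<le> card (F ` (c ` V \<times> Pow \<W>))"
      using V finW by (intro card_mono) auto
    also have "\<dots> \<le> card (c ` V \<times> Pow \<W>)" using V finW by (intro card_image_le) auto
    also have "\<dots> = card (c ` V) * 2 ^ card \<W>" using finW by (simp add: card_cartesian_product card_Pow)
    also have "\<dots> \<le> card (c ` V) * 2 ^ (3 * card (c ` V) ^ 3)"
      using cardW by (intro mult_left_mono power_increasing) auto
    finally show ?thesis .
  qed
  moreover have "energy G c + \<epsilon> ^ 5 * real (card (irreg G \<epsilon> c)) \<le> energy G c'"
  proof -
    define \<Omega> where "\<Omega> = cube V"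
    define a where "a = cell_avg \<Omega> (color_triple c) (edge_indicator G)"
    define a' where "a' = cell_avg \<Omega> (color_triple c') (edge_indicator G)"
    have fin\<Omega>: "finite \<Omega>" using V by (simp add: \<Omega>_def cube_def)
    have en: "energy G c = (\<Sum>t\<in>\<Omega>. (a t)\<^sup>2)" "energy G c' = (\<Sum>t\<in>\<Omega>. (a' t)\<^sup>2)"
      by (simp_all add: energy_def a_def a'_def \<Omega>_def V_def)
    have "(\<Sum>t\<in>\<Omega>. (a' t)\<^sup>2) = (\<Sum>t\<in>\<Omega>. (a t)\<^sup>2) + (\<Sum>t\<in>\<Omega>. (a' t - a t)\<^sup>2)"
      unfolding a_def a'_def
    proof (rule sum_cell_avg_refine[OF fin\<Omega>])
      fix t t' assume t: "t \<in> \<Omega>" "t' \<in> \<Omega>" "color_triple c' t' = color_triple c' t"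
      obtain p q r p' q' r' where tt: "t = (p, q, r)" "t' = (p', q', r')" by (cases t, cases t')
      have "c p' = c p" "c q' = c q" "c r' = c r"
        using t c'(1)[of p p'] c'(1)[of q q'] c'(1)[of r r'] by (simp_all add: tt \<Omega>_def cube_def color_triple_def)
      then show "color_triple c t' = color_triple c t" by (simp add: color_triple_def tt)
    qed
    moreover have "\<epsilon> ^ 5 * real (card (irreg G \<epsilon> c)) \<le> (\<Sum>t\<in>\<Omega>. (a' t - a t)\<^sup>2)"
    proof -
      have ir: "irreg G \<epsilon> c = \<Omega> \<inter> {t. t \<in> irreg G \<epsilon> c}"
        by (auto simp: irreg_def \<Omega>_def cube_def V_def)
      have "\<epsilon> ^ 5 * real (card (irreg G \<epsilon> c)) = (\<Sum>t\<in>\<Omega>. \<epsilon> ^ 5 * of_bool (t \<in> irreg G \<epsilon> c))"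
        using fin\<Omega> ir by (simp add: sum_of_bool_eq flip: sum_distrib_left)
      also have "\<dots> = (\<Sum>u\<in>color_triple c ` \<Omega>. \<Sum>t\<in>{t \<in> \<Omega>. color_triple c t = u}. \<epsilon> ^ 5 * of_bool (t \<in> irreg G \<epsilon> c))"
        using fin\<Omega> by (intro sum.group[symmetric]) auto
      also have "\<dots> \<le> (\<Sum>u\<in>color_triple c ` \<Omega>. \<Sum>t\<in>{t \<in> \<Omega>. color_triple c t = u}. (a' t - a t)\<^sup>2)"
      proof (rule sum_mono)
        fix u assume "u \<in> color_triple c ` \<Omega>"
        then obtain x y z where 0: "x \<in> V" "y \<in> V" "z \<in> V" and u: "u = color_triple c (x, y, z)"
          by (auto simp: \<Omega>_def cube_def)
        define X where "X = ?cl x"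
        define Y where "Y = ?cl y"
        define Z where "Z = ?cl z"
        note XYZ = X_def Y_def Z_def
        have fXYZ: "finite X" "finite Y" "finite Z" using V by (auto simp: XYZ cell_def)
        have fib: "{t \<in> \<Omega>. color_triple c t = u} = X \<times> Y \<times> Z"
          using cell_cube[of V c x y z] by (simp add: XYZ \<Omega>_def u cell_def)
        have cells: "?cl x' = X" "?cl y' = Y" "?cl z' = Z" if "x' \<in> X" "y' \<in> Y" "z' \<in> Z" for x' y' z'
          using that by (auto simp: XYZ cell_def)
        have inV: "X \<subseteq> V" "Y \<subseteq> V" "Z \<subseteq> V" by (auto simp: XYZ cell_def)
        have irr: "(t \<in> irreg G \<epsilon> c) = (\<not> reg_triple G \<epsilon> X Y Z)" if "t \<in> X \<times> Y \<times> Z" for t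
          using that inV cells by (auto simp: irreg_def V_def)
        show "(\<Sum>t\<in>{t \<in> \<Omega>. color_triple c t = u}. \<epsilon> ^ 5 * of_bool (t \<in> irreg G \<epsilon> c)) \<le> (\<Sum>t\<in>{t \<in> \<Omega>. color_triple c t = u}. (a' t - a t)\<^sup>2)"
        proof (cases "reg_triple G \<epsilon> X Y Z")
          case True
          then show ?thesis unfolding fib using irr by (simp add: sum_nonneg)
        next
          case False
          obtain X' Y' Z' where w': "w (X, Y, Z) = (X', Y', Z')" by (cases "w (X, Y, Z)")
          note wit = w[OF w' False]
          have "(X, Y, Z) \<in> \<C> \<times> \<C> \<times> \<C>" using 0 by (auto simp: \<C>_def XYZ)
          then have inW: "X' \<in> \<W>" "Y' \<in> \<W>" "Z' \<in> \<W>"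
            unfolding \<W>_def using w' by (force intro: image_eqI[of _ _ "(X, Y, Z)"])+
          define U where "U = X' \<times> Y' \<times> Z'"
          have sub: "U \<subseteq> X \<times> Y \<times> Z" using wit by (auto simp: U_def)
          have fU: "finite U" using sub fXYZ by (meson finite_SigmaI finite_subset)
          have fin': "finite X'" "finite Y'" "finite Z'" using wit fXYZ finite_subset by blast+
          have subO: "U \<subseteq> \<Omega>" using sub inV by (auto simp: \<Omega>_def cube_def)
          have cU: "real (card U) = real (card X') * real (card Y') * real (card Z')"
            by (simp add: U_def card_cartesian_product)
          \<comment> \<open>The indicator of \<open>U\<close> is constant on the boxes of
            \<open>c'\<close>, so over \<open>U\<close> the average \<open>a'\<close> has the same
            sum as the edge indicator.\<close>
          have "(\<Sum>t\<in>U. a' t) = (\<Sum>t\<in>\<Omega>. a' t * of_bool (t \<in> U))"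
            using fin\<Omega> subO by (intro sum.mono_neutral_cong_left) auto
          also have "\<dots> = (\<Sum>t\<in>\<Omega>. edge_indicator G t * of_bool (t \<in> U))"
            unfolding a'_def
          proof (rule sum_cell_avg_mult[OF fin\<Omega>])
            fix t t' assume t: "t \<in> \<Omega>" "t' \<in> \<Omega>" "color_triple c' t' = color_triple c' t"
            obtain p q r p' q' r' where tt: "t = (p, q, r)" "t' = (p', q', r')" by (cases t, cases t')
            have "p' \<in> X' \<longleftrightarrow> p \<in> X'" "q' \<in> Y' \<longleftrightarrow> q \<in> Y'" "r' \<in> Z' \<longleftrightarrow> r \<in> Z'"
              using t inW by (auto simp: tt \<Omega>_def cube_def color_triple_def dest: c'(2))
            then show "(of_bool (t' \<in> U) :: real) = of_bool (t \<in> U)" by (simp add: U_def tt)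
          qed
          also have "\<dots> = (\<Sum>t\<in>U. edge_indicator G t)"
            using fin\<Omega> subO by (intro sum.mono_neutral_cong_right) auto
          also have "\<dots> = real (card (triples G X' Y' Z'))"
            unfolding U_def using fin' by (rule sum_edge_indicator)
          also have "\<dots> = dens G X' Y' Z' * real (card U)"
            using card_triples_le[OF fin', of G] unfolding dens_eq cU by (cases "real (card X') * real (card Y') * real (card Z') = 0") auto
          finally have s': "(\<Sum>t\<in>U. a' t) = dens G X' Y' Z' * real (card U)" .
          have "a t = dens G X Y Z" if "t \<in> U" for t
          proof -
            obtain x' y' z' where t: "t = (x', y', z')" by (cases t)
            show ?thesis using that sub cells unfolding a_def \<Omega>_def t cell_avg_edge_indicator[OF V] by auto
          qed
          then have "(\<Sum>t\<in>U. a' t - a t) = (dens G X' Y' Z' - dens G X Y Z) * real (card U)"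
            by (simp add: sum_subtractf s' algebra_simps)
          then have "((dens G X' Y' Z' - dens G X Y Z) * real (card U))\<^sup>2 \<le> real (card U) * (\<Sum>t\<in>U. (a' t - a t)\<^sup>2)"
            using sum_squared_le_sum_of_squares[of "\<lambda>t. a' t - a t" U] by (simp add: mult.commute)
          then have cs: "real (card U) * ((dens G X' Y' Z' - dens G X Y Z)\<^sup>2 * real (card U)) \<le> real (card U) * (\<Sum>t\<in>U. (a' t - a t)\<^sup>2)"
            by (simp add: power_mult_distrib power2_eq_square ac_simps)
          define P where "P = real (card X) * real (card Y) * real (card Z)"
          have P: "real (card (X \<times> Y \<times> Z)) = P" by (simp add: P_def card_cartesian_product)
          have "X \<noteq> {}" "Y \<noteq> {}" "Z \<noteq> {}"
            using mem_cell_self[OF 0(1), of c] mem_cell_self[OF 0(2), of c] mem_cell_self[OF 0(3), of c] unfolding XYZ by auto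
          then have P0: "0 < P" using fXYZ by (simp add: P_def card_gt_0_iff)
          have "(\<epsilon> * real (card X)) * (\<epsilon> * real (card Y)) * (\<epsilon> * real (card Z)) \<le> real (card U)"
            unfolding cU using wit eps by (intro mult_mono) auto
          then have PU: "\<epsilon> ^ 3 * P \<le> real (card U)"
            by (simp add: P_def power3_eq_cube algebra_simps)
          then have U0: "0 < real (card U)" using P0 eps by (smt (verit) mult_pos_pos zero_less_power)
          have "\<epsilon>\<^sup>2 \<le> (dens G X' Y' Z' - dens G X Y Z)\<^sup>2"
            using wit eps by (simp add: abs_le_square_iff[symmetric] abs_minus_commute)
          then have "\<epsilon>\<^sup>2 * (\<epsilon> ^ 3 * P) \<le> (dens G X' Y' Z' - dens G X Y Z)\<^sup>2 * real (card U)"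
            using PU P0 eps by (intro mult_mono) auto
          also have "\<dots> \<le> (\<Sum>t\<in>U. (a' t - a t)\<^sup>2)" using cs U0 by simp
          also have "\<dots> \<le> (\<Sum>t\<in>X \<times> Y \<times> Z. (a' t - a t)\<^sup>2)"
            using sub fXYZ by (intro sum_mono2) auto
          finally have "\<epsilon> ^ 5 * P \<le> (\<Sum>t\<in>X \<times> Y \<times> Z. (a' t - a t)\<^sup>2)"
            by (simp add: power_numeral_reduce power2_eq_square power3_eq_cube ac_simps)
          moreover have "(\<Sum>t\<in>X \<times> Y \<times> Z. \<epsilon> ^ 5 * of_bool (t \<in> irreg G \<epsilon> c)) = \<epsilon> ^ 5 * P"
            using irr False P by simp
          ultimately show ?thesis unfolding fib by simp
        qed
      qed
      also have "\<dots> = (\<Sum>t\<in>\<Omega>. (a' t - a t)\<^sup>2)"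
        using fin\<Omega> by (intro sum.group) auto
      finally show ?thesis .
    qed
    ultimately show ?thesis unfolding en by linarith
  qed
  ultimately show ?thesis unfolding V_def by blast
qed

section \<open>Tower arithmetic and the number of refinement rounds\<close>

lemma Tw_Suc: "1 \<le> n \<Longrightarrow> Tw (Suc n) = 2 ^ Tw n"
  by (cases n) auto

lemma Tw_le_Suc: "Tw n \<le> Tw (Suc n)"
proof (cases "n = 0")
  case False
  then show ?thesis using less_exp[of "Tw n"] by (simp add: Tw_Suc)
qed simp

lemma Tw_mono: "m \<le> n \<Longrightarrow> Tw m \<le> Tw n"
  by (rule lift_Suc_mono_le[of Tw, OF Tw_le_Suc])

text \<open>One refinement costs three levels, as its size stays below a triple exponential of
  \<open>T\<close>. The lower bound on \<open>n\<close> secures \<open>4 \<le> T\<close>, where the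
  crude estimate \<open>lin\<close> holds.\<close>

lemma refinement_size_le_Tw:
  assumes "m \<le> Tw n" "4 \<le> n" shows "m * 2 ^ (3 * m ^ 3) \<le> Tw (n + 3)"
proof -
  define T where "T = Tw n"
  have "Tw 3 = 4" by (simp add: numeral_eq_Suc)
  then have T: "4 \<le> T" using Tw_mono[of 3 n] assms by (simp add: T_def)
  have lin: "3 * t + 2 \<le> 2 ^ t" if "4 \<le> t" for t :: nat
    using that by (induction t rule: dec_induct) auto
  have "m * 2 ^ (3 * m ^ 3) \<le> T * 2 ^ (3 * T ^ 3)"
    using assms by (intro mult_le_mono power_increasing) (auto simp: T_def power_mono)
  also have "\<dots> \<le> 2 ^ T * 2 ^ (3 * T ^ 3)" by (intro mult_le_mono) (simp_all add: less_imp_le)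
  also have "\<dots> = 2 ^ (T + 3 * T ^ 3)" by (simp add: power_add)
  also have "\<dots> \<le> 2 ^ (2 ^ (2 ^ T))"
  proof (rule power_increasing)
    have "T ^ 1 \<le> T ^ 3" using T by (intro power_increasing) auto
    then have "T + 3 * T ^ 3 \<le> 2 ^ 2 * T ^ 3" by simp
    also have "\<dots> \<le> 2 ^ 2 * (2 ^ T) ^ 3" by (intro mult_le_mono power_mono) (simp_all add: less_imp_le)
    also have "\<dots> = 2 ^ (3 * T + 2)" by (simp add: power_add power_mult[symmetric] mult.commute)
    also have "\<dots> \<le> 2 ^ (2 ^ T)" using lin[OF T] by (intro power_increasing) auto
    finally show "T + 3 * T ^ 3 \<le> 2 ^ (2 ^ T)" .
  qed simp
  also have "\<dots> = Tw (n + 3)"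
    using assms(2) by (simp add: Tw_Suc T_def numeral_3_eq_3)
  finally show ?thesis .
qed

text \<open>A failing round has more than \<open>\<epsilon> * card (fst G) ^ 3\<close> irregular
  triples and thus raises the energy by at least \<open>\<epsilon> ^ 6 * card (fst G) ^ 3\<close>,
  while the energy never exceeds \<open>card (fst G) ^ 3\<close>. So \<open>t\<close> failing rounds
  are impossible.\<close>

lemma exists_reg_partition:
  fixes G :: "'a hg"
  assumes fin: "finite (fst G)" and eps: "0 < \<epsilon>" and t: "1 < real t * \<epsilon> ^ 6"
  shows "\<exists>P. reg_partition G \<epsilon> P \<and> card P \<le> Tw (4 + 3 * t)"
proof -
  let ?V = "fst G"
  let ?reg = "\<lambda>c :: 'a \<Rightarrow> 'a set. real (card (irreg G \<epsilon> c)) \<le> \<epsilon> * real (card ?V) ^ 3"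
  have "\<exists>c :: 'a \<Rightarrow> 'a set. card (c ` ?V) \<le> Tw (4 + 3 * s) \<and>
      (?reg c \<or> real s * \<epsilon> ^ 6 * real (card ?V) ^ 3 \<le> energy G c)" for s
  proof (induction s)
    case 0
    have "card ((\<lambda>_. {} :: 'a set) ` ?V) \<le> card {{} :: 'a set}" by (intro card_mono) auto
    then have "card ((\<lambda>_. {} :: 'a set) ` ?V) \<le> Tw (4 + 3 * 0)" by (simp add: numeral_eq_Suc)
    moreover have "0 \<le> energy G (\<lambda>_. {} :: 'a set)" by (simp add: energy_def sum_nonneg)
    ultimately show ?case by (intro exI[of _ "\<lambda>_. {}"]) simp
  next
    case (Suc s)
    then obtain c :: "'a \<Rightarrow> 'a set" where c: "card (c ` ?V) \<le> Tw (4 + 3 * s)"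
      "?reg c \<or> real s * \<epsilon> ^ 6 * real (card ?V) ^ 3 \<le> energy G c" by blast
    show ?case
    proof (cases "?reg c")
      case True
      have "Tw (4 + 3 * s) \<le> Tw (4 + 3 * Suc s)" by (rule Tw_mono) simp
      then show ?thesis using True c(1) order_trans by blast
    next
      case False
      obtain c' :: "'a \<Rightarrow> 'a set" where c': "card (c' ` ?V) \<le> card (c ` ?V) * 2 ^ (3 * card (c ` ?V) ^ 3)"
        "energy G c + \<epsilon> ^ 5 * real (card (irreg G \<epsilon> c)) \<le> energy G c'"
        using energy_increment[OF fin eps, of c] by blast
      have "card (c' ` ?V) \<le> Tw (4 + 3 * Suc s)"
        using c'(1) refinement_size_le_Tw[OF c(1)] by (simp add: algebra_simps)
      moreover have "\<epsilon> ^ 5 * (\<epsilon> * real (card ?V) ^ 3) \<le> \<epsilon> ^ 5 * real (card (irreg G \<epsilon> c))"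
        using False eps by (intro mult_left_mono) auto
      then have "real (Suc s) * \<epsilon> ^ 6 * real (card ?V) ^ 3 \<le> energy G c'"
        using c' c False by (simp add: algebra_simps power_numeral_reduce)
      ultimately show ?thesis by blast
    qed
  qed
  then obtain c :: "'a \<Rightarrow> 'a set" where c: "card (c ` ?V) \<le> Tw (4 + 3 * t)"
    "?reg c \<or> real t * \<epsilon> ^ 6 * real (card ?V) ^ 3 \<le> energy G c" by blast
  have "?reg c"
  proof (cases "?V = {}")
    case True
    then have "irreg G \<epsilon> c = {}" by (auto simp: irreg_def)
    then show ?thesis using eps by simp
  next
    case False
    then have "0 < real (card ?V) ^ 3" using fin by (simp add: card_gt_0_iff)
    then have "1 * real (card ?V) ^ 3 < real t * \<epsilon> ^ 6 * real (card ?V) ^ 3"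
      using t by (intro mult_strict_right_mono)
    then show ?thesis using c(2) energy_le[OF fin, of c] by linarith
  qed
  then have "reg_partition G \<epsilon> (cell ?V c ` ?V)"
    unfolding reg_partition_def
    by (subst good_partition_iff[OF fin partition_on_cells, where p = "cell ?V c"]) (auto simp: mem_cell_self irreg_def)
  moreover have "card (cell ?V c ` ?V) \<le> Tw (4 + 3 * t)"
    using card_cells_le[OF fin, of c] c(1) by (rule order_trans)
  ultimately show ?thesis by blast
qed

lemma admits_reg_Tw:
  assumes H: "hereditary \<H>" and eps: "0 < \<epsilon>" "\<epsilon> \<le> 1 / 13"
  shows "admits_reg \<H> \<epsilon> (Tw (nat \<lceil>\<epsilon> powr (- 7)\<rceil>))"
proof -
  define u where "u = 1 / \<epsilon> ^ 6"
  define t where "t = nat \<lceil>u\<rceil> + 1"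
  have u: "1 \<le> u" using eps by (simp add: u_def power_le_one)
  have tu: "real t \<le> u + 2" "u < real t" unfolding t_def using u by linarith+
  have "1 = u * \<epsilon> ^ 6" using eps by (simp add: u_def)
  also have "\<dots> < real t * \<epsilon> ^ 6" using tu eps by (intro mult_strict_right_mono) auto
  finally have t1: "1 < real t * \<epsilon> ^ 6" .
  \<comment> \<open>The sum is at most \<open>3 * u + 10\<close>; then
    \<open>\<epsilon> \<le> 1 / 13\<close> trades the factor 13 for one more power of
    \<open>1 / \<epsilon>\<close>.\<close>
  have "real (4 + 3 * t) \<le> 13 * u" using tu u by simp
  also have "\<dots> \<le> (1 / \<epsilon>) * u" using eps u by (intro mult_right_mono) (auto simp: field_simps)
  also have "\<dots> = \<epsilon> powr (- 7)"
    using eps(1) by (simp add: u_def powr_minus powr_numeral divide_inverse power_numeral_reduce)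
  finally have "4 + 3 * t \<le> nat \<lceil>\<epsilon> powr (- 7)\<rceil>" by linarith
  then have le: "Tw (4 + 3 * t) \<le> Tw (nat \<lceil>\<epsilon> powr (- 7)\<rceil>)" by (rule Tw_mono)
  have "\<exists>P. reg_partition G \<epsilon> P \<and> card P \<le> Tw (nat \<lceil>\<epsilon> powr (- 7)\<rceil>)" if "G \<in> \<H>" for G
  proof -
    have "finite (fst G)" using H that by (auto simp: hereditary_def is_3graph_def)
    then show ?thesis using exists_reg_partition[OF _ eps(1) t1] le order_trans by blast
  qed
  then show ?thesis unfolding admits_reg_def by blast
qed

section \<open>Layered 3-graphs\<close>

definition symdiff :: "'a set \<Rightarrow> 'a set \<Rightarrow> 'a set" where
  "symdiff S T = (S - T) \<union> (T - S)"

lemma card_symdiff_ball_le: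
  assumes A: "finite A" and T: "T \<subseteq> A"
  shows "card {S \<in> Pow A. card (symdiff S T) \<le> r} \<le> (\<Sum>i\<le>r. card A choose i)"
proof -
  have inj: "inj_on (\<lambda>S. symdiff S T) {S \<in> Pow A. card (symdiff S T) \<le> r}"
  proof (rule inj_onI)
    fix S S' assume "symdiff S T = symdiff S' T"
    then have "symdiff (symdiff S T) T = symdiff (symdiff S' T) T" by simp
    moreover have "symdiff (symdiff U T) T = U" for U by (auto simp: symdiff_def)
    ultimately show "S = S'" by simp
  qed
  have "card {S \<in> Pow A. card (symdiff S T) \<le> r} = card ((\<lambda>S. symdiff S T) ` {S \<in> Pow A. card (symdiff S T) \<le> r})"
    using inj by (simp add: card_image)
  also have "\<dots> \<le> card (\<Union>i\<le>r. {U. U \<subseteq> A \<and> card U = i})"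
    using A T by (intro card_mono) (auto simp: symdiff_def)
  also have "\<dots> \<le> (\<Sum>i\<le>r. card {U. U \<subseteq> A \<and> card U = i})" by (intro card_UN_le) simp
  also have "\<dots> = (\<Sum>i\<le>r. card A choose i)" using A by (simp add: n_subsets)
  finally show ?thesis .
qed

text \<open>For \<open>i \<le> 2 * m\<close> the weight \<open>2 ^ (8 * m - i)\<close> is at least
  \<open>2 ^ (6 * m)\<close>, and the full weighted sum is \<open>3 ^ (8 * m)\<close>, where
  \<open>3 ^ 8 = 6561 \<le> 2 ^ 13\<close>.\<close>

lemma sum_binomial_le: "(\<Sum>i\<le>2 * m. (8 * m) choose i) \<le> 2 ^ (7 * m)"
proof -
  have "(\<Sum>i\<le>2 * m. (8 * m) choose i) * 2 ^ (6 * m) = (\<Sum>i\<le>2 * m. ((8 * m) choose i) * 2 ^ (6 * m))"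
    by (simp add: sum_distrib_right)
  also have "\<dots> \<le> (\<Sum>i\<le>2 * m. ((8 * m) choose i) * 2 ^ (8 * m - i))"
    by (intro sum_mono mult_left_mono power_increasing) auto
  also have "\<dots> \<le> (\<Sum>i\<le>8 * m. ((8 * m) choose i) * 2 ^ (8 * m - i))"
    by (intro sum_mono2) auto
  also have "\<dots> = (1 + 2) ^ (8 * m)" unfolding binomial by simp
  also have "\<dots> = 3 ^ (8 * m)" by (rule arg_cong[of _ _ "\<lambda>x. x ^ (8 * m)"]) simp
  also have "\<dots> = 6561 ^ m" by (simp add: power_mult)
  also have "\<dots> \<le> 8192 ^ m" by (intro power_mono) auto
  also have "\<dots> = 2 ^ (13 * m)" by (simp add: power_mult)
  also have "\<dots> = 2 ^ (7 * m) * 2 ^ (6 * m)" by (simp add: power_add[symmetric])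
  finally show ?thesis by simp
qed

text \<open>Gilbert-Varshamov: as long as the balls around the chosen sets do not cover the cube,
  another set can be added greedily.\<close>

lemma exists_separated_family:
  assumes A: "finite A" and ball: "\<And>T. T \<subseteq> A \<Longrightarrow> card {S \<in> Pow A. card (symdiff S T) \<le> r} \<le> b" "0 < b"
    and n: "n * b \<le> 2 ^ card A"
  shows "\<exists>F. F \<subseteq> Pow A \<and> card F = n \<and> (\<forall>S\<in>F. \<forall>T\<in>F. S \<noteq> T \<longrightarrow> r < card (symdiff S T))"
  using n
proof (induction n)
  case 0
  show ?case by (intro exI[of _ "{}"]) simp
next
  case (Suc n)
  then obtain F where F: "F \<subseteq> Pow A" "card F = n" "\<forall>S\<in>F. \<forall>T\<in>F. S \<noteq> T \<longrightarrow> r < card (symdiff S T)" by auto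
  have finF: "finite F" using F(1) A by (meson finite_Pow_iff finite_subset)
  define U where "U = (\<Union>T\<in>F. {S \<in> Pow A. card (symdiff S T) \<le> r})"
  have "card U \<le> (\<Sum>T\<in>F. card {S \<in> Pow A. card (symdiff S T) \<le> r})"
    unfolding U_def by (rule card_UN_le[OF finF])
  also have "\<dots> \<le> (\<Sum>T\<in>F. b)" using F(1) by (intro sum_mono ball) auto
  also have "\<dots> < card (Pow A)" using Suc.prems ball(2) F(2) A by (simp add: card_Pow)
  finally have "\<not> Pow A \<subseteq> U" using card_mono[of U "Pow A"] finite_subset[of U "Pow A"] A by (auto simp: U_def)
  then obtain S where S: "S \<in> Pow A" "S \<notin> U" by blast
  then have far: "r < card (symdiff S T)" "r < card (symdiff T S)" if "T \<in> F" for T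
    using that S by (auto simp: U_def not_le symdiff_def Un_commute)
  have "S \<notin> F" using far[of S] by (auto simp: symdiff_def)
  then show ?case
    using F S(1) finF far by (intro exI[of _ "insert S F"]) auto
qed

lemma exists_code:
  "\<exists>W :: nat \<Rightarrow> nat set. (\<forall>w<2 ^ m. W w \<subseteq> {..<8 * m}) \<and>
    (\<forall>w<2 ^ m. \<forall>w'<2 ^ m. w \<noteq> w' \<longrightarrow> 2 * m < card (symdiff (W w) (W w')))"
proof -
  have "card {S \<in> Pow {..<8 * m}. card (symdiff S T) \<le> 2 * m} \<le> 2 ^ (7 * m)" if "T \<subseteq> {..<8 * m}" for T
    using card_symdiff_ball_le[OF _ that, of "2 * m"] sum_binomial_le[of m] by simp
  moreover have "2 ^ m * 2 ^ (7 * m) \<le> (2 :: nat) ^ card {..<8 * m}" by (simp add: power_add[symmetric])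
  ultimately obtain F where F: "F \<subseteq> Pow {..<8 * m}" "card F = 2 ^ m"
    "\<forall>S\<in>F. \<forall>T\<in>F. S \<noteq> T \<longrightarrow> 2 * m < card (symdiff S T)"
    using exists_separated_family[of "{..<8 * m}" "2 * m" "2 ^ (7 * m)" "2 ^ m"] by auto
  have "finite F" using F(1) by (meson finite_Pow_iff finite_lessThan finite_subset)
  then obtain W where W: "bij_betw W {0..<2 ^ m :: nat} F"
    using ex_bij_betw_nat_finite[of F] F(2) by auto
  have WF: "W w \<in> F" if "w < 2 ^ m" for w using W that by (auto simp: bij_betw_def)
  then have "W w \<subseteq> {..<8 * m}" if "w < 2 ^ m" for w using F(1) that by blast
  moreover have "W w \<noteq> W w'" if "w < 2 ^ m" "w' < 2 ^ m" "w \<noteq> w'" for w w'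
    using W that by (auto simp: bij_betw_def inj_on_def)
  ultimately show ?thesis using F(3) WF by (intro exI[of _ W]) simp
qed

text \<open>Decode every coordinate outside the few balanced ones by majority: most points of \<open>Z\<close> then lie
  close to the decoded word, hence share one codeword.\<close>

lemma majority_codeword:
  fixes word :: "'b \<Rightarrow> nat set" and cl :: "'b \<Rightarrow> nat" and \<tau> :: real
  assumes Z: "finite Z" and m: "0 < m" and word: "\<And>y. y \<in> Z \<Longrightarrow> word y \<subseteq> {..<8 * m}"
    and dist: "\<And>y y'. y \<in> Z \<Longrightarrow> y' \<in> Z \<Longrightarrow> cl y \<noteq> cl y' \<Longrightarrow> 2 * m < card (symdiff (word y) (word y'))"
    and J: "card {j \<in> {..<8 * m}. \<tau> \<le> real (card {y \<in> Z. j \<in> word y}) \<and> \<tau> \<le> real (card {y \<in> Z. j \<notin> word y})} < m"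
      (is "card ?J < m")
  shows "\<exists>w. real (card {y \<in> Z. cl y \<noteq> w}) \<le> 16 * \<tau>"
proof -
  \<comment> \<open>\<open>u\<close> is the majority word of \<open>Z\<close>, and
    \<open>d y\<close> the distance of \<open>word y\<close> from it outside the balanced
    coordinates. Each remaining coordinate is wrong for at most \<open>\<tau>\<close> points, so by
    Markov's inequality at most \<open>16 * \<tau>\<close> points are \<open>far\<close>, that is,
    at distance \<open>m / 2\<close> or more.\<close>
  define u where "u = {j \<in> {..<8 * m}. card {y \<in> Z. j \<notin> word y} \<le> card {y \<in> Z. j \<in> word y}}"
  define d where "d y = card (symdiff (word y) u - ?J)" for y
  define far where "far = {y \<in> Z. m \<le> 2 * d y}"
  have "(\<Sum>y\<in>Z. d y) = (\<Sum>y\<in>Z. \<Sum>j\<in>{..<8 * m} - ?J. of_bool (j \<in> symdiff (word y) u))"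
  proof (intro sum.cong refl)
    fix y assume "y \<in> Z"
    have "({..<8 * m} - ?J) \<inter> {j. j \<in> symdiff (word y) u} = symdiff (word y) u - ?J"
      using word[OF \<open>y \<in> Z\<close>] by (auto simp: symdiff_def u_def)
    then show "d y = (\<Sum>j\<in>{..<8 * m} - ?J. of_bool (j \<in> symdiff (word y) u))"
      by (simp add: d_def sum_of_bool_eq)
  qed
  also have "\<dots> = (\<Sum>j\<in>{..<8 * m} - ?J. \<Sum>y\<in>Z. of_bool (j \<in> symdiff (word y) u))" by (rule sum.swap)
  finally have "real (\<Sum>y\<in>Z. d y) = (\<Sum>j\<in>{..<8 * m} - ?J. real (card {y \<in> Z. j \<in> symdiff (word y) u}))"
    using Z by (simp add: sum_of_bool_eq Int_def)
  also have "\<dots> \<le> (\<Sum>j\<in>{..<8 * m} - ?J. \<tau>)"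
  proof (rule sum_mono)
    fix j assume j: "j \<in> {..<8 * m} - ?J"
    show "real (card {y \<in> Z. j \<in> symdiff (word y) u}) \<le> \<tau>"
    proof (cases "j \<in> u")
      case True
      then have "{y \<in> Z. j \<in> symdiff (word y) u} = {y \<in> Z. j \<notin> word y}" by (auto simp: symdiff_def)
      then show ?thesis using True j by (auto simp: u_def)
    next
      case False
      then have "{y \<in> Z. j \<in> symdiff (word y) u} = {y \<in> Z. j \<in> word y}" by (auto simp: symdiff_def)
      then show ?thesis using False j by (auto simp: u_def)
    qed
  qed
  also have "\<dots> = real (card ({..<8 * m} - ?J)) * \<tau>" by simp
  finally have sum: "real (\<Sum>y\<in>Z. d y) \<le> real (card ({..<8 * m} - ?J)) * \<tau>" .
  have Jc: "card ({..<8 * m} - ?J) = 8 * m - card ?J"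
    by (subst card_Diff_subset) auto
  have pos: "0 < card ({..<8 * m} - ?J)" using Jc J by simp
  have \<tau>0: "0 \<le> \<tau>"
  proof (rule ccontr)
    assume "\<not> 0 \<le> \<tau>"
    then have "real (card ({..<8 * m} - ?J)) * \<tau> < 0" using pos by (intro mult_pos_neg) auto
    then show False using sum of_nat_0_le_iff[of "\<Sum>y\<in>Z. d y", where 'a = real] by linarith
  qed
  have "card far * m \<le> 2 * (\<Sum>y\<in>far. d y)"
    using sum_mono[of far "\<lambda>_. m" "\<lambda>y. 2 * d y"] by (auto simp: far_def sum_distrib_left)
  also have "\<dots> \<le> 2 * (\<Sum>y\<in>Z. d y)" using Z by (intro mult_left_mono sum_mono2) (auto simp: far_def)
  finally have "real (card far) * real m \<le> 2 * real (\<Sum>y\<in>Z. d y)" by (metis of_nat_le_iff of_nat_mult of_nat_numeral)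
  also have "\<dots> \<le> 2 * (real (8 * m) * \<tau>)"
  proof -
    have "real (card ({..<8 * m} - ?J)) * \<tau> \<le> real (8 * m) * \<tau>"
      using card_mono[of "{..<8 * m}" "{..<8 * m} - ?J"] by (intro mult_right_mono \<tau>0 of_nat_mono) simp
    then show ?thesis using sum by linarith
  qed
  also have "2 * (real (8 * m) * \<tau>) = (16 * \<tau>) * real m" by simp
  finally have "real (card far) * real m \<le> (16 * \<tau>) * real m" .
  then have far: "real (card far) \<le> 16 * \<tau>" using m by simp
  have finfar: "finite far" using Z by (simp add: far_def)
  show ?thesis
  proof (cases "\<exists>y0\<in>Z. y0 \<notin> far")
    case True
    then obtain y0 where y0: "y0 \<in> Z" "2 * d y0 < m" by (auto simp: far_def)
    \<comment> \<open>Words of different clusters differ in more than \<open>2 * m\<close> places,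
      of which fewer than \<open>m\<close> are balanced; as \<open>d y0\<close> is below
      \<open>m / 2\<close>, the other point must be far.\<close>
    have "{y \<in> Z. cl y \<noteq> cl y0} \<subseteq> far"
    proof
      fix y assume y: "y \<in> {y \<in> Z. cl y \<noteq> cl y0}"
      have fin: "finite (symdiff (word y) u)" "finite (symdiff (word y0) u)" "finite ?J"
        using word[of y] word[of y0] y y0 by (auto simp: symdiff_def u_def intro: finite_subset)
      have "symdiff (word y) (word y0) \<subseteq> ?J \<union> ((symdiff (word y) u - ?J) \<union> (symdiff (word y0) u - ?J))"
        by (auto simp: symdiff_def)
      then have "card (symdiff (word y) (word y0)) \<le> card (?J \<union> ((symdiff (word y) u - ?J) \<union> (symdiff (word y0) u - ?J)))"
        using fin by (intro card_mono) auto
      also have "\<dots> \<le> card ?J + (d y + d y0)"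
        unfolding d_def by (meson add_le_mono card_Un_le le_refl le_trans)
      finally have "2 * m < card ?J + (d y + d y0)" using dist[of y y0] y y0 by simp
      then show "y \<in> far" using J y0 y by (simp add: far_def)
    qed
    then have "card {y \<in> Z. cl y \<noteq> cl y0} \<le> card far" using finfar by (intro card_mono)
    then show ?thesis using far by (intro exI[of _ "cl y0"]) linarith
  next
    case False
    then have "card {y \<in> Z. cl y \<noteq> 0} \<le> card far" using finfar by (intro card_mono) auto
    then show ?thesis using far by (intro exI[of _ 0]) linarith
  qed
qed

text \<open>For every apex \<open>c\<close>, cluster \<open>j\<close> of \<open>B i\<close> and
  cluster \<open>w\<close> of \<open>B (Suc i)\<close> are joined completely if
  \<open>j \<in> W i w\<close> and not at all otherwise; all clusters of a layer have equal size.
  Layers and apex set may share vertices, because the classes of \<open>trip G\<close> project to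
  one vertex set, so only cardinalities are recorded. The constant 65536 leaves room for all later
  losses.\<close>

locale layered_reg_partition =
  fixes G :: "'a hg" and P :: "'a set set" and \<epsilon> :: real and N s :: nat and C :: "'a set"
    and B :: "nat \<Rightarrow> 'a set" and cl :: "nat \<Rightarrow> 'a \<Rightarrow> nat" and m :: "nat \<Rightarrow> nat"
    and W :: "nat \<Rightarrow> nat \<Rightarrow> nat set"
  assumes fin: "finite (fst G)" and reg: "reg_partition G \<epsilon> P"
    and eps: "0 < \<epsilon>" "\<epsilon> * (real s + 2) ^ 3 \<le> 1 / 65536"
    and N: "0 < N" and C: "C \<subseteq> fst G" "card C = N"
    and B: "\<And>i. i \<le> s \<Longrightarrow> B i \<subseteq> fst G" "\<And>i. i \<le> s \<Longrightarrow> card (B i) = N"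
    and card_V: "card (fst G) \<le> (s + 2) * N"
    and m: "m 0 = 8" "\<And>i. i \<le> s \<Longrightarrow> 0 < m i"
    and cl: "\<And>i x. i \<le> s \<Longrightarrow> x \<in> B i \<Longrightarrow> cl i x < 8 * m i"
    and card_cl: "\<And>i j. i \<le> s \<Longrightarrow> j < 8 * m i \<Longrightarrow> card {x \<in> B i. cl i x = j} * (8 * m i) = N"
    and W: "\<And>i w. i < s \<Longrightarrow> w < 8 * m (Suc i) \<Longrightarrow> W i w \<subseteq> {..<8 * m i}"
    and W_dist: "\<And>i w w'. i < s \<Longrightarrow> w < 8 * m (Suc i) \<Longrightarrow> w' < 8 * m (Suc i) \<Longrightarrow> w \<noteq> w' \<Longrightarrow>
      2 * m i < card (symdiff (W i w) (W i w'))"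
    and edge: "\<And>i c x y. i < s \<Longrightarrow> c \<in> C \<Longrightarrow> x \<in> B i \<Longrightarrow> y \<in> B (Suc i) \<Longrightarrow>
      {c, x, y} \<in> snd G \<longleftrightarrow> cl i x \<in> W i (cl (Suc i) y)"
begin

abbreviation V where "V \<equiv> fst G"

definition part :: "'a \<Rightarrow> 'a set" where
  "part x = (THE X. X \<in> P \<and> x \<in> X)"

lemma P: "partition_on V P"
  using reg by (simp add: reg_partition_def good_partition_def)

lemma finP: "finite P" "X \<in> P \<Longrightarrow> finite X" "X \<in> P \<Longrightarrow> X \<subseteq> V"
  using P fin by (auto simp: partition_on_def intro: finite_UnionD dest: finite_subset[rotated])

lemma part_unique: "X \<in> P \<Longrightarrow> x \<in> X \<Longrightarrow> part x = X"
  unfolding part_def using partition_onD2[OF P] by (intro the_equality) (auto simp: disjoint_def)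

lemma part: assumes "x \<in> V" shows "part x \<in> P" "x \<in> part x"
proof -
  obtain X where "X \<in> P" "x \<in> X" using P assms by (auto simp: partition_on_def)
  then show "part x \<in> P" "x \<in> part x" using part_unique by auto
qed

lemma card_le_if_card_parts_le:
  assumes D: "D \<subseteq> V" and small: "\<And>X. X \<in> P \<Longrightarrow> D \<inter> X \<noteq> {} \<Longrightarrow> real (card (D \<inter> X)) \<le> \<delta> * real (card X)"
    and \<delta>: "0 \<le> \<delta>"
  shows "real (card D) \<le> \<delta> * real (card V)"
proof -
  have V: "V = \<Union>P" using P by (simp add: partition_on_def)
  have "D = (\<Union>X\<in>P. D \<inter> X)" using D V by auto
  then have "card D \<le> (\<Sum>X\<in>P. card (D \<inter> X))" using card_UN_le[OF finP(1), of "\<lambda>X. D \<inter> X"] by simp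
  then have "real (card D) \<le> (\<Sum>X\<in>P. real (card (D \<inter> X)))" by (metis of_nat_le_iff of_nat_sum)
  also have "\<dots> \<le> (\<Sum>X\<in>P. \<delta> * real (card X))"
  proof (rule sum_mono)
    fix X assume "X \<in> P"
    then show "real (card (D \<inter> X)) \<le> \<delta> * real (card X)"
      using small[of X] \<delta> by (cases "D \<inter> X = {}") auto
  qed
  also have "\<dots> = \<delta> * real (card V)"
    unfolding V using partition_onD2[OF P] finP
    by (subst card_Union_disjoint) (auto simp: sum_distrib_left)
  finally show ?thesis .
qed

lemma eps_V: "\<epsilon> * real (card V) \<le> real N / 65536"
  "\<epsilon> * real (card V) ^ 3 \<le> real N ^ 3 / 65536"
proof -
  have V: "real (card V) \<le> (real s + 2) * real N"
    using of_nat_mono[OF card_V, where 'a = real] by (simp add: algebra_simps)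
  have "(real s + 2) ^ 1 \<le> (real s + 2) ^ 3" by (rule power_increasing) auto
  then have "\<epsilon> * (real s + 2) \<le> \<epsilon> * (real s + 2) ^ 3" using eps(1) by simp
  then have e: "\<epsilon> * (real s + 2) \<le> 1 / 65536" using eps(2) by linarith
  have "\<epsilon> * real (card V) \<le> \<epsilon> * (real s + 2) * real N"
    using V eps(1) by (simp add: mult.assoc)
  also have "\<dots> \<le> 1 / 65536 * real N" by (rule mult_right_mono[OF e]) simp
  finally show "\<epsilon> * real (card V) \<le> real N / 65536" by simp
  have "\<epsilon> * real (card V) ^ 3 \<le> \<epsilon> * ((real s + 2) * real N) ^ 3"
    using V eps(1) by (intro mult_left_mono power_mono) auto
  also have "\<dots> = \<epsilon> * (real s + 2) ^ 3 * real N ^ 3" by (simp add: power_mult_distrib)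
  also have "\<dots> \<le> 1 / 65536 * real N ^ 3" by (rule mult_right_mono[OF eps(2)]) simp
  finally show "\<epsilon> * real (card V) ^ 3 \<le> real N ^ 3 / 65536" by simp
qed

lemma eps_small: "\<epsilon> < 1 / 2"
proof -
  have "1 \<le> (real s + 2) ^ 3" by (rule one_le_power) simp
  then have "\<epsilon> * 1 \<le> \<epsilon> * (real s + 2) ^ 3" using eps(1) by (intro mult_left_mono) auto
  then show ?thesis using eps(2) by linarith
qed

text \<open>\<open>good_C\<close> and \<open>good i\<close> single out the points whose part
  contains a piece of \<open>C\<close>, or of their own cluster, large enough to be a test set in
  \<open>reg_triple\<close>.\<close>

definition good_C :: "'a set" where
  "good_C = {c \<in> C. \<epsilon> * real (card (part c)) \<le> real (card (part c \<inter> C))}"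

definition good :: "nat \<Rightarrow> 'a set" where
  "good i = {x \<in> B i. \<epsilon> * real (card (part x)) \<le> real (card (part x \<inter> {x' \<in> B i. cl i x' = cl i x}))}"

definition bad_triples :: "('a \<times> 'a \<times> 'a) set" where
  "bad_triples = {(x, y, z) \<in> V \<times> V \<times> V. \<not> reg_triple G \<epsilon> (part x) (part y) (part z)}"

lemma card_bad_triples: "real (card bad_triples) \<le> real N ^ 3 / 65536"
proof -
  have "real (card bad_triples) \<le> \<epsilon> * real (card V) ^ 3"
    using reg good_partition_iff[OF fin P, of part] part unfolding reg_partition_def bad_triples_def by blast
  then show ?thesis using eps_V(2) by linarith
qed

lemma card_good_C: "real N / 2 \<le> real (card good_C)"
proof -
  have finC: "finite C" using C fin finite_subset by blast
  have "real (card (C - good_C)) \<le> \<epsilon> * real (card V)"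
  proof (rule card_le_if_card_parts_le)
    show "C - good_C \<subseteq> V" using C by auto
    fix X assume X: "X \<in> P" "(C - good_C) \<inter> X \<noteq> {}"
    then obtain c where c: "c \<in> C" "c \<notin> good_C" "c \<in> X" by blast
    then have "real (card (X \<inter> C)) < \<epsilon> * real (card X)"
      using part_unique[OF X(1) c(3)] by (auto simp: good_C_def)
    moreover have "card ((C - good_C) \<inter> X) \<le> card (X \<inter> C)" using finC by (intro card_mono) auto
    ultimately show "real (card ((C - good_C) \<inter> X)) \<le> \<epsilon> * real (card X)" by linarith
  qed (use eps in simp)
  moreover have "card (C - good_C) = N - card good_C" "card good_C \<le> N"
    using finC C by (auto simp: good_C_def card_Diff_subset intro!: card_mono)
  ultimately show ?thesis using eps_V(1) by linarith
qed

text \<open>The coordinate \<open>cl i x\<close> cuts the part of \<open>y\<close> into two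
  admissible pieces. Together with the good pieces around \<open>c\<close> and \<open>x\<close> they
  have densities exactly 1 and 0, and no number is within \<open>\<epsilon> < 1 / 2\<close> of
  both.\<close>

lemma irregular_if_balanced:
  assumes i: "i < s" and c: "c \<in> good_C" and x: "x \<in> good i" and y: "y \<in> B (Suc i)"
    and bal: "\<epsilon> * real (card (part y)) \<le> real (card {y' \<in> part y \<inter> B (Suc i). cl i x \<in> W i (cl (Suc i) y')})"
      "\<epsilon> * real (card (part y)) \<le> real (card {y' \<in> part y \<inter> B (Suc i). cl i x \<notin> W i (cl (Suc i) y')})"
  shows "(c, x, y) \<in> bad_triples"
proof -
  have inV: "c \<in> V" "x \<in> V" "y \<in> V" using c x y C B(1)[of i] B(1)[of "Suc i"] i by (auto simp: good_C_def good_def)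
  have "\<not> reg_triple G \<epsilon> (part c) (part x) (part y)"
  proof
    assume r: "reg_triple G \<epsilon> (part c) (part x) (part y)"
    define C' where "C' = part c \<inter> C"
    define X' where "X' = part x \<inter> {x' \<in> B i. cl i x' = cl i x}"
    define Y1 where "Y1 = {y' \<in> part y \<inter> B (Suc i). cl i x \<in> W i (cl (Suc i) y')}"
    define Y0 where "Y0 = {y' \<in> part y \<inter> B (Suc i). cl i x \<notin> W i (cl (Suc i) y')}"
    have fins: "finite (part c)" "finite (part x)" "finite (part y)" using finP part inV by auto
    then have fin': "finite C'" "finite X'" "finite Y1" "finite Y0"
      by (auto simp: C'_def X'_def Y1_def Y0_def)
    have sz: "\<epsilon> * real (card (part c)) \<le> real (card C')" "\<epsilon> * real (card (part x)) \<le> real (card X')"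
      "\<epsilon> * real (card (part y)) \<le> real (card Y1)" "\<epsilon> * real (card (part y)) \<le> real (card Y0)"
      using c x bal by (auto simp: good_C_def good_def C'_def X'_def Y1_def Y0_def)
    have "0 < real (card (part c))" "0 < real (card (part x))" "0 < real (card (part y))"
      using part inV fins by (auto simp: card_gt_0_iff)
    then have "0 < \<epsilon> * real (card (part c))" "0 < \<epsilon> * real (card (part x))" "0 < \<epsilon> * real (card (part y))"
      using eps(1) by auto
    then have pos: "0 < real (card C')" "0 < real (card X')" "0 < real (card Y1)"
      using sz by linarith+
    have ed: "{c', x', y'} \<in> snd G \<longleftrightarrow> cl i x \<in> W i (cl (Suc i) y')"
      if "c' \<in> C'" "x' \<in> X'" "y' \<in> B (Suc i)" for c' x' y'
      using edge[OF i, of c' x' y'] that by (auto simp: C'_def X'_def)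
    have "triples G C' X' Y1 = C' \<times> X' \<times> Y1" using ed by (auto simp: triples_def Y1_def)
    then have "dens G C' X' Y1 = 1"
      using pos unfolding dens_eq by (simp add: card_cartesian_product mult.assoc)
    moreover have "triples G C' X' Y0 = {}" using ed by (auto simp: triples_def Y0_def)
    then have "dens G C' X' Y0 = 0" unfolding dens_eq by simp
    moreover have "C' \<subseteq> part c" "X' \<subseteq> part x" "Y1 \<subseteq> part y" "Y0 \<subseteq> part y"
      by (auto simp: C'_def X'_def Y1_def Y0_def)
    then have "\<bar>dens G (part c) (part x) (part y) - dens G C' X' Y1\<bar> \<le> \<epsilon>"
      "\<bar>dens G (part c) (part x) (part y) - dens G C' X' Y0\<bar> \<le> \<epsilon>"
      using r sz unfolding reg_triple_def by blast+
    ultimately show False using eps_small by linarith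
  qed
  then show ?thesis using inV by (simp add: bad_triples_def)
qed

text \<open>\<open>M\<close> names a dominant cluster for each part. The share 1/32 is the same in
  all layers, so that alignment can be passed up the chain.\<close>

definition aligned :: "nat \<Rightarrow> bool" where
  "aligned i \<longleftrightarrow> (\<exists>M. real (card {y \<in> B i. cl i y \<noteq> M (part y)}) \<le> real N / 32)"

text \<open>The bottom layer has only 64 clusters, so a loss of \<open>\<epsilon> * card V\<close>
  for each of them is affordable.\<close>

lemma good_0: "real (card (B 0 - good 0)) \<le> real N / 16"
proof -
  have finB: "finite (B 0)" using B[of 0] fin finite_subset by blast
  define D where "D j = {x \<in> B 0 - good 0. cl 0 x = j}" for j
  have D: "real (card (D j)) \<le> \<epsilon> * real (card V)" for j
  proof (rule card_le_if_card_parts_le)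
    show "D j \<subseteq> V" using B[of 0] by (auto simp: D_def)
    fix X assume X: "X \<in> P" "D j \<inter> X \<noteq> {}"
    then obtain x where x: "x \<in> B 0" "x \<notin> good 0" "cl 0 x = j" "x \<in> X" by (auto simp: D_def)
    then have "real (card (X \<inter> {x' \<in> B 0. cl 0 x' = j})) < \<epsilon> * real (card X)"
      using part_unique[OF X(1) x(4)] by (auto simp: good_def)
    moreover have "card (D j \<inter> X) \<le> card (X \<inter> {x' \<in> B 0. cl 0 x' = j})"
      using finB by (intro card_mono) (auto simp: D_def)
    ultimately show "real (card (D j \<inter> X)) \<le> \<epsilon> * real (card X)" by linarith
  qed (use eps in simp)
  have "B 0 - good 0 = (\<Union>j<64. D j)" using cl[of 0] m(1) by (auto simp: D_def)
  then have "card (B 0 - good 0) \<le> (\<Sum>j<64. card (D j))" using card_UN_le[of "{..<64}" D] by simp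
  then have "real (card (B 0 - good 0)) \<le> (\<Sum>j<64. real (card (D j)))" by (metis of_nat_le_iff of_nat_sum)
  also have "\<dots> \<le> (\<Sum>j<64::nat. \<epsilon> * real (card V))" by (intro sum_mono D)
  also have "\<dots> = 64 * (\<epsilon> * real (card V))" by simp
  finally show ?thesis using eps_V(1) by linarith
qed

text \<open>Apart from the misaligned points, each part only has to be tested against its one
  dominant cluster. So \<open>\<epsilon> * card V\<close> is lost just once, however many clusters
  the layer has.\<close>

lemma good_if_aligned:
  assumes i: "i \<le> s" and al: "aligned i" shows "real (card (B i - good i)) \<le> real N / 16"
proof -
  have finB: "finite (B i)" using B(1)[OF i] fin finite_subset by blast
  obtain M where M: "real (card {y \<in> B i. cl i y \<noteq> M (part y)}) \<le> real N / 32"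
    using al by (auto simp: aligned_def)
  define D where "D = {y \<in> B i - good i. cl i y = M (part y)}"
  have "real (card D) \<le> \<epsilon> * real (card V)"
  proof (rule card_le_if_card_parts_le)
    show "D \<subseteq> V" using B(1)[OF i] by (auto simp: D_def)
    fix X assume X: "X \<in> P" "D \<inter> X \<noteq> {}"
    then obtain x where x: "x \<in> B i" "x \<notin> good i" "cl i x = M X" "x \<in> X"
      using part_unique by (auto simp: D_def)
    then have "real (card (X \<inter> {x' \<in> B i. cl i x' = M X})) < \<epsilon> * real (card X)"
      using part_unique[OF X(1) x(4)] by (auto simp: good_def)
    moreover have "card (D \<inter> X) \<le> card (X \<inter> {x' \<in> B i. cl i x' = M X})"
      using finB part_unique[OF X(1)] by (intro card_mono) (auto simp: D_def)
    ultimately show "real (card (D \<inter> X)) \<le> \<epsilon> * real (card X)" by linarith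
  qed (use eps in simp)
  moreover have "card (B i - good i) \<le> card ({y \<in> B i. cl i y \<noteq> M (part y)} \<union> D)"
    using finB by (intro card_mono) (auto simp: D_def)
  moreover have "card ({y \<in> B i. cl i y \<noteq> M (part y)} \<union> D) \<le> card {y \<in> B i. cl i y \<noteq> M (part y)} + card D"
    by (rule card_Un_le)
  ultimately show ?thesis using M eps_V(1) by linarith
qed

text \<open>\<open>J Z\<close> holds the coordinates balanced on the part \<open>Z\<close>. If there
  are fewer than \<open>m i\<close>, majority decoding gives a dominant cluster up to
  \<open>16 * \<epsilon>\<close> of the part. Otherwise each layer point of the part lies in so many
  irregular triples that regularity allows only few such points. The bound obtained does not depend
  on how the loss below arose, so nothing accumulates.\<close>

lemma aligned_Suc:
  assumes i: "i < s" and gd: "real (card (B i - good i)) \<le> real N / 16"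
  shows "aligned (Suc i)"
proof -
  let ?B = "B (Suc i)" and ?cl = "cl (Suc i)"
  have i': "i \<le> s" "Suc i \<le> s" using i by auto
  have finB: "finite (B i)" "finite ?B" using B(1)[OF i'(1)] B(1)[OF i'(2)] fin finite_subset by blast+
  define J where "J Z = {j \<in> {..<8 * m i}. \<epsilon> * real (card Z) \<le> real (card {y \<in> Z \<inter> ?B. j \<in> W i (?cl y)}) \<and>
    \<epsilon> * real (card Z) \<le> real (card {y \<in> Z \<inter> ?B. j \<notin> W i (?cl y)})}" for Z
  have "\<exists>w. card (J Z) < m i \<longrightarrow> real (card {y \<in> Z \<inter> ?B. ?cl y \<noteq> w}) \<le> 16 * (\<epsilon> * real (card Z))" for Z
  proof (cases "card (J Z) < m i")
    case True
    have "\<exists>w. real (card {y \<in> Z \<inter> ?B. ?cl y \<noteq> w}) \<le> 16 * (\<epsilon> * real (card Z))"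
      by (rule majority_codeword[where m = "m i" and word = "\<lambda>y. W i (?cl y)"])
        (use True finB m(2)[OF i'(1)] W[OF i] W_dist[OF i] cl[OF i'(2)] in \<open>auto simp: J_def\<close>)
    then show ?thesis by blast
  qed blast
  then obtain M where M: "\<And>Z. card (J Z) < m i \<Longrightarrow> real (card {y \<in> Z \<inter> ?B. ?cl y \<noteq> M Z}) \<le> 16 * (\<epsilon> * real (card Z))"
    by metis
  define Bad where "Bad = {y \<in> ?B. m i \<le> card (J (part y))}"
  define D where "D = {y \<in> ?B - Bad. ?cl y \<noteq> M (part y)}"
  have "real (card D) \<le> (16 * \<epsilon>) * real (card V)"
  proof (rule card_le_if_card_parts_le)
    show "D \<subseteq> V" using B(1)[OF i'(2)] by (auto simp: D_def)
    fix Z assume Z: "Z \<in> P" "D \<inter> Z \<noteq> {}"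
    then obtain y where "y \<in> ?B" "y \<notin> Bad" "y \<in> Z" by (auto simp: D_def)
    then have "card (J Z) < m i" using part_unique[OF Z(1)] by (auto simp: Bad_def)
    moreover have "card (D \<inter> Z) \<le> card {y \<in> Z \<inter> ?B. ?cl y \<noteq> M Z}"
      using finB part_unique[OF Z(1)] by (intro card_mono) (auto simp: D_def)
    ultimately show "real (card (D \<inter> Z)) \<le> 16 * \<epsilon> * real (card Z)" using M[of Z] by linarith
  qed (use eps in simp)
  then have D: "real (card D) \<le> 16 * (real N / 65536)" using eps_V(1) by linarith
  \<comment> \<open>Clusters have equal size, so those in \<open>J (part y)\<close> fill at least an
    eighth of \<open>B i\<close>; discarding at most \<open>N / 16\<close> points that are not good
    leaves \<open>N / 16\<close>.\<close>
  have X: "real N / 16 \<le> real (card {x \<in> good i. cl i x \<in> J (part y)})" if y: "y \<in> Bad" for y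
  proof -
    let ?J = "J (part y)"
    have finJ: "finite ?J" by (simp add: J_def)
    have "card {x \<in> B i. cl i x \<in> ?J} = card (\<Union>j\<in>?J. {x \<in> B i. cl i x = j})"
      by (rule arg_cong[of _ _ card]) auto
    also have "\<dots> = (\<Sum>j\<in>?J. card {x \<in> B i. cl i x = j})"
      using finB finJ by (intro card_UN_disjoint) auto
    finally have "card {x \<in> B i. cl i x \<in> ?J} * (8 * m i) = (\<Sum>j\<in>?J. card {x \<in> B i. cl i x = j} * (8 * m i))"
      by (simp only: sum_distrib_right)
    also have "\<dots> = (\<Sum>j\<in>?J. N)"
      using card_cl[OF i'(1)] by (intro sum.cong refl) (simp add: J_def)
    also have "\<dots> = card ?J * N" by simp
    finally have "m i * N \<le> card {x \<in> B i. cl i x \<in> ?J} * (8 * m i)"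
      using y by (simp add: Bad_def)
    then have "m i * N \<le> m i * (8 * card {x \<in> B i. cl i x \<in> ?J})" by (simp only: ac_simps)
    then have "N \<le> 8 * card {x \<in> B i. cl i x \<in> ?J}" using m(2)[OF i'(1)] by simp
    moreover have "card {x \<in> B i. cl i x \<in> ?J} \<le> card ({x \<in> good i. cl i x \<in> ?J} \<union> (B i - good i))"
      using finB by (intro card_mono) (auto simp: good_def)
    moreover have "\<dots> \<le> card {x \<in> good i. cl i x \<in> ?J} + card (B i - good i)" by (rule card_Un_le)
    ultimately show ?thesis using gd by linarith
  qed
  define I where "I = (\<lambda>(y, c, x). (c, x, y)) ` (SIGMA y:Bad. good_C \<times> {x \<in> good i. cl i x \<in> J (part y)})"
  have fins: "finite Bad" "finite good_C" "finite (good i)"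
    using finB C fin by (auto simp: Bad_def good_C_def good_def dest: finite_subset)
  have "I \<subseteq> bad_triples"
    unfolding I_def
  proof clarsimp
    fix y c x assume "y \<in> Bad" "c \<in> good_C" "x \<in> good i" "cl i x \<in> J (part y)"
    then show "(c, x, y) \<in> bad_triples"
      using irregular_if_balanced[OF i, of c x y] by (auto simp: Bad_def J_def)
  qed
  moreover have "bad_triples \<subseteq> V \<times> V \<times> V" by (auto simp: bad_triples_def)
  then have "finite bad_triples" using fin by (meson finite_SigmaI finite_subset)
  ultimately have "card I \<le> card bad_triples" by (intro card_mono)
  then have I: "real (card I) \<le> real N ^ 3 / 65536" using card_bad_triples by linarith
  have "card I = (\<Sum>y\<in>Bad. card good_C * card {x \<in> good i. cl i x \<in> J (part y)})"
    unfolding I_def using fins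
    by (subst card_image) (auto simp: inj_on_def card_SigmaI card_cartesian_product)
  then have cI: "real (card I) = (\<Sum>y\<in>Bad. real (card good_C) * real (card {x \<in> good i. cl i x \<in> J (part y)}))"
    by simp
  \<comment> \<open>Each \<open>y \<in> Bad\<close> carries \<open>N / 2 * (N / 16)\<close>
    irregular triples out of at most \<open>N ^ 3 / 65536\<close>. So \<open>Bad\<close> has at most
    \<open>N / 2048\<close> points and \<open>D\<close> at most \<open>N / 4096\<close>, together
    well below \<open>N / 32\<close>.\<close>
  have "(\<Sum>y\<in>Bad. real N / 2 * (real N / 16)) \<le> real (card I)"
    unfolding cI using X card_good_C by (intro sum_mono mult_mono) auto
  moreover have "(\<Sum>y\<in>Bad. real N / 2 * (real N / 16)) = real (card Bad) * (real N * real N / 32)" by simp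
  ultimately have "real (card Bad) * (real N * real N / 32) \<le> real N ^ 3 / 65536" using I by linarith
  then have "(real N * real N) * (real (card Bad) / 32) \<le> (real N * real N) * (real N / 65536)"
    by (simp add: power3_eq_cube)
  then have Bad: "real (card Bad) / 32 \<le> real N / 65536" using N by simp
  have "card {y \<in> ?B. ?cl y \<noteq> M (part y)} \<le> card (Bad \<union> D)"
    using finB fins by (intro card_mono) (auto simp: D_def)
  also have "\<dots> \<le> card Bad + card D" by (rule card_Un_le)
  finally have "real (card {y \<in> ?B. ?cl y \<noteq> M (part y)}) \<le> real N / 32" using Bad D by linarith
  then show ?thesis unfolding aligned_def by blast
qed

text \<open>More than half of the top layer lies in the dominant cluster of its part, and each part
  captures in this way at most one cluster, that is, \<open>N / (8 * m s)\<close> points.\<close>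

lemma card_P_ge:
  assumes "1 \<le> s" shows "4 * m s \<le> card P"
proof -
  have good: "real (card (B i - good i)) \<le> real N / 16" if "i \<le> s" for i
    using that
  proof (induction i)
    case 0
    show ?case by (rule good_0)
  next
    case (Suc i)
    then show ?case using good_if_aligned aligned_Suc[of i] by auto
  qed
  have "aligned s" using aligned_Suc[of "s - 1"] good[of "s - 1"] assms by auto
  then obtain M where M: "real (card {y \<in> B s. cl s y \<noteq> M (part y)}) \<le> real N / 32"
    by (auto simp: aligned_def)
  have finB: "finite (B s)" using B(1)[of s] fin finite_subset by blast
  have "N = card {y \<in> B s. cl s y \<noteq> M (part y)} + card {y \<in> B s. cl s y = M (part y)}"
    using B(2)[of s] finB by (subst card_Un_disjoint[symmetric]) (auto intro!: arg_cong[of _ _ card])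
  then have h: "real N / 2 \<le> real (card {y \<in> B s. cl s y = M (part y)})" using M by linarith
  have "{y \<in> B s. cl s y = M (part y)} \<subseteq> (\<Union>X\<in>P. {y \<in> B s. cl s y = M X})"
    using part B(1)[of s] by auto
  then have "card {y \<in> B s. cl s y = M (part y)} \<le> card (\<Union>X\<in>P. {y \<in> B s. cl s y = M X})"
    using finB finP by (intro card_mono) auto
  also have "\<dots> \<le> (\<Sum>X\<in>P. card {y \<in> B s. cl s y = M X})" by (rule card_UN_le[OF finP(1)])
  finally have "card {y \<in> B s. cl s y = M (part y)} * (8 * m s) \<le> (\<Sum>X\<in>P. card {y \<in> B s. cl s y = M X} * (8 * m s))"
    unfolding sum_distrib_right[symmetric] by (rule mult_right_mono) simp
  also have "\<dots> \<le> (\<Sum>X\<in>P. N)"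
  proof (rule sum_mono)
    fix X
    show "card {y \<in> B s. cl s y = M X} * (8 * m s) \<le> N"
    proof (cases "M X < 8 * m s")
      case True
      then show ?thesis using card_cl[of s "M X"] by simp
    next
      case False
      then have "{y \<in> B s. cl s y = M X} = {}" by (auto dest!: cl[OF order_refl])
      then show ?thesis by (simp only: card.empty)
    qed
  qed
  finally have "real (card {y \<in> B s. cl s y = M (part y)} * (8 * m s)) \<le> real (N * card P)"
    by (intro of_nat_mono) (simp add: mult.commute)
  moreover have "real N / 2 * real (8 * m s) \<le> real (card {y \<in> B s. cl s y = M (part y)}) * real (8 * m s)"
    by (intro mult_right_mono h) simp
  moreover have "real N / 2 * real (8 * m s) = real N * real (4 * m s)" by simp
  ultimately have "real N * real (4 * m s) \<le> real N * real (card P)"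
    unfolding of_nat_mult of_nat_numeral by linarith
  then show ?thesis using N by simp
qed

end

section \<open>Realising the layers inside a member of the property\<close>

lemma card_mod_eq:
  fixes k N :: nat
  assumes k: "k dvd N" and j: "j < k"
  shows "card {p. p < N \<and> p mod k = j} * k = N"
proof -
  obtain q where q: "N = k * q" using k by blast
  have "{p. p < N \<and> p mod k = j} = (\<lambda>i. k * i + j) ` {..<q}"
  proof (intro set_eqI iffI)
    fix p assume p: "p \<in> {p. p < N \<and> p mod k = j}"
    then have "p = k * (p div k) + j" "p div k < q"
      using mult_div_mod_eq[of k p] j by (auto simp: q less_mult_imp_div_less mult.commute)
    then show "p \<in> (\<lambda>i. k * i + j) ` {..<q}" by blast
  next
    fix p assume "p \<in> (\<lambda>i. k * i + j) ` {..<q}"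
    then obtain i where i: "i < q" "p = k * i + j" by blast
    have "k * i + j < k * Suc i" using j by simp
    also have "\<dots> \<le> k * q" using i by (intro mult_le_mono2) simp
    finally show "p \<in> {p. p < N \<and> p mod k = j}" using i j by (simp add: q)
  qed
  moreover have "inj_on (\<lambda>i. k * i + j) {..<q}" using j by (auto simp: inj_on_def)
  ultimately show ?thesis by (simp add: card_image q)
qed

text \<open>The recursion solves \<open>8 * code_size (Suc i) = 2 ^ code_size i\<close>: layer
  \<open>Suc i\<close> has exactly one cluster per codeword over the clusters of layer
  \<open>i\<close>.\<close>

fun code_size :: "nat \<Rightarrow> nat" where
  "code_size 0 = 8"
| "code_size (Suc i) = 2 ^ (code_size i - 3)"

lemma code_size_ge: "8 \<le> code_size i"
proof (induction i)
  case (Suc i)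
  then have "(2 :: nat) ^ 3 \<le> 2 ^ (code_size i - 3)" by (intro power_increasing) auto
  then show ?case by simp
qed simp

lemma eight_code_size_Suc: "8 * code_size (Suc i) = 2 ^ code_size i"
proof -
  have "(2 :: nat) ^ code_size i = 2 ^ (3 + (code_size i - 3))" using code_size_ge[of i] by simp
  then show ?thesis by (simp add: power_add)
qed

text \<open>The surplus 4 in the invariant covers the 3 subtracted in the exponent and leaves 1,
  which doubles the power and so renews the surplus. Starting at index 2 makes the next tower value
  at least 4, as the doubling needs.\<close>

lemma Tw_le_code_size: "Tw i \<le> code_size i"
proof -
  have *: "Tw (i + 2) + 4 \<le> code_size (i + 2)" for i
  proof (induction i)
    case 0
    have "0 + 2 = Suc (Suc 0)" by simp
    then show ?case by (simp only:) simp
  next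
    case (Suc i)
    have "4 \<le> Tw (Suc i + 2)" using Tw_mono[of 3 "Suc i + 2"] by (simp add: numeral_3_eq_3)
    then have "Tw (Suc i + 2) + 4 \<le> 2 * 2 ^ Tw (i + 2)" by (simp add: Tw_Suc)
    also have "\<dots> = 2 ^ (Tw (i + 2) + 1)" by simp
    also have "\<dots> \<le> 2 ^ (code_size (i + 2) - 3)" using Suc by (intro power_increasing) auto
    finally show ?case by simp
  qed
  show ?thesis
  proof (cases "2 \<le> i")
    case True
    then have "i - 2 + 2 = i" by simp
    then show ?thesis using *[of "i - 2"] by (simp only:)
  next
    case False
    then have "i = 0 \<or> i = 1" by auto
    then show ?thesis by auto
  qed
qed

definition code :: "nat \<Rightarrow> nat \<Rightarrow> nat set" where
  "code i = (SOME W. (\<forall>w<2 ^ code_size i. W w \<subseteq> {..<8 * code_size i}) \<and>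
    (\<forall>w<2 ^ code_size i. \<forall>w'<2 ^ code_size i. w \<noteq> w' \<longrightarrow> 2 * code_size i < card (symdiff (W w) (W w'))))"

lemma code:
  "w < 2 ^ code_size i \<Longrightarrow> code i w \<subseteq> {..<8 * code_size i}"
  "w < 2 ^ code_size i \<Longrightarrow> w' < 2 ^ code_size i \<Longrightarrow> w \<noteq> w' \<Longrightarrow> 2 * code_size i < card (symdiff (code i w) (code i w'))"
  using someI_ex[OF exists_code[of "code_size i"], folded code_def] by auto

text \<open>Layer \<open>i\<close> has points \<open>(i, p)\<close> with \<open>p < N\<close>, in the cluster \<open>p mod (8 * code_size i)\<close>. Even layers are
  placed among the vertices \<open>a\<^sub>j\<close> of \<open>U(K)\<close>, with index \<open>pos N i p\<close>, odd layers among the vertices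
  \<open>b\<^sub>S\<close>, with \<open>S = nbr s N i p\<close>; the element \<open>pos N i p\<close> of \<open>nbr s N i p\<close> only makes these sets distinct.\<close>

definition pos :: "nat \<Rightarrow> nat \<Rightarrow> nat \<Rightarrow> nat" where
  "pos N i p = Suc (i * N + p)"

definition linked :: "nat \<Rightarrow> nat \<Rightarrow> nat \<Rightarrow> bool" where
  "linked i p q \<longleftrightarrow> p mod (8 * code_size i) \<in> code i (q mod (8 * code_size (Suc i)))"

definition nbr :: "nat \<Rightarrow> nat \<Rightarrow> nat \<Rightarrow> nat \<Rightarrow> nat set" where
  "nbr s N i p = insert (pos N i p) {pos N i' p' | i' p'. i' \<le> s \<and> even i' \<and> p' < N \<and>
     (Suc i' = i \<and> linked i' p' p \<or> i' = Suc i \<and> linked i p p')}"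

lemma pos_eq_iff:
  assumes "p < N" "p' < N" shows "pos N i p = pos N i' p' \<longleftrightarrow> i = i' \<and> p = p'"
proof
  assume "pos N i p = pos N i' p'"
  then have e: "i * N + p = i' * N + p'" by (simp add: pos_def)
  have "(i * N + p) div N = i" "(i' * N + p') div N = i'"
    "(i * N + p) mod N = p" "(i' * N + p') mod N = p'" using assms by simp_all
  then show "i = i' \<and> p = p'" using e by metis
qed simp

lemma pos_mem:
  assumes "p < N" "i \<le> s" shows "pos N i p \<in> {1..(s + 1) * N}"
proof -
  have "i * N + p < Suc i * N" using assms by simp
  also have "\<dots> \<le> (s + 1) * N" using assms by (intro mult_le_mono1) simp
  finally show ?thesis by (simp add: pos_def)
qed

lemma nbr_subset: "p < N \<Longrightarrow> i \<le> s \<Longrightarrow> nbr s N i p \<subseteq> {1..(s + 1) * N}"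
  unfolding nbr_def using pos_mem by blast

text \<open>The tag \<open>pos N i p\<close> has an odd layer index, hence is never confused with
  the even positions queried here.\<close>

lemma pos_mem_nbr_iff:
  assumes "odd i" "even i'" "p < N" "p' < N" "i' \<le> s"
  shows "pos N i' p' \<in> nbr s N i p \<longleftrightarrow> (Suc i' = i \<and> linked i' p' p \<or> i' = Suc i \<and> linked i p p')"
  using assms unfolding nbr_def by (auto simp: pos_eq_iff)

lemma nbr_inj:
  assumes "odd i" "p < N" "p' < N" "nbr s N i p = nbr s N i p'" shows "p = p'"
proof -
  have "pos N i p \<in> nbr s N i p'" using assms(4) by (auto simp: nbr_def)
  then show ?thesis using assms(1-3) unfolding nbr_def by (auto simp: pos_eq_iff)
qed

lemma code_size_le_admits_reg:
  assumes H: "hereditary \<H>" and tr: "\<And>k. 1 \<le> k \<Longrightarrow> in_Trip \<H> (tensor k (Ubip k))"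
    and s: "1 \<le> s" and eps: "0 < \<epsilon>" "\<epsilon> * (real s + 2) ^ 3 \<le> 1 / 65536" and M: "admits_reg \<H> \<epsilon> M"
  shows "4 * code_size s \<le> M"
proof -
  obtain N0 where N0: "\<And>G. G \<in> \<H> \<Longrightarrow> N0 \<le> card (fst G) \<Longrightarrow> \<exists>P. reg_partition G \<epsilon> P \<and> card P \<le> M"
    using M by (auto simp: admits_reg_def)
  \<comment> \<open>Divisible by all cluster counts up to \<open>s\<close>, so that residues cut
    every layer into exactly equal clusters, and at least \<open>N0\<close>, so that the 3-graph
    spanned by the layers is large enough.\<close>
  define N where "N = Suc N0 * (\<Prod>i\<le>s. 8 * code_size i)"
  have dvd: "8 * code_size i dvd N" if "i \<le> s" for i
    unfolding N_def using that by (intro dvd_mult dvd_prodI) auto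
  have "0 < (\<Prod>i\<le>s. 8 * code_size i)" using code_size_ge by (intro prod_pos) (auto intro: less_le_trans[of 0 8])
  then have "1 \<le> (\<Prod>i\<le>s. 8 * code_size i)" by linarith
  then have "Suc N0 * 1 \<le> N" unfolding N_def by (rule mult_le_mono2)
  then have N: "0 < N" "N0 \<le> N" by auto
  define K where "K = (s + 1) * N"
  have K: "1 \<le> K" "N \<le> K" using N by (auto simp: K_def)
  obtain G and \<gamma> \<alpha> :: "nat \<Rightarrow> nat" and \<beta> :: "nat set \<Rightarrow> nat"
    where G: "G \<in> \<H>" and inj: "inj_on \<gamma> {1..K}" "inj_on \<alpha> {1..K}" "inj_on \<beta> (Pow {1..K} - {{}})"
    and img: "\<gamma> ` {1..K} \<subseteq> fst G" "\<alpha> ` {1..K} \<subseteq> fst G" "\<beta> ` Pow {1..K} \<subseteq> fst G"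
    and E: "\<And>i j S. i \<in> {1..K} \<Longrightarrow> j \<in> {1..K} \<Longrightarrow> S \<subseteq> {1..K} \<Longrightarrow> S \<noteq> {} \<Longrightarrow> {\<gamma> i, \<alpha> j, \<beta> S} \<in> snd G \<longleftrightarrow> j \<in> S"
    using in_Trip_tensor_UbipE[OF tr[OF K(1)] K(1)] by metis
  define v where "v i p = (if even i then \<alpha> (pos N i p) else \<beta> (nbr s N i p))" for i p
  have v_inj: "inj_on (v i) {..<N}" if i: "i \<le> s" for i
  proof (rule inj_onI)
    fix p p' assume p: "p \<in> {..<N}" "p' \<in> {..<N}" "v i p = v i p'"
    show "p = p'"
    proof (cases "even i")
      case True
      then have "pos N i p = pos N i p'"
        using p pos_mem[of p N i s] pos_mem[of p' N i s] i inj(2) by (auto simp: v_def K_def dest: inj_onD)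
      then show ?thesis using p by (simp add: pos_eq_iff)
    next
      case False
      have "nbr s N i p \<in> Pow {1..K} - {{}}" "nbr s N i p' \<in> Pow {1..K} - {{}}"
        using nbr_subset[of p N i s] nbr_subset[of p' N i s] p i by (auto simp: K_def nbr_def)
      then have "nbr s N i p = nbr s N i p'" using p(3) False inj_onD[OF inj(3)] by (simp add: v_def)
      then show ?thesis using p False nbr_inj[of i p N p' s] by simp
    qed
  qed
  have v_mem: "v i p \<in> fst G" if "i \<le> s" "p < N" for i p
    using img pos_mem[OF that(2,1)] nbr_subset[OF that(2,1)] by (auto simp: v_def K_def)
  define C where "C = \<gamma> ` {1..N}"
  define B where "B i = v i ` {..<N}" for i
  define cl where "cl i x = the_inv_into {..<N} (v i) x mod (8 * code_size i)" for i x
  define V where "V = C \<union> (\<Union>i\<le>s. B i)"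
  have VG: "V \<subseteq> fst G" using img(1) v_mem K by (auto simp: V_def C_def B_def)
  \<comment> \<open>Restricting to the layers keeps the vertex count within
    \<open>(s + 2) * N\<close>; inside all of \<open>G\<close> the layers could be a negligible
    share, invisible to an \<open>\<epsilon>\<close>-regular partition.\<close>
  define G' where "G' = induced G V"
  have G': "G' \<in> \<H>" "fst G' = V" "snd G' = {e \<in> snd G. e \<subseteq> V}"
    using H G VG by (auto simp: G'_def hereditary_def induced_def)
  have cl_v: "cl i (v i p) = p mod (8 * code_size i)" if "i \<le> s" "p < N" for i p
    using the_inv_into_f_f[OF v_inj[OF that(1)], of p] that(2) by (simp add: cl_def)
  have finV: "finite V" by (simp add: V_def C_def B_def)
  have cardC: "card C = N"
  proof -
    have "inj_on \<gamma> {1..N}" using inj(1) by (rule inj_on_subset) (use K in auto)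
    then show ?thesis by (simp add: C_def card_image)
  qed
  have cardB: "card (B i) = N" if "i \<le> s" for i
    unfolding B_def using v_inj[OF that] by (simp add: card_image)
  have "card V \<le> card C + card (\<Union>i\<le>s. B i)" unfolding V_def by (rule card_Un_le)
  also have "card (\<Union>i\<le>s. B i) \<le> (\<Sum>i\<le>s. card (B i))" by (rule card_UN_le) simp
  also have "\<dots> = (s + 1) * N" using cardB by simp
  finally have cardV: "card V \<le> (s + 2) * N" by (simp add: cardC)
  have "N0 \<le> card V" using card_mono[OF finV, of C] cardC N by (auto simp: V_def)
  then obtain P where regP: "reg_partition G' \<epsilon> P" "card P \<le> M" using N0[OF G'(1)] G'(2) by auto
  have lt: "q mod (8 * code_size (Suc i)) < 2 ^ code_size i" for q i
    unfolding eight_code_size_Suc by simp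
  interpret layered_reg_partition G' P \<epsilon> N s C B cl code_size code
  proof
    show "finite (fst G')" using finV G' by simp
    show "reg_partition G' \<epsilon> P" by (rule regP(1))
    show "0 < \<epsilon>" "\<epsilon> * (real s + 2) ^ 3 \<le> 1 / 65536" by (rule eps)+
    show "0 < N" "card C = N" by (rule N cardC)+
    show "C \<subseteq> fst G'" by (simp add: G' V_def)
    show "card (fst G') \<le> (s + 2) * N" using cardV G' by simp
    show "code_size 0 = 8" by simp
    show "0 < code_size i" for i using code_size_ge[of i] by simp
    show "B i \<subseteq> fst G'" if "i \<le> s" for i using that by (auto simp: G' V_def)
    show "card (B i) = N" if "i \<le> s" for i using cardB[OF that] .
    show "cl i x < 8 * code_size i" for i x using code_size_ge[of i] by (simp add: cl_def)
    show "card {x \<in> B i. cl i x = j} * (8 * code_size i) = N" if i: "i \<le> s" "j < 8 * code_size i" for i j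
    proof -
      have "{x \<in> B i. cl i x = j} = v i ` {p. p < N \<and> p mod (8 * code_size i) = j}"
        using cl_v[OF i(1)] by (auto simp: B_def)
      moreover have "inj_on (v i) {p. p < N \<and> p mod (8 * code_size i) = j}"
        using v_inj[OF i(1)] by (rule inj_on_subset) auto
      ultimately show ?thesis using card_mod_eq[OF dvd[OF i(1)] i(2)] by (simp add: card_image)
    qed
    show "code i w \<subseteq> {..<8 * code_size i}" if "w < 8 * code_size (Suc i)" for i w
      using that unfolding eight_code_size_Suc by (rule code(1))
    show "2 * code_size i < card (symdiff (code i w) (code i w'))"
      if "w < 8 * code_size (Suc i)" "w' < 8 * code_size (Suc i)" "w \<noteq> w'" for i w w'
      using that unfolding eight_code_size_Suc by (rule code(2))
    fix i c x y assume i: "i < s" and c: "c \<in> C" and x: "x \<in> B i" and y: "y \<in> B (Suc i)"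
    obtain a where a: "c = \<gamma> a" "a \<in> {1..K}" using c K by (auto simp: C_def)
    obtain p q where p: "p < N" "x = v i p" and q: "q < N" "y = v (Suc i) q"
      using x y by (auto simp: B_def)
    have "{c, x, y} \<subseteq> V" using i c x y by (auto simp: V_def Suc_le_eq)
    then have "{c, x, y} \<in> snd G' \<longleftrightarrow> {c, x, y} \<in> snd G" by (simp add: G')
    also have "\<dots> \<longleftrightarrow> linked i p q"
    \<comment> \<open>Consecutive layers lie on opposite sides of \<open>U(K)\<close>: the odd one
      of the two supplies the set \<open>nbr\<close>, the even one the element.\<close>
    proof (cases "even i")
      case True
      have S: "nbr s N (Suc i) q \<subseteq> {1..K}" "nbr s N (Suc i) q \<noteq> {}" "pos N i p \<in> {1..K}"
        using nbr_subset[of q N "Suc i" s] pos_mem[of p N i s] p q i by (auto simp: K_def nbr_def)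
      show ?thesis
        using E[OF a(2) S(3) S(1,2)] pos_mem_nbr_iff[of "Suc i" i q N p s] True p q i by (simp add: a v_def)
    next
      case False
      have S: "nbr s N i p \<subseteq> {1..K}" "nbr s N i p \<noteq> {}" "pos N (Suc i) q \<in> {1..K}"
        using nbr_subset[of p N i s] pos_mem[of q N "Suc i" s] p q i by (auto simp: K_def nbr_def)
      show ?thesis
        using E[OF a(2) S(3) S(1,2)] pos_mem_nbr_iff[of i "Suc i" p N q s] False p q i
        by (simp add: a v_def insert_commute)
    qed
    also have "\<dots> \<longleftrightarrow> cl i x \<in> code i (cl (Suc i) y)"
      using cl_v[of i p] cl_v[of "Suc i" q] p q i by (simp add: linked_def)
    finally show "{c, x, y} \<in> snd G' \<longleftrightarrow> cl i x \<in> code i (cl (Suc i) y)" .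
  qed
  show ?thesis using card_P_ge[OF s] regP(2) by (rule order_trans)
qed

lemma M_reg_bounds:
  assumes H: "hereditary \<H>" and tr: "\<forall>k\<ge>1. in_Trip \<H> (tensor k (Ubip k))"
  shows "\<exists>C>0. \<exists>C'>0. \<exists>\<epsilon>0>0. \<forall>\<epsilon>::real. 0 < \<epsilon> \<and> \<epsilon> < \<epsilon>0 \<longrightarrow>
              Tw (nat \<lceil>\<epsilon> powr (- C)\<rceil>) \<le> M_reg \<H> \<epsilon> \<and>
              M_reg \<H> \<epsilon> \<le> Tw (nat \<lceil>\<epsilon> powr (- C')\<rceil>)"
proof -
  have "eventually (\<lambda>\<epsilon>::real. \<epsilon> * (\<epsilon> powr (- (1 / 4)) + 3) ^ 3 \<le> 1 / 65536) (at_right 0)"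
    by real_asymp
  then obtain \<delta> where \<delta>: "0 < \<delta>" "\<And>\<epsilon>::real. 0 < \<epsilon> \<Longrightarrow> \<epsilon> < \<delta> \<Longrightarrow> \<epsilon> * (\<epsilon> powr (- (1 / 4)) + 3) ^ 3 \<le> 1 / 65536"
    by (auto simp: eventually_at_right_field)
  define \<epsilon>0 where "\<epsilon>0 = min \<delta> (1 / 13)"
  have "Tw (nat \<lceil>\<epsilon> powr (- (1 / 4))\<rceil>) \<le> M_reg \<H> \<epsilon> \<and> M_reg \<H> \<epsilon> \<le> Tw (nat \<lceil>\<epsilon> powr (- 7)\<rceil>)"
    if e: "0 < \<epsilon>" "\<epsilon> < \<epsilon>0" for \<epsilon>
  proof
    \<comment> \<open>The exponent 1/4 is below 1/3, so \<open>\<epsilon> * (s + 2) ^ 3\<close>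
      tends to 0 with \<open>\<epsilon>\<close> while \<open>s\<close> is still a power of
      \<open>1 / \<epsilon>\<close>.\<close>
    define s where "s = nat \<lceil>\<epsilon> powr (- (1 / 4))\<rceil>"
    have "0 < \<epsilon> powr (- (1 / 4))" using e by simp
    then have s1: "1 \<le> s" and s2: "real s + 2 \<le> \<epsilon> powr (- (1 / 4)) + 3" unfolding s_def by linarith+
    have "\<epsilon> * (real s + 2) ^ 3 \<le> \<epsilon> * (\<epsilon> powr (- (1 / 4)) + 3) ^ 3"
      using e s2 by (intro mult_left_mono power_mono) auto
    also have "\<dots> \<le> 1 / 65536" using e by (intro \<delta>(2)) (auto simp: \<epsilon>0_def)
    finally have small: "\<epsilon> * (real s + 2) ^ 3 \<le> 1 / 65536" .
    have adm: "admits_reg \<H> \<epsilon> (Tw (nat \<lceil>\<epsilon> powr (- 7)\<rceil>))"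
      using e by (intro admits_reg_Tw[OF H]) (auto simp: \<epsilon>0_def)
    then show "M_reg \<H> \<epsilon> \<le> Tw (nat \<lceil>\<epsilon> powr (- 7)\<rceil>)" unfolding M_reg_def by (rule Least_le)
    \<comment> \<open>The upper bound is what makes the \<open>LEAST\<close> in \<open>M_reg\<close>
      an admissible value, to which the lower bound applies.\<close>
    have "admits_reg \<H> \<epsilon> (M_reg \<H> \<epsilon>)" unfolding M_reg_def using adm by (rule LeastI)
    then have "4 * code_size s \<le> M_reg \<H> \<epsilon>"
      using tr s1 by (intro code_size_le_admits_reg[OF H _ _ e(1) small]) auto
    then show "Tw (nat \<lceil>\<epsilon> powr (- (1 / 4))\<rceil>) \<le> M_reg \<H> \<epsilon>"
      using Tw_le_code_size[of s] unfolding s_def by linarith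
  qed
  moreover have "0 < \<epsilon>0" using \<delta>(1) by (simp add: \<epsilon>0_def)
  ultimately show ?thesis by (intro exI[of _ "1 / 4"] conjI exI[of _ 7] exI[of _ \<epsilon>0]) auto
qed

theorem theorem5p5:
  fixes \<H> :: "nat hg set"
  assumes "hereditary \<H>"
  shows "((\<forall>k\<ge>1. in_Trip \<H> (tensor k (Ubip k))) \<and>
          (\<exists>C>0. \<exists>C'>0. \<exists>\<epsilon>0>0. \<forall>\<epsilon>::real. 0 < \<epsilon> \<and> \<epsilon> < \<epsilon>0 \<longrightarrow>
              Tw (nat \<lceil>\<epsilon> powr (- C)\<rceil>) \<le> M_reg \<H> \<epsilon> \<and>
              M_reg \<H> \<epsilon> \<le> Tw (nat \<lceil>\<epsilon> powr (- C')\<rceil>)))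
       \<or> ((\<exists>k\<ge>1. \<not> in_Trip \<H> (tensor k (Ubip k))) \<and>
          M_hom_defined \<H> \<and>
          (\<exists>K>0. \<exists>\<epsilon>0>0. \<forall>\<epsilon>::real. 0 < \<epsilon> \<and> \<epsilon> < \<epsilon>0 \<longrightarrow>
              M_reg \<H> \<epsilon> \<le> M_hom \<H> (\<epsilon> ^ 4) \<and>
              real (M_hom \<H> (\<epsilon> ^ 4)) \<le> 2 powr (2 powr (\<epsilon> powr (- K)))))"
proof (cases "\<forall>k\<ge>1. in_Trip \<H> (tensor k (Ubip k))")
  case True
  then show ?thesis using M_reg_bounds[OF assms True] by blast
next
  case False
  then obtain k where "1 \<le> k" and k: "\<not> in_Trip \<H> (tensor k (Ubip k))" by blast
  then show ?thesis using M_hom_bounds[OF assms k] by blast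
qed

end
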